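(* Let $\Omega\subset\mathbb{R}^2$ be an open, bounded, connected set with Lipschitzian boundary, $U=W_0^{1,2}(\Omega;\mathbb{R}^2)\times W_0^{2,2}(\Omega)$, $\mathbf f=(P_1,P_2,P)\in L^2(\Omega;\mathbb{R}^3)$, and let $J:U\to\mathbb{R}$ be $$J(u)=G_1(\gamma(u))+G_2(\kappa(u))-\langle w,P\rangle_{L^2}-\langle u_\alpha,P_\alpha\rangle_{L^2},\qquad u=(u_1,u_2,w)\in U.$$ With $K>0$ and $F^*$, $G^*$, $A^*$, $Y_2^*$ as defined in the context, one has $$\inf_{u\in U}J(u)\ \ge\ \sup_{v^*=(Q,N)\in A^*}\Big\{\inf_{z^*\in Y_2^*}\{-F^*(z^*,Q)+G^*(z^*,N)\}\Big\}.$$ Moreover, denote $$J^*(v^*,z^* )=-F^*(z^*,Q)+G^*(z^*,N),\quad (v^*,z^* )\in A^*\times Y_2^*,\qquad \tilde J^*(v^* )=\inf_{z^*\in Y_2^*}J^*(v^*,z^* ),\quad v^*\in A^*,$$ and suppose there exist $v_0^*=(Q_0,N_0)\in A^*$, $z_0^*\in Y_2^*$ and $u_0=((u_0)_1,(u_0)_2,w_0)\in U$ such that $$\delta\{J^*(v_0^*,z_0^* )-\langle(u_0)_\alpha,(N_0)_{\alpha\beta,\beta}+P_\alpha\rangle_{L^2}-\langle w_0,(Q_0)_{\alpha,\alpha}+P\rangle_{L^2}\}=0.$$ Then $$J(u_0)=\min_{u\in U}J(u)=\max_{v^*\in A^*}\tilde J^*(v^* )=\tilde J^*(v_0^* )=J^*(v_0^*,z_0^*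 ).$$
   Context: Greek indices range over $\{1,2\}$ and repeated indices are summed; subscripts after a comma are distributional partial derivatives; $\langle\cdot,\cdot\rangle_{L^2}$ is the $L^2(\Omega)$ pairing. Tensors: $\{H_{\alpha\beta\lambda\mu}\}$ is a symmetric positive definite fourth order tensor with constant real coefficients (acting on symmetric $2\times2$ matrices), $h_{\alpha\beta\lambda\mu}=\frac{h^2}{12}H_{\alpha\beta\lambda\mu}$ with $h>0$ the plate thickness, and $\{\overline H_{\alpha\beta\lambda\mu}\}=\{H_{\alpha\beta\lambda\mu}\}^{-1}$. For $u=(u_1,u_2,w)\in U$: $$\gamma_{\alpha\beta}(u)=\frac{u_{\alpha,\beta}+u_{\beta,\alpha}}2+\frac{w_{,\alpha}w_{,\beta}}2,\qquad \kappa_{\alpha\beta}(u)=-w_{,\alpha\beta},$$ $$G_1(\gamma(u))=\frac12\int_\Omega H_{\alpha\beta\lambda\mu}\gamma_{\alpha\beta}(u)\gamma_{\lambda\mu}(u)\,dx,\qquad G_2(\kappa(u))=\frac12\int_\Omega h_{\alpha\beta\lambda\mu}\kappa_{\alpha\beta}(u)\kappa_{\lambda\mu}(u)\,dx.$$ Spaces: $Y^*=Y=L^2(\Omega;\mathbb{R}^2)\times L^2(\Omega;\mathbb{R}^{2\times2})$, with elements $v^*=(Q,N)$; $Y_2^*=Y_2=L^2(\Omega;\mathbb{R}^2)$. $K>0$ is a fixed constant. Define $$F(u)=G_2(\kappa(u))+\frac K2\langle w_{,\alpha},w_{,\alpha}\rangle_{L^2},\qquad F^*(z^*,Q)=\sup_{u\in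 U}\{\langle z_\alpha^*+Q_\alpha,w_{,\alpha}\rangle_{L^2}-F(u)\},\quad (z^*,Q)\in[Y_2^*]^2.$$ For $N\in L^2(\Omega;\mathbb{R}^{2\times2})$ let $$\{(-N_{\alpha\beta})^K\}=\begin{pmatrix}-N_{11}+K&-N_{12}\\-N_{21}&-N_{22}+K\end{pmatrix},\qquad \overline{(-N_{\alpha\beta})^K}=\{(-N_{\alpha\beta})^K\}^{-1},$$ and, for $v^*=(Q,N)\in A_3$ and $z^*\in Y_2^*$, $$G^*(z^*,N)=\frac12\int_\Omega\overline{(-N_{\alpha\beta})^K}\,z_\alpha^*z_\beta^*\,dx-\frac12\int_\Omega\overline H_{\alpha\beta\lambda\mu}N_{\alpha\beta}N_{\lambda\mu}\,dx\in(-\infty,+\infty].$$ The set $A^*=A_1\cap A_2\cap A_3\cap A_4$, where - $A_1=\{v^*=(Q,N)\in Y^*: N_{\alpha\beta,\beta}+P_\alpha=0\text{ in }\Omega,\ \forall\alpha\in\{1,2\}\}$, - $A_2=\{v^*=(Q,N)\in Y^*: Q_{\alpha,\alpha}+P=0\text{ in }\Omega\}$, - $A_3=\{v^*=(Q,N)\in Y^*:\{(-N_{\alpha\beta})^K\}\text{ is positive definite in }\Omega\}$ (positive definite matrices being symmetric), - $A_4=\{v^*=(Q,N)\in Y^*:\hat J^*(z^* )>0\ \forall z^*\in Y_2^*,\ z^*\ne\mathbf 0\}$, with $$\hat J^*(z^* )=-F^*(z^*,\mathbf 0)+\frac12\int_\Omega\overline{(-N_{\alpha\beta})^K}\,z_\alpha^*z_\beta^*\,dx.$$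 The condition $\delta\{\cdots\}=0$ means that the first variation (Gâteaux derivative) of the functional $$(Q,N,z^*,u)\mapsto -F^*(z^*,Q)+G^*(z^*,N)-\langle u_\alpha,N_{\alpha\beta,\beta}+P_\alpha\rangle_{L^2}-\langle w,Q_{\alpha,\alpha}+P\rangle_{L^2}$$ with respect to all its variables $Q,N,z^*,u$ vanishes at $(Q_0,N_0,z_0^*,u_0)$; here the pairings with the distributional divergences are $\langle u_\alpha,N_{\alpha\beta,\beta}\rangle=-\langle u_{\alpha,\beta},N_{\alpha\beta}\rangle_{L^2}$ and $\langle w,Q_{\alpha,\alpha}\rangle=-\langle w_{,\alpha},Q_\alpha\rangle_{L^2}$. *)

theory Defs
  imports "HOL-Analysis.Analysis"
begin

section \<open>Sobolev spaces on a plane domain\<close>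

type_synonym plane = "real^2"

text \<open>Functions on \<open>\<Omega>\<close> are total functions on the plane of which only the values on \<open>\<Omega>\<close> matter;
  elements of \<open>L\<^sup>2\<close> are representatives, not equivalence classes, so equality in \<open>L\<^sup>2\<close> is equality
  almost everywhere on \<open>\<Omega>\<close>.\<close>

definition L2 :: "plane set \<Rightarrow> (plane \<Rightarrow> 'b::euclidean_space) set" where
  "L2 \<Omega> = {f. f \<in> borel_measurable (lebesgue_on \<Omega>) \<and>
              integrable (lebesgue_on \<Omega>) (\<lambda>x. (norm (f x))\<^sup>2)}"

definition l2_inner :: "plane set \<Rightarrow> (plane \<Rightarrow> 'b::euclidean_space) \<Rightarrow> (plane \<Rightarrow> 'b) \<Rightarrow> real" where
  "l2_inner \<Omega> f g = (LINT x|lebesgue_on \<Omega>. f x \<bullet> g x)"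

definition partial_deriv :: "2 \<Rightarrow> (plane \<Rightarrow> real) \<Rightarrow> plane \<Rightarrow> real" where
  "partial_deriv i f x = frechet_derivative f (at x) (axis i 1)"

definition partial_derivs :: "2 list \<Rightarrow> (plane \<Rightarrow> real) \<Rightarrow> plane \<Rightarrow> real" where
  "partial_derivs is f = foldr partial_deriv is f"

text \<open>Frechet differentiability of all iterated partial derivatives amounts to \<open>C\<^sup>\<infinity>\<close>.\<close>

definition test_functions :: "plane set \<Rightarrow> (plane \<Rightarrow> real) set" where
  "test_functions \<Omega> = {\<phi>. (\<forall>is. partial_derivs is \<phi> differentiable_on UNIV) \<and>
     compact (closure {x. \<phi> x \<noteq> 0}) \<and> closure {x. \<phi> x \<noteq> 0} \<subseteq> \<Omega>}"

definition has_weak_deriv :: "plane set \<Rightarrow> 2 list \<Rightarrow> (plane \<Rightarrow> real) \<Rightarrow> (plane \<Rightarrow> real) \<Rightarrow> bool" where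
  "has_weak_deriv \<Omega> is f g \<longleftrightarrow> (\<forall>\<phi>\<in>test_functions \<Omega>.
     (LINT x|lebesgue_on \<Omega>. f x * partial_derivs is \<phi> x) =
     (-1) ^ length is * (LINT x|lebesgue_on \<Omega>. g x * \<phi> x))"

text \<open>A chosen representative of the weak derivative; it is unique up to null sets, and it is only
  used for functions whose weak derivative exists in \<open>L\<^sup>2\<close>.\<close>

definition wderiv :: "plane set \<Rightarrow> 2 list \<Rightarrow> (plane \<Rightarrow> real) \<Rightarrow> plane \<Rightarrow> real" where
  "wderiv \<Omega> is f = (SOME g. g \<in> L2 \<Omega> \<and> has_weak_deriv \<Omega> is f g)"

definition W2 :: "plane set \<Rightarrow> nat \<Rightarrow> (plane \<Rightarrow> real) set" where
  "W2 \<Omega> k = {f \<in> L2 \<Omega>. \<forall>is. length is \<le> k \<longrightarrow> (\<exists>g\<in>L2 \<Omega>. has_weak_deriv \<Omega> is f g)}"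

definition sobolev_norm :: "plane set \<Rightarrow> nat \<Rightarrow> (plane \<Rightarrow> real) \<Rightarrow> real" where
  "sobolev_norm \<Omega> k f =
     sqrt (\<Sum>is | length is \<le> k. l2_inner \<Omega> (wderiv \<Omega> is f) (wderiv \<Omega> is f))"

text \<open>\<open>W\<^sub>0\<^sup>k\<^sup>,\<^sup>2(\<Omega>)\<close>: the closure of the test functions in \<open>W\<^sup>k\<^sup>,\<^sup>2(\<Omega>)\<close>.\<close>

definition W20 :: "plane set \<Rightarrow> nat \<Rightarrow> (plane \<Rightarrow> real) set" where
  "W20 \<Omega> k = {f \<in> W2 \<Omega> k. \<exists>\<phi>. (\<forall>n. \<phi> n \<in> test_functions \<Omega>) \<and>
     (\<lambda>n. sobolev_norm \<Omega> k (\<lambda>x. f x - \<phi> n x)) \<longlonglongrightarrow> 0}"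

text \<open>Near each boundary point \<open>\<Omega>\<close> is, in suitable Cartesian coordinates, the region below the graph
  of a Lipschitz function; translations are absorbed into \<open>g\<close>.\<close>

definition lipschitz_boundary :: "plane set \<Rightarrow> bool" where
  "lipschitz_boundary \<Omega> \<longleftrightarrow> (\<forall>x\<in>frontier \<Omega>. \<exists>(T :: plane \<Rightarrow> plane) r (g :: real \<Rightarrow> real) L.
     orthogonal_transformation T \<and> r > 0 \<and> L-lipschitz_on UNIV g \<and>
     (\<forall>y\<in>ball x r. y \<in> \<Omega> \<longleftrightarrow> T y $ 2 < g (T y $ 1)))"

section \<open>Fourth order tensors\<close>

type_synonym tensor4 = "2 \<Rightarrow> 2 \<Rightarrow> 2 \<Rightarrow> 2 \<Rightarrow> real"

definition tensor_app :: "tensor4 \<Rightarrow> real^2^2 \<Rightarrow> real^2^2" where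
  "tensor_app H T = (\<chi> \<alpha> \<beta>. \<Sum>\<rho>\<in>UNIV. \<Sum>\<mu>\<in>UNIV. H \<alpha> \<beta> \<rho> \<mu> * T $ \<rho> $ \<mu>)"

definition minor_symmetric :: "tensor4 \<Rightarrow> bool" where
  "minor_symmetric H \<longleftrightarrow> (\<forall>\<alpha> \<beta> \<rho> \<mu>. H \<alpha> \<beta> \<rho> \<mu> = H \<beta> \<alpha> \<rho> \<mu> \<and> H \<alpha> \<beta> \<rho> \<mu> = H \<alpha> \<beta> \<mu> \<rho>)"

definition symmetric_tensor :: "tensor4 \<Rightarrow> bool" where
  "symmetric_tensor H \<longleftrightarrow> minor_symmetric H \<and> (\<forall>\<alpha> \<beta> \<rho> \<mu>. H \<alpha> \<beta> \<rho> \<mu> = H \<rho> \<mu> \<alpha> \<beta>)"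

definition pos_def_tensor :: "tensor4 \<Rightarrow> bool" where
  "pos_def_tensor H \<longleftrightarrow> (\<forall>T. transpose T = T \<and> T \<noteq> 0 \<longrightarrow> T \<bullet> tensor_app H T > 0)"

text \<open>The inverse of \<open>H\<close> as an operator on symmetric matrices. Minor symmetry makes the
  coefficients of the inverse unique.\<close>

definition tensor_inv :: "tensor4 \<Rightarrow> tensor4" where
  "tensor_inv H = (THE B. minor_symmetric B \<and>
     (\<forall>T. transpose T = T \<longrightarrow> tensor_app B (tensor_app H T) = T))"

definition bending_tensor :: "real \<Rightarrow> tensor4 \<Rightarrow> tensor4" where
  "bending_tensor h H = (\<lambda>\<alpha> \<beta> \<rho> \<mu>. h\<^sup>2 / 12 * H \<alpha> \<beta> \<rho> \<mu>)"

section \<open>The primal functional\<close>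

text \<open>A displacement field \<open>(v, w)\<close> has in-plane part \<open>v = (u\<^sub>1, u\<^sub>2)\<close> and transversal part \<open>w\<close>;
  the load is likewise given by its in-plane part \<open>p = (P\<^sub>1, P\<^sub>2)\<close> and its transversal part \<open>P\<close>.\<close>

type_synonym displacement = "(plane \<Rightarrow> real^2) \<times> (plane \<Rightarrow> real)"

definition U :: "plane set \<Rightarrow> displacement set" where
  "U \<Omega> = {(v, w). (\<forall>\<alpha>. (\<lambda>x. v x $ \<alpha>) \<in> W20 \<Omega> 1) \<and> w \<in> W20 \<Omega> 2}"

definition wgrad :: "plane set \<Rightarrow> (plane \<Rightarrow> real) \<Rightarrow> plane \<Rightarrow> real^2" where
  "wgrad \<Omega> w x = (\<chi> \<alpha>. wderiv \<Omega> [\<alpha>] w x)"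

text \<open>The entry \<open>(\<alpha>, \<beta>)\<close> is \<open>u\<^sub>\<alpha>\<^sub>,\<^sub>\<beta>\<close>.\<close>

definition wjac :: "plane set \<Rightarrow> (plane \<Rightarrow> real^2) \<Rightarrow> plane \<Rightarrow> real^2^2" where
  "wjac \<Omega> v x = (\<chi> \<alpha> \<beta>. wderiv \<Omega> [\<beta>] (\<lambda>y. v y $ \<alpha>) x)"

definition strain :: "plane set \<Rightarrow> displacement \<Rightarrow> plane \<Rightarrow> real^2^2" where
  "strain \<Omega> u x = (case u of (v, w) \<Rightarrow>
     \<chi> \<alpha> \<beta>. (wjac \<Omega> v x $ \<alpha> $ \<beta> + wjac \<Omega> v x $ \<beta> $ \<alpha>) / 2
           + wgrad \<Omega> w x $ \<alpha> * wgrad \<Omega> w x $ \<beta> / 2)"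

definition curvature :: "plane set \<Rightarrow> displacement \<Rightarrow> plane \<Rightarrow> real^2^2" where
  "curvature \<Omega> u x = (case u of (v, w) \<Rightarrow> \<chi> \<alpha> \<beta>. - wderiv \<Omega> [\<alpha>, \<beta>] w x)"

definition G1 :: "plane set \<Rightarrow> tensor4 \<Rightarrow> (plane \<Rightarrow> real^2^2) \<Rightarrow> real" where
  "G1 \<Omega> H \<gamma> = 1/2 * l2_inner \<Omega> \<gamma> (\<lambda>x. tensor_app H (\<gamma> x))"

definition G2 :: "plane set \<Rightarrow> tensor4 \<Rightarrow> real \<Rightarrow> (plane \<Rightarrow> real^2^2) \<Rightarrow> real" where
  "G2 \<Omega> H h \<kappa> = 1/2 * l2_inner \<Omega> \<kappa> (\<lambda>x. tensor_app (bending_tensor h H) (\<kappa> x))"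

definition J :: "plane set \<Rightarrow> tensor4 \<Rightarrow> real \<Rightarrow> (plane \<Rightarrow> real^2) \<Rightarrow> (plane \<Rightarrow> real) \<Rightarrow>
    displacement \<Rightarrow> real" where
  "J \<Omega> H h p P u = G1 \<Omega> H (strain \<Omega> u) + G2 \<Omega> H h (curvature \<Omega> u)
     - l2_inner \<Omega> (snd u) P - l2_inner \<Omega> (fst u) p"

section \<open>The dual functionals\<close>

definition F :: "plane set \<Rightarrow> tensor4 \<Rightarrow> real \<Rightarrow> real \<Rightarrow> displacement \<Rightarrow> real" where
  "F \<Omega> H h K u = G2 \<Omega> H h (curvature \<Omega> u)
     + K/2 * l2_inner \<Omega> (wgrad \<Omega> (snd u)) (wgrad \<Omega> (snd u))"

definition F_star :: "plane set \<Rightarrow> tensor4 \<Rightarrow> real \<Rightarrow> real \<Rightarrow>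
    (plane \<Rightarrow> real^2) \<Rightarrow> (plane \<Rightarrow> real^2) \<Rightarrow> ereal" where
  "F_star \<Omega> H h K z Q =
     (SUP u\<in>U \<Omega>. ereal (l2_inner \<Omega> (\<lambda>x. z x + Q x) (wgrad \<Omega> (snd u)) - F \<Omega> H h K u))"

definition NK :: "real \<Rightarrow> real^2^2 \<Rightarrow> real^2^2" where
  "NK K N = mat K - N"

definition pos_def_matrix :: "real^2^2 \<Rightarrow> bool" where
  "pos_def_matrix A \<longleftrightarrow> transpose A = A \<and> (\<forall>\<xi>. \<xi> \<noteq> 0 \<longrightarrow> \<xi> \<bullet> (A *v \<xi>) > 0)"

text \<open>The integral of \<open>(-N)\<^sup>K\<close> inverted, applied to \<open>(z, z)\<close>. The integrand is nonnegative a.e. when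
  \<open>(-N)\<^sup>K\<close> is positive definite a.e., the only case in which this is used; the integral may be \<open>\<infinity>\<close>.\<close>

definition inv_NK_form :: "plane set \<Rightarrow> real \<Rightarrow> (plane \<Rightarrow> real^2^2) \<Rightarrow> (plane \<Rightarrow> real^2) \<Rightarrow> ereal" where
  "inv_NK_form \<Omega> K N z =
     enn2ereal (\<integral>\<^sup>+x. ennreal (z x \<bullet> (matrix_inv (NK K (N x)) *v z x)) \<partial>lebesgue_on \<Omega>)"

definition G_star :: "plane set \<Rightarrow> tensor4 \<Rightarrow> real \<Rightarrow> (plane \<Rightarrow> real^2) \<Rightarrow> (plane \<Rightarrow> real^2^2) \<Rightarrow> ereal" where
  "G_star \<Omega> H K z N = ereal (1/2) * inv_NK_form \<Omega> K N z
     - ereal (1/2 * l2_inner \<Omega> N (\<lambda>x. tensor_app (tensor_inv H) (N x)))"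

type_synonym dual_var = "(plane \<Rightarrow> real^2) \<times> (plane \<Rightarrow> real^2^2)"

definition Y_star :: "plane set \<Rightarrow> dual_var set" where
  "Y_star \<Omega> = L2 \<Omega> \<times> L2 \<Omega>"

text \<open>The equilibrium equations hold in the sense of distributions.\<close>

definition A1 :: "plane set \<Rightarrow> (plane \<Rightarrow> real^2) \<Rightarrow> dual_var set" where
  "A1 \<Omega> p = {(Q, N) \<in> Y_star \<Omega>. \<forall>\<alpha>. \<forall>\<phi>\<in>test_functions \<Omega>.
     - (\<Sum>\<beta>\<in>UNIV. LINT x|lebesgue_on \<Omega>. N x $ \<alpha> $ \<beta> * partial_deriv \<beta> \<phi> x)
     + (LINT x|lebesgue_on \<Omega>. p x $ \<alpha> * \<phi> x) = 0}"

definition A2 :: "plane set \<Rightarrow> (plane \<Rightarrow> real) \<Rightarrow> dual_var set" where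
  "A2 \<Omega> P = {(Q, N) \<in> Y_star \<Omega>. \<forall>\<phi>\<in>test_functions \<Omega>.
     - (\<Sum>\<alpha>\<in>UNIV. LINT x|lebesgue_on \<Omega>. Q x $ \<alpha> * partial_deriv \<alpha> \<phi> x)
     + (LINT x|lebesgue_on \<Omega>. P x * \<phi> x) = 0}"

definition A3 :: "plane set \<Rightarrow> real \<Rightarrow> dual_var set" where
  "A3 \<Omega> K = {(Q, N) \<in> Y_star \<Omega>. AE x in lebesgue_on \<Omega>. pos_def_matrix (NK K (N x))}"

definition J_hat :: "plane set \<Rightarrow> tensor4 \<Rightarrow> real \<Rightarrow> real \<Rightarrow> (plane \<Rightarrow> real^2^2) \<Rightarrow> (plane \<Rightarrow> real^2) \<Rightarrow> ereal" where
  "J_hat \<Omega> H h K N z = - F_star \<Omega> H h K z (\<lambda>x. 0) + ereal (1/2) * inv_NK_form \<Omega> K N z"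

definition A4 :: "plane set \<Rightarrow> tensor4 \<Rightarrow> real \<Rightarrow> real \<Rightarrow> dual_var set" where
  "A4 \<Omega> H h K = {(Q, N) \<in> Y_star \<Omega>. \<forall>z\<in>L2 \<Omega>.
     \<not> (AE x in lebesgue_on \<Omega>. z x = 0) \<longrightarrow> J_hat \<Omega> H h K N z > 0}"

definition A_star :: "plane set \<Rightarrow> tensor4 \<Rightarrow> real \<Rightarrow> real \<Rightarrow> (plane \<Rightarrow> real^2) \<Rightarrow> (plane \<Rightarrow> real) \<Rightarrow>
    dual_var set" where
  "A_star \<Omega> H h K p P = A1 \<Omega> p \<inter> A2 \<Omega> P \<inter> A3 \<Omega> K \<inter> A4 \<Omega> H h K"

definition J_star :: "plane set \<Rightarrow> tensor4 \<Rightarrow> real \<Rightarrow> real \<Rightarrow> dual_var \<Rightarrow> (plane \<Rightarrow> real^2) \<Rightarrow> ereal" where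
  "J_star \<Omega> H h K v z = - F_star \<Omega> H h K z (fst v) + G_star \<Omega> H K z (snd v)"

definition J_tilde :: "plane set \<Rightarrow> tensor4 \<Rightarrow> real \<Rightarrow> real \<Rightarrow> dual_var \<Rightarrow> ereal" where
  "J_tilde \<Omega> H h K v = (INF z\<in>L2 \<Omega>. J_star \<Omega> H h K v z)"

section \<open>The stationarity condition\<close>

text \<open>The pairings of a displacement with the distributional divergences of \<open>N\<close> and \<open>Q\<close>.\<close>

definition lagrangian :: "plane set \<Rightarrow> tensor4 \<Rightarrow> real \<Rightarrow> real \<Rightarrow> (plane \<Rightarrow> real^2) \<Rightarrow> (plane \<Rightarrow> real) \<Rightarrow>
    dual_var \<Rightarrow> (plane \<Rightarrow> real^2) \<Rightarrow> displacement \<Rightarrow> ereal" where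
  "lagrangian \<Omega> H h K p P v z u = J_star \<Omega> H h K v z
     - ereal (- l2_inner \<Omega> (wjac \<Omega> (fst u)) (snd v) + l2_inner \<Omega> (fst u) p)
     - ereal (- l2_inner \<Omega> (wgrad \<Omega> (snd u)) (fst v) + l2_inner \<Omega> (snd u) P)"

definition shift :: "('a \<Rightarrow> 'b::real_vector) \<Rightarrow> real \<Rightarrow> ('a \<Rightarrow> 'b) \<Rightarrow> 'a \<Rightarrow> 'b" where
  "shift f t g = (\<lambda>x. f x + t *\<^sub>R g x)"

text \<open>The Lagrangian is defined only where \<open>(-N)\<^sup>K\<close> is positive definite, may be \<open>\<infinity>\<close> there,
  and that set has no interior in \<open>L\<^sup>2\<close>. So the Gateaux derivative at a point where the
  Lagrangian is finite is taken in those directions along which, for all small \<open>t\<close> of either sign, the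
  Lagrangian is defined and finite.\<close>

definition first_variation_vanishes :: "plane set \<Rightarrow> tensor4 \<Rightarrow> real \<Rightarrow> real \<Rightarrow>
    (plane \<Rightarrow> real^2) \<Rightarrow> (plane \<Rightarrow> real) \<Rightarrow> dual_var \<Rightarrow> (plane \<Rightarrow> real^2) \<Rightarrow> displacement \<Rightarrow> bool" where
  "first_variation_vanishes \<Omega> H h K p P v0 z0 u0 \<longleftrightarrow>
     \<bar>lagrangian \<Omega> H h K p P v0 z0 u0\<bar> \<noteq> \<infinity> \<and>
     (\<forall>v\<in>Y_star \<Omega>. \<forall>z\<in>L2 \<Omega>. \<forall>u\<in>U \<Omega>.
        let v' = (\<lambda>t. (shift (fst v0) t (fst v), shift (snd v0) t (snd v)));
            z' = (\<lambda>t. shift z0 t z);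
            u' = (\<lambda>t. (shift (fst u0) t (fst u), shift (snd u0) t (snd u)));
            \<Phi> = (\<lambda>t. lagrangian \<Omega> H h K p P (v' t) (z' t) (u' t))
        in (\<forall>\<^sub>F t in at 0. v' t \<in> A3 \<Omega> K \<and> \<bar>\<Phi> t\<bar> \<noteq> \<infinity>) \<longrightarrow>
           ((\<lambda>t. real_of_ereal (\<Phi> t)) has_real_derivative 0) (at 0))"

end

theory Submission
  imports Defs
begin

text \<open>Write \<open>A = (-N)\<^sup>K\<close> and \<open>\<Phi>(y) = F\<^sup>*(z, Q)\<close> for \<open>y = z + Q\<close>.

  Weak duality. Equilibrium of \<open>(Q, N)\<close> and the Fenchel-Young inequality for \<open>H\<close> give
  \<open>J(u) \<ge> F(u) - \<langle>Q, \<nabla>w\<rangle> - \<langle>A \<nabla>w, \<nabla>w\<rangle>/2 - \<langle>N, H\<^sup>-\<^sup>1 N\<rangle>/2\<close>, and \<open>z = A \<nabla>w\<close> would make the right hand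
  side an upper bound of \<open>J\<^sup>*(v, z)\<close>. This \<open>z\<close> need not be in \<open>L\<^sup>2\<close>, so it is truncated to the sets
  \<open>|A| \<le> n\<close>; the limit exists because \<open>\<nabla>w\<close> is in \<open>L\<^sup>4\<close> by Ladyzhenskaya's inequality.

  Stationary points. Variations of \<open>Q\<close> alone show that \<open>\<nabla>w\<^sub>0\<close> is a subgradient of \<open>\<Phi>\<close> at \<open>y\<^sub>0 = z\<^sub>0 + Q\<^sub>0\<close>,
  hence \<open>w\<^sub>0\<close> attains the supremum defining \<open>\<Phi>(y\<^sub>0)\<close>. Opposite variations of \<open>z\<close> and \<open>Q\<close> leave \<open>y\<^sub>0\<close>
  fixed and give \<open>z\<^sub>0 = A \<nabla>w\<^sub>0\<close>; varying \<open>N\<close> by \<open>M\<close> together with \<open>z\<close> by \<open>-M \<nabla>w\<^sub>0\<close> and \<open>Q\<close> by \<open>M \<nabla>w\<^sub>0\<close>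
  gives \<open>\<gamma>(u\<^sub>0) = H\<^sup>-\<^sup>1 N\<^sub>0\<close>. So all the inequalities above are equalities at \<open>u\<^sub>0\<close>. Since \<open>F\<close> is quadratic,
  \<open>\<Phi>(y\<^sub>0 + \<zeta>) \<le> \<Phi>(y\<^sub>0) + \<langle>\<nabla>w\<^sub>0, \<zeta>\<rangle> + \<Phi>(\<zeta>)\<close>, and the positivity of \<open>J_hat\<close> makes \<open>z\<^sub>0\<close> a minimizer.\<close>

section \<open>Square integrable fields\<close>

text \<open>The obstacle behind most constructions is that \<open>A\<close> is merely square
  integrable: it is unbounded, its smaller eigenvalue may come arbitrarily close to 0, and positive
  definiteness almost everywhere is not an open condition in \<open>L2\<close>. The inverse form can
  be infinite, and only special directions keep the Lagrangian finite around \<open>t = 0\<close>.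
  The variations of \<open>z\<close> and \<open>N\<close> are therefore built from a residual
  multiplied by a positive pointwise weight that compensates for the size of \<open>A\<close> and of
  the residual. The derivative becomes the integral of weight times squared residual, so its
  vanishing makes the residual vanish almost everywhere. The directions are shaped so that the
  inverse matrix cancels; for the variation of \<open>N\<close> this presupposes the identity for
  \<open>z0\<close>. Differentiability of the conjugate is never assumed: it is read off from that
  of the Lagrangian, whose other terms are polynomial in \<open>t\<close>. As a function of
  \<open>z\<close>, \<open>J_star\<close> is a difference of convex functions, so stationarity alone
  gives no minimum; \<open>J_hat\<close> bounds its growth away from \<open>z0\<close> from below,
  once the linear terms have cancelled.\<close>

lemma L2_measurable: "f \<in> L2 \<Omega> \<Longrightarrow> f \<in> borel_measurable (lebesgue_on \<Omega>)"
  by (simp add: L2_def)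

lemma L2_integrable: "f \<in> L2 \<Omega> \<Longrightarrow> integrable (lebesgue_on \<Omega>) (\<lambda>x. (norm (f x))\<^sup>2)"
  by (simp add: L2_def)

lemma L2_I:
  assumes "f \<in> borel_measurable (lebesgue_on \<Omega>)" "integrable (lebesgue_on \<Omega>) g"
    "AE x in lebesgue_on \<Omega>. (norm (f x))\<^sup>2 \<le> g x"
  shows "f \<in> L2 \<Omega>"
proof -
  have "integrable (lebesgue_on \<Omega>) (\<lambda>x. (norm (f x))\<^sup>2)"
    by (rule Bochner_Integration.integrable_bound[OF assms(2)])
      (use assms in \<open>auto elim!: eventually_mono\<close>)
  then show ?thesis using assms by (simp add: L2_def)
qed

lemma L2_add:
  assumes "f \<in> L2 \<Omega>" "g \<in> L2 \<Omega>"
  shows "(\<lambda>x. f x + g x) \<in> L2 \<Omega>"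
proof (rule L2_I)
  show "integrable (lebesgue_on \<Omega>) (\<lambda>x. 2 * (norm (f x))\<^sup>2 + 2 * (norm (g x))\<^sup>2)"
    using assms by (auto simp: L2_def)
  have "(norm (a + b))\<^sup>2 \<le> 2 * (norm a)\<^sup>2 + 2 * (norm b)\<^sup>2" for a b :: 'a
    using zero_le_power2[of "norm (a - b)"]
    by (simp add: power2_norm_eq_inner inner_add_left inner_add_right inner_diff_left inner_diff_right
        inner_commute[of b a])
  then show "AE x in lebesgue_on \<Omega>. (norm (f x + g x))\<^sup>2 \<le> 2 * (norm (f x))\<^sup>2 + 2 * (norm (g x))\<^sup>2"
    by simp
qed (use assms in \<open>auto simp: L2_def\<close>)

lemma L2_bounded_linear:
  assumes "f \<in> L2 \<Omega>" "bounded_linear T"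
  shows "(\<lambda>x. T (f x)) \<in> L2 \<Omega>"
proof -
  obtain C where C: "\<And>x. norm (T x) \<le> norm x * C"
    using bounded_linear.bounded[OF assms(2)] by auto
  have le: "(norm (T y))\<^sup>2 \<le> C\<^sup>2 * (norm y)\<^sup>2" for y
    using power_mono[OF C[of y] norm_ge_zero, of 2] by (simp add: power_mult_distrib mult.commute)
  have "T \<in> borel_measurable borel"
    by (intro borel_measurable_continuous_onI linear_continuous_on assms)
  with L2_measurable[OF assms(1)] have "(\<lambda>x. T (f x)) \<in> borel_measurable (lebesgue_on \<Omega>)"
    by (rule measurable_compose)
  then show ?thesis
    by (rule L2_I[where g="\<lambda>x. C\<^sup>2 * (norm (f x))\<^sup>2"]) (use le L2_integrable[OF assms(1)] in auto)
qed

lemma L2_scaleR: "f \<in> L2 \<Omega> \<Longrightarrow> (\<lambda>x. c *\<^sub>R f x) \<in> L2 \<Omega>"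
  by (rule L2_bounded_linear) (auto intro: bounded_linear_scaleR_right)

lemma L2_minus: "f \<in> L2 \<Omega> \<Longrightarrow> (\<lambda>x. - f x) \<in> L2 \<Omega>"
  using L2_scaleR[of f \<Omega> "-1"] by simp

lemma L2_diff: "f \<in> L2 \<Omega> \<Longrightarrow> g \<in> L2 \<Omega> \<Longrightarrow> (\<lambda>x. f x - g x) \<in> L2 \<Omega>"
  using L2_add[OF _ L2_minus, of f \<Omega> g] by simp

lemma L2_cmult: "f \<in> L2 \<Omega> \<Longrightarrow> (\<lambda>x. c * f x) \<in> L2 \<Omega>" for f :: "plane \<Rightarrow> real"
  using L2_scaleR[of f \<Omega> c] by simp

lemma L2_zero: "(\<lambda>x. 0) \<in> L2 \<Omega>"
  by (simp add: L2_def)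

lemma L2_sum:
  assumes "\<And>i. i \<in> I \<Longrightarrow> f i \<in> L2 \<Omega>"
  shows "(\<lambda>x. \<Sum>i\<in>I. f i x) \<in> L2 \<Omega>"
  using assms by (induction I rule: infinite_finite_induct) (auto intro: L2_zero L2_add)

lemma L2_nth: "f \<in> L2 \<Omega> \<Longrightarrow> (\<lambda>x. f x $ i) \<in> L2 \<Omega>"
  for f :: "plane \<Rightarrow> 'a::euclidean_space ^ 'n::finite"
  by (rule L2_bounded_linear[of f \<Omega> "\<lambda>y. y $ i"]) (auto intro: bounded_linear_vec_nth)

lemma L2_axis: "f \<in> L2 \<Omega> \<Longrightarrow> (\<lambda>x. axis i (f x)) \<in> L2 \<Omega>"
  for f :: "plane \<Rightarrow> 'a::euclidean_space"
proof (rule L2_bounded_linear[of f \<Omega> "axis i"])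
  show "bounded_linear (axis i :: 'a \<Rightarrow> 'a ^ 'b)"
    by (rule linear_conv_bounded_linear[THEN iffD1]) (auto simp: linear_iff axis_def vec_eq_iff)
qed

lemma L2_vec:
  fixes f :: "plane \<Rightarrow> 'a::euclidean_space ^ 'n::finite"
  assumes "\<And>i. (\<lambda>x. f x $ i) \<in> L2 \<Omega>"
  shows "f \<in> L2 \<Omega>"
proof -
  have "f = (\<lambda>x. \<Sum>i\<in>UNIV. axis i (f x $ i))"
    by (auto simp: fun_eq_iff vec_eq_iff axis_def)
  moreover have "(\<lambda>x. \<Sum>i\<in>UNIV. axis i (f x $ i)) \<in> L2 \<Omega>"
    by (intro L2_sum L2_axis assms)
  ultimately show ?thesis by simp
qed

lemma L2_inner_integrable:
  assumes "f \<in> L2 \<Omega>" "g \<in> L2 \<Omega>"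
  shows "integrable (lebesgue_on \<Omega>) (\<lambda>x. f x \<bullet> g x)"
proof (rule Bochner_Integration.integrable_bound)
  show "integrable (lebesgue_on \<Omega>) (\<lambda>x. (norm (f x))\<^sup>2 + (norm (g x))\<^sup>2)"
    using assms by (auto simp: L2_def)
  have "\<bar>a \<bullet> b\<bar> \<le> (norm a)\<^sup>2 + (norm b)\<^sup>2" for a b :: 'a
    using Cauchy_Schwarz_ineq2[of a b] sum_squares_bound[of "norm a" "norm b"]
      mult_nonneg_nonneg[OF norm_ge_zero[of a] norm_ge_zero[of b]] by linarith
  then show "AE x in lebesgue_on \<Omega>. norm (f x \<bullet> g x) \<le> norm ((norm (f x))\<^sup>2 + (norm (g x))\<^sup>2)"
    by simp
qed (use assms in \<open>auto simp: L2_def\<close>)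

lemma L2_mult_integrable:
  "f \<in> L2 \<Omega> \<Longrightarrow> g \<in> L2 \<Omega> \<Longrightarrow> integrable (lebesgue_on \<Omega>) (\<lambda>x. f x * g x)"
  for f :: "plane \<Rightarrow> real"
  using L2_inner_integrable[of f \<Omega> g] by simp

lemma L2_bounded:
  assumes "f \<in> borel_measurable (lebesgue_on \<Omega>)" "\<Omega> \<in> lmeasurable"
    "AE x in lebesgue_on \<Omega>. norm (f x) \<le> C"
  shows "f \<in> L2 \<Omega>"
proof (rule L2_I[OF assms(1), where g="\<lambda>x. C\<^sup>2"])
  interpret finite_measure "lebesgue_on \<Omega>"
    using assms(2) by (rule finite_measure_lebesgue_on)
  show "integrable (lebesgue_on \<Omega>) (\<lambda>x. C\<^sup>2)" by simp
  show "AE x in lebesgue_on \<Omega>. (norm (f x))\<^sup>2 \<le> C\<^sup>2"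
    using assms(3) by eventually_elim (rule power_mono, auto)
qed

lemma l2_inner_commute: "l2_inner \<Omega> f g = l2_inner \<Omega> g f"
  by (simp add: l2_inner_def inner_commute)

lemma l2_inner_cong_AE:
  assumes "f \<in> L2 \<Omega>" "f' \<in> L2 \<Omega>" "g \<in> L2 \<Omega>" "g' \<in> L2 \<Omega>"
    "AE x in lebesgue_on \<Omega>. f x = f' x" "AE x in lebesgue_on \<Omega>. g x = g' x"
  shows "l2_inner \<Omega> f g = l2_inner \<Omega> f' g'"
  unfolding l2_inner_def
proof (rule integral_cong_AE)
  show "AE x in lebesgue_on \<Omega>. f x \<bullet> g x = f' x \<bullet> g' x"
    using assms(5,6) by eventually_elim simp
qed (use assms in \<open>auto simp: L2_def\<close>)

lemma l2_inner_add_left: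
  "f \<in> L2 \<Omega> \<Longrightarrow> g \<in> L2 \<Omega> \<Longrightarrow> k \<in> L2 \<Omega> \<Longrightarrow>
    l2_inner \<Omega> (\<lambda>x. f x + g x) k = l2_inner \<Omega> f k + l2_inner \<Omega> g k"
  unfolding l2_inner_def inner_add_left
  by (rule Bochner_Integration.integral_add) (auto intro: L2_inner_integrable)

lemma l2_inner_scaleR_left: "l2_inner \<Omega> (\<lambda>x. c *\<^sub>R f x) k = c * l2_inner \<Omega> f k"
  unfolding l2_inner_def by simp

lemma l2_inner_diff_left:
  "f \<in> L2 \<Omega> \<Longrightarrow> g \<in> L2 \<Omega> \<Longrightarrow> k \<in> L2 \<Omega> \<Longrightarrow>
    l2_inner \<Omega> (\<lambda>x. f x - g x) k = l2_inner \<Omega> f k - l2_inner \<Omega> g k"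
  unfolding l2_inner_def inner_diff_left
  by (rule Bochner_Integration.integral_diff) (auto intro: L2_inner_integrable)

lemma l2_inner_add_right:
  "f \<in> L2 \<Omega> \<Longrightarrow> g \<in> L2 \<Omega> \<Longrightarrow> k \<in> L2 \<Omega> \<Longrightarrow>
    l2_inner \<Omega> k (\<lambda>x. f x + g x) = l2_inner \<Omega> k f + l2_inner \<Omega> k g"
  using l2_inner_add_left[of f \<Omega> g k] by (simp add: l2_inner_commute)

lemma l2_inner_scaleR_right: "l2_inner \<Omega> k (\<lambda>x. c *\<^sub>R f x) = c * l2_inner \<Omega> k f"
  unfolding l2_inner_def by simp

lemma l2_inner_diff_right:
  "f \<in> L2 \<Omega> \<Longrightarrow> g \<in> L2 \<Omega> \<Longrightarrow> k \<in> L2 \<Omega> \<Longrightarrow>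
    l2_inner \<Omega> k (\<lambda>x. f x - g x) = l2_inner \<Omega> k f - l2_inner \<Omega> k g"
  using l2_inner_diff_left[of f \<Omega> g k] by (simp add: l2_inner_commute)

lemma l2_inner_self: "l2_inner \<Omega> f f = (LINT x|lebesgue_on \<Omega>. (norm (f x))\<^sup>2)"
  by (simp add: l2_inner_def power2_norm_eq_inner)

lemma l2_inner_self_nonneg: "0 \<le> l2_inner \<Omega> f f"
  by (simp add: l2_inner_def)

lemma l2_inner_self_eq_0:
  assumes "f \<in> L2 \<Omega>" "l2_inner \<Omega> f f = 0"
  shows "AE x in lebesgue_on \<Omega>. f x = 0"
proof -
  have "AE x in lebesgue_on \<Omega>. f x \<bullet> f x = 0"
    using integral_nonneg_eq_0_iff_AE[OF L2_inner_integrable[OF assms(1,1)]] assms(2)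
    by (simp add: l2_inner_def)
  then show ?thesis by simp
qed

lemma l2_cauchy_schwarz:
  assumes f: "f \<in> L2 \<Omega>" and g: "g \<in> L2 \<Omega>"
  shows "(l2_inner \<Omega> f g)\<^sup>2 \<le> l2_inner \<Omega> f f * l2_inner \<Omega> g g"
proof -
  have q: "0 \<le> l2_inner \<Omega> f f - 2 * t * l2_inner \<Omega> f g + t\<^sup>2 * l2_inner \<Omega> g g" for t
  proof -
    have "0 \<le> l2_inner \<Omega> (\<lambda>x. f x - t *\<^sub>R g x) (\<lambda>x. f x - t *\<^sub>R g x)"
      by (rule l2_inner_self_nonneg)
    also have "\<dots> = l2_inner \<Omega> f f - 2 * t * l2_inner \<Omega> f g + t\<^sup>2 * l2_inner \<Omega> g g"
      using f g
      by (simp add: l2_inner_diff_left l2_inner_diff_right L2_diff L2_scaleR l2_inner_scaleR_left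
          l2_inner_scaleR_right l2_inner_commute[of \<Omega> g f] power2_eq_square algebra_simps)
    finally show ?thesis .
  qed
  show ?thesis
  \<comment> \<open>The quadratic in \<open>t\<close> is evaluated at its minimizer, the quotient of
    the pairings of \<open>g\<close> with \<open>f\<close> and with itself; it exists unless
    \<open>g\<close> vanishes almost everywhere.\<close>
  proof (cases "l2_inner \<Omega> g g = 0")
    case True
    then have "AE x in lebesgue_on \<Omega>. g x = 0" using g l2_inner_self_eq_0 by blast
    then have "l2_inner \<Omega> f g = l2_inner \<Omega> f (\<lambda>x. 0)"
      by (intro l2_inner_cong_AE) (use f g L2_zero in auto)
    then show ?thesis using True by (simp add: l2_inner_def)
  next
    case False
    then have pos: "l2_inner \<Omega> g g > 0" using l2_inner_self_nonneg[of \<Omega> g] by simp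
    have "0 \<le> l2_inner \<Omega> f f - (l2_inner \<Omega> f g)\<^sup>2 / l2_inner \<Omega> g g"
      using q[of "l2_inner \<Omega> f g / l2_inner \<Omega> g g"] pos
      by (simp add: power2_eq_square field_simps)
    then show ?thesis using pos by (simp add: field_simps)
  qed
qed

text \<open>By Cauchy-Schwarz the error is at most the \<open>L2\<close> distance times the norm of
  \<open>g\<close>. Identities known for test functions pass to \<open>W20\<close> through this
  limit.\<close>

lemma l2_inner_tendsto:
  assumes "\<And>n. f n \<in> L2 \<Omega>" "f' \<in> L2 \<Omega>" "g \<in> L2 \<Omega>"
    "(\<lambda>n. l2_inner \<Omega> (\<lambda>x. f' x - f n x) (\<lambda>x. f' x - f n x)) \<longlonglongrightarrow> 0"
  shows "(\<lambda>n. l2_inner \<Omega> (f n) g) \<longlonglongrightarrow> l2_inner \<Omega> f' g"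
proof -
  let ?d = "\<lambda>n. l2_inner \<Omega> (\<lambda>x. f' x - f n x) (\<lambda>x. f' x - f n x)"
  have "(\<lambda>n. sqrt (?d n * l2_inner \<Omega> g g)) \<longlonglongrightarrow> sqrt (0 * l2_inner \<Omega> g g)"
    by (intro tendsto_intros assms)
  then have lim: "(\<lambda>n. sqrt (?d n * l2_inner \<Omega> g g)) \<longlonglongrightarrow> 0" by simp
  have "(\<lambda>n. l2_inner \<Omega> f' g - l2_inner \<Omega> (f n) g) \<longlonglongrightarrow> 0"
  proof (rule Lim_null_comparison[OF _ lim], intro always_eventually allI)
    fix n
    have "(l2_inner \<Omega> f' g - l2_inner \<Omega> (f n) g)\<^sup>2 \<le> ?d n * l2_inner \<Omega> g g"
      using l2_cauchy_schwarz[OF L2_diff[OF assms(2) assms(1)[of n]] assms(3)]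
      by (simp add: l2_inner_diff_left assms)
    then show "norm (l2_inner \<Omega> f' g - l2_inner \<Omega> (f n) g) \<le> sqrt (?d n * l2_inner \<Omega> g g)"
      by (simp add: real_le_rsqrt)
  qed
  then have "(\<lambda>n. l2_inner \<Omega> f' g - (l2_inner \<Omega> f' g - l2_inner \<Omega> (f n) g)) \<longlonglongrightarrow> l2_inner \<Omega> f' g - 0"
    by (intro tendsto_diff tendsto_const)
  then show ?thesis by simp
qed

section \<open>Smooth bumps and the fundamental lemma\<close>

text \<open>Differentiability \<open>k\<close> times, with the derivative existentially quantified
  so that closure properties follow by induction, one differentiation at a time. Level 0 demands
  nothing, not even continuity; having all levels is smoothness.\<close>

fun kdiff :: "nat \<Rightarrow> (real \<Rightarrow> real) \<Rightarrow> bool" where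
  "kdiff 0 f \<longleftrightarrow> True"
| "kdiff (Suc k) f \<longleftrightarrow> (\<exists>f'. (\<forall>x. (f has_real_derivative f' x) (at x)) \<and> kdiff k f')"

lemma kdiff_mono: "kdiff (Suc k) f \<Longrightarrow> kdiff k f"
  by (induction k arbitrary: f) auto

lemma kdiff_add: "kdiff k f \<Longrightarrow> kdiff k g \<Longrightarrow> kdiff k (\<lambda>x. f x + g x)"
proof (induction k arbitrary: f g)
  case (Suc k)
  then obtain f' g' where d: "\<And>x. (f has_real_derivative f' x) (at x)" "kdiff k f'"
      "\<And>x. (g has_real_derivative g' x) (at x)" "kdiff k g'" by auto
  then have "kdiff k (\<lambda>x. f' x + g' x)" by (intro Suc.IH)
  moreover have "((\<lambda>x. f x + g x) has_real_derivative f' x + g' x) (at x)" for x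
    by (intro derivative_intros d)
  ultimately show ?case by (auto intro!: exI[of _ "\<lambda>x. f' x + g' x"])
qed simp

lemma kdiff_mult: "kdiff k f \<Longrightarrow> kdiff k g \<Longrightarrow> kdiff k (\<lambda>x. f x * g x)"
proof (induction k arbitrary: f g)
  case (Suc k)
  then obtain f' g' where d: "\<And>x. (f has_real_derivative f' x) (at x)" "kdiff k f'"
      "\<And>x. (g has_real_derivative g' x) (at x)" "kdiff k g'" by auto
  \<comment> \<open>The product rule leaves one factor undifferentiated, so the factors themselves
    are needed at level \<open>k\<close>.\<close>
  have "kdiff k f" "kdiff k g" using Suc.prems kdiff_mono by auto
  with d have "kdiff k (\<lambda>x. f' x * g x + g' x * f x)"
    by (intro kdiff_add Suc.IH)
  moreover have "((\<lambda>x. f x * g x) has_real_derivative f' x * g x + g' x * f x) (at x)" for x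
    by (intro DERIV_mult d)
  ultimately show ?case by (auto intro!: exI[of _ "\<lambda>x. f' x * g x + g' x * f x"])
qed simp

lemma kdiff_const: "kdiff k (\<lambda>x. c)"
proof (induction k arbitrary: c)
  case (Suc k)
  have "((\<lambda>x. c) has_real_derivative 0) (at x)" for x :: real by simp
  then show ?case using Suc[of 0] by (auto intro!: exI[of _ "\<lambda>x. 0"])
qed simp

lemma kdiff_affine: "kdiff k f \<Longrightarrow> kdiff k (\<lambda>x. f (a * x + b))"
proof (induction k arbitrary: f)
  case (Suc k)
  then obtain f' where d: "\<And>x. (f has_real_derivative f' x) (at x)" "kdiff k f'" by auto
  then have "kdiff k (\<lambda>x. f' (a * x + b) * a)" by (intro kdiff_mult kdiff_const Suc.IH)
  moreover have "((\<lambda>x. f (a * x + b)) has_real_derivative f' (a * x + b) * a) (at x)" for x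
    by (rule DERIV_chain2[OF d(1)]) (auto intro!: derivative_eq_intros)
  ultimately show ?case by (auto intro!: exI[of _ "\<lambda>x. f' (a * x + b) * a"])
qed simp

definition smooth_real :: "(real \<Rightarrow> real) \<Rightarrow> bool" where
  "smooth_real f \<longleftrightarrow> (\<forall>k. kdiff k f)"

text \<open>Each level \<open>k\<close> supplies its own derivative function; uniqueness of
  derivatives identifies them all.\<close>

lemma smooth_realD:
  assumes "smooth_real f"
  obtains f' where "\<And>x. (f has_real_derivative f' x) (at x)" "smooth_real f'"
proof -
  obtain f' where f': "\<And>x. (f has_real_derivative f' x) (at x)"
    using assms[unfolded smooth_real_def, rule_format, of "Suc 0"] by auto
  have "kdiff k f'" for k
  proof -
    obtain g where g: "\<And>x. (f has_real_derivative g x) (at x)" "kdiff k g"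
      using assms[unfolded smooth_real_def, rule_format, of "Suc k"] by auto
    then have "g = f'" using f' DERIV_unique by blast
    then show ?thesis using g by simp
  qed
  then show ?thesis using that f' by (auto simp: smooth_real_def)
qed

text \<open>The classical flat function \<open>exp (-1/t)\<close>, extended by 0, times a power of
  \<open>1/t\<close>. Including the powers makes the family closed under differentiation up to
  linear combinations, so smoothness of every member follows from one derivative formula.\<close>

definition flat_pow :: "nat \<Rightarrow> real \<Rightarrow> real" where
  "flat_pow m t = (if t > 0 then inverse t ^ m * exp (- inverse t) else 0)"

lemma flat_pow_limit: "((\<lambda>t. inverse t ^ m * exp (- inverse t)) \<longlongrightarrow> 0) (at_right (0::real))"
proof -
  have "((\<lambda>s::real. s ^ m / exp s) \<longlongrightarrow> 0) at_top" by (rule tendsto_power_div_exp_0)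
  from filterlim_compose[OF this filterlim_inverse_at_top_right]
  show ?thesis by (simp add: exp_minus field_simps)
qed

lemma flat_pow_has_derivative:
  "(flat_pow m has_real_derivative (flat_pow (m + 2) t - of_nat m * flat_pow (m + 1) t)) (at t)"
proof (cases t "0::real" rule: linorder_cases)
  case less
  have "((\<lambda>x. 0) has_real_derivative 0) (at t)" by simp
  then have "(flat_pow m has_real_derivative 0) (at t)"
    by (rule has_field_derivative_transform_within_open[of _ _ _ "{..<0}"])
      (use less in \<open>auto simp: flat_pow_def\<close>)
  then show ?thesis using less by (simp add: flat_pow_def)
next
  case greater
  have inv: "(inverse has_real_derivative - (inverse t ^ 2)) (at t)"
    using DERIV_inverse[of t] greater by (simp add: power_inverse power2_eq_square)
  have "((\<lambda>x. inverse x ^ m) has_real_derivative - of_nat m * inverse t ^ (m + 1)) (at t)"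
    using DERIV_power[OF inv, of m] by (cases m) (simp_all add: power2_eq_square algebra_simps)
  moreover have "((\<lambda>x. exp (- inverse x)) has_real_derivative exp (- inverse t) * inverse t ^ 2) (at t)"
    using DERIV_chain2[OF DERIV_exp DERIV_minus[OF inv]] by simp
  ultimately have "((\<lambda>x. inverse x ^ m * exp (- inverse x)) has_real_derivative
      - of_nat m * inverse t ^ (m + 1) * exp (- inverse t) + exp (- inverse t) * inverse t ^ 2 * inverse t ^ m) (at t)"
    by (rule DERIV_mult)
  then have "((\<lambda>x. inverse x ^ m * exp (- inverse x)) has_real_derivative
      (flat_pow (m + 2) t - of_nat m * flat_pow (m + 1) t)) (at t)"
    using greater by (simp add: flat_pow_def power2_eq_square algebra_simps)
  then show ?thesis
    by (rule has_field_derivative_transform_within_open[of _ _ _ "{0<..}"])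
      (use greater in \<open>auto simp: flat_pow_def\<close>)
next
  case equal
  \<comment> \<open>For positive \<open>h\<close> dividing by \<open>h\<close> raises the power by
    one, so the right difference quotient is the expression of \<open>flat_pow_limit\<close> at
    \<open>Suc m\<close>; the left one is identically 0.\<close>
  have "((\<lambda>h. (flat_pow m (0 + h) - flat_pow m 0) / h) \<longlongrightarrow> 0) (at_right 0)"
    by (rule Lim_transform_eventually[OF flat_pow_limit[of "Suc m"]])
      (auto simp: flat_pow_def eventually_at_right_less field_simps
        intro!: eventually_mono[OF eventually_at_right_less[of "0::real"]])
  moreover have "((\<lambda>h. (flat_pow m (0 + h) - flat_pow m 0) / h) \<longlongrightarrow> 0) (at_left 0)"
    by (rule Lim_transform_eventually[OF tendsto_const])
      (auto simp: flat_pow_def eventually_at_filter)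
  ultimately have "((\<lambda>h. (flat_pow m (0 + h) - flat_pow m 0) / h) \<longlongrightarrow> 0) (at 0)"
    using filterlim_at_split by blast
  then show ?thesis using equal by (simp add: DERIV_def flat_pow_def)
qed

lemma smooth_flat_pow: "smooth_real (flat_pow m)"
proof -
  have "kdiff k (flat_pow m)" for k
  proof (induction k arbitrary: m)
    case (Suc k)
    have "kdiff k (\<lambda>t. flat_pow (m + 2) t + (- of_nat m) * flat_pow (m + 1) t)"
      by (intro kdiff_add kdiff_mult kdiff_const Suc)
    then show ?case using flat_pow_has_derivative[of m]
      by (auto intro!: exI[of _ "\<lambda>t. flat_pow (m + 2) t + (- of_nat m) * flat_pow (m + 1) t"])
  qed simp
  then show ?thesis by (simp add: smooth_real_def)
qed

section \<open>Product functions and bumps on boxes of the plane\<close>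

definition coord_prod :: "(real \<Rightarrow> real) \<Rightarrow> (real \<Rightarrow> real) \<Rightarrow> plane \<Rightarrow> real" where
  "coord_prod f g x = f (x $ 1) * g (x $ 2)"

lemma coord_prod_has_derivative:
  assumes "\<And>x. (f has_real_derivative f' x) (at x)" "\<And>x. (g has_real_derivative g' x) (at x)"
  shows "(coord_prod f g has_derivative
    (\<lambda>v. f' (x $ 1) * v $ 1 * g (x $ 2) + f (x $ 1) * (g' (x $ 2) * v $ 2))) (at x)"
proof -
  have nth: "((\<lambda>x. x $ i) has_derivative (\<lambda>v. v $ i)) (at x)" for i :: 2
    by (rule bounded_linear_imp_has_derivative) (rule bounded_linear_vec_nth)
  have "((\<lambda>x. f (x $ 1)) has_derivative (\<lambda>v. f' (x $ 1) * v $ 1)) (at x)"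
    using has_derivative_compose[OF nth] assms(1)[of "x $ 1"]
    by (simp add: has_field_derivative_def)
  moreover have "((\<lambda>x. g (x $ 2)) has_derivative (\<lambda>v. g' (x $ 2) * v $ 2)) (at x)"
    using has_derivative_compose[OF nth] assms(2)[of "x $ 2"]
    by (simp add: has_field_derivative_def)
  ultimately show ?thesis
    unfolding coord_prod_def[abs_def]
    using has_derivative_mult by (fastforce simp: algebra_simps)
qed

text \<open>A partial derivative acts on one factor only, so iterated derivatives keep the product
  form and smoothness in the plane reduces to smoothness of functions of one variable.\<close>

lemma partial_derivs_coord_prod:
  assumes "smooth_real f" "smooth_real g"
  shows "\<exists>f' g'. smooth_real f' \<and> smooth_real g' \<and> partial_derivs is (coord_prod f g) = coord_prod f' g'"
proof (induction "is")
  case Nil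
  then show ?case using assms by (auto simp: partial_derivs_def)
next
  case (Cons i "is")
  then obtain a b where ab: "smooth_real a" "smooth_real b"
    "partial_derivs is (coord_prod f g) = coord_prod a b" by blast
  obtain a' b' where d: "\<And>x. (a has_real_derivative a' x) (at x)" "smooth_real a'"
    "\<And>x. (b has_real_derivative b' x) (at x)" "smooth_real b'"
    using smooth_realD[OF ab(1)] smooth_realD[OF ab(2)] by metis
  have pd: "partial_deriv i (coord_prod a b) x =
      a' (x $ 1) * axis i 1 $ 1 * b (x $ 2) + a (x $ 1) * (b' (x $ 2) * axis i 1 $ 2)" for x
    unfolding partial_deriv_def
    by (subst frechet_derivative_at[OF coord_prod_has_derivative[OF d(1,3)], symmetric]) simp
  have eq: "partial_derivs (i # is) (coord_prod f g) = partial_deriv i (coord_prod a b)"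
    using ab(3) by (simp add: partial_derivs_def)
  show ?case
  proof (cases "i = 1")
    case True
    then have "partial_deriv i (coord_prod a b) = coord_prod a' b"
      using pd by (auto simp: axis_def coord_prod_def)
    then show ?thesis using eq ab d by auto
  next
    case False
    then have "i = 2" using exhaust_2 by blast
    then have "partial_deriv i (coord_prod a b) = coord_prod a b'"
      using pd by (auto simp: axis_def coord_prod_def)
    then show ?thesis using eq ab d by auto
  qed
qed

text \<open>For \<open>n >= 1\<close> this is \<open>exp (- 1/(n(t-a)) - 1/(n(b-t)))\<close> between
  \<open>a\<close> and \<open>b\<close> and 0 elsewhere; the exponent tends to 0 as \<open>n\<close>
  grows, so the limit is the indicator of the open interval. The arguments are spelled out as affine
  functions of \<open>t\<close> to match \<open>kdiff_affine\<close>.\<close>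

definition bump1 :: "real \<Rightarrow> real \<Rightarrow> nat \<Rightarrow> real \<Rightarrow> real" where
  "bump1 a b n t = flat_pow 0 (real n * t + - (real n * a)) * flat_pow 0 (- real n * t + real n * b)"

definition bump :: "plane \<Rightarrow> plane \<Rightarrow> nat \<Rightarrow> plane \<Rightarrow> real" where
  "bump a b n = coord_prod (bump1 (a $ 1) (b $ 1) n) (bump1 (a $ 2) (b $ 2) n)"

lemma bump1_alt: "bump1 a b n t = flat_pow 0 (real n * (t - a)) * flat_pow 0 (real n * (b - t))"
  by (simp add: bump1_def algebra_simps)

lemma flat_pow_0_bounds: "0 \<le> flat_pow 0 t" "flat_pow 0 t \<le> 1"
  by (auto simp: flat_pow_def)

lemma bump1_bounds: "0 \<le> bump1 a b n t" "bump1 a b n t \<le> 1"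
  unfolding bump1_def by (auto intro!: mult_nonneg_nonneg mult_le_one flat_pow_0_bounds)

lemma bump_bounds: "0 \<le> bump a b n t" "bump a b n t \<le> 1"
  unfolding bump_def coord_prod_def by (auto intro!: mult_nonneg_nonneg mult_le_one bump1_bounds)

lemma bump1_eq_0: "\<not> (a < t \<and> t < b) \<Longrightarrow> bump1 a b n t = 0"
  by (auto simp: bump1_alt flat_pow_def zero_less_mult_iff)

lemma bump1_tendsto: "(\<lambda>n. bump1 a b n t) \<longlonglongrightarrow> (if a < t \<and> t < b then 1 else 0)"
proof (cases "a < t \<and> t < b")
  case True
  have lim: "(\<lambda>n. flat_pow 0 (real n * c)) \<longlonglongrightarrow> 1" if "c > 0" for c
  proof -
    have "(\<lambda>n. exp (- (inverse (real n) * inverse c))) \<longlonglongrightarrow> exp (- (0 * inverse c))"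
      by (intro tendsto_intros lim_inverse_n)
    then have "(\<lambda>n. exp (- (inverse (real n) * inverse c))) \<longlonglongrightarrow> 1" by simp
    then show ?thesis
      by (rule Lim_transform_eventually)
        (use that in \<open>auto simp: flat_pow_def intro!: eventually_mono[OF eventually_gt_at_top[of 0]]\<close>)
  qed
  show ?thesis using tendsto_mult[OF lim[of "t - a"] lim[of "b - t"]] True
    by (simp add: bump1_alt)
next
  case False
  then show ?thesis by (auto simp: bump1_eq_0)
qed

lemma mem_box_plane: "x \<in> box a b \<longleftrightarrow> (a $ 1 < x $ 1 \<and> x $ 1 < b $ 1) \<and> a $ 2 < x $ 2 \<and> x $ 2 < b $ 2"
  for x :: plane
  by (auto simp: mem_box_cart forall_2)

lemma bump_tendsto: "(\<lambda>n. bump a b n x) \<longlonglongrightarrow> indicator (box a b) x"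
  using tendsto_mult[OF bump1_tendsto[of "a $ 1" "b $ 1" "x $ 1"] bump1_tendsto[of "a $ 2" "b $ 2" "x $ 2"]]
  by (auto simp: bump_def coord_prod_def indicator_def mem_box_plane split: if_splits)

lemma smooth_bump1: "smooth_real (bump1 a b n)"
  using smooth_flat_pow unfolding smooth_real_def bump1_def[abs_def]
  by (intro allI kdiff_mult kdiff_affine) auto

lemma bump_test_function:
  assumes "cbox a b \<subseteq> \<Omega>"
  shows "bump a b n \<in> test_functions \<Omega>"
proof -
  have "partial_derivs is (bump a b n) differentiable_on UNIV" for "is"
  proof -
    obtain f g where "smooth_real f" "smooth_real g" "partial_derivs is (bump a b n) = coord_prod f g"
      using partial_derivs_coord_prod[OF smooth_bump1 smooth_bump1] unfolding bump_def by blast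
    moreover obtain f' g' where "\<And>x. (f has_real_derivative f' x) (at x)"
      "\<And>x. (g has_real_derivative g' x) (at x)"
      using smooth_realD[OF \<open>smooth_real f\<close>] smooth_realD[OF \<open>smooth_real g\<close>] by metis
    ultimately show ?thesis
      using coord_prod_has_derivative[of f f' g g']
      by (auto simp: differentiable_on_def differentiable_def)
  qed
  moreover have "{x. bump a b n x \<noteq> 0} \<subseteq> cbox a b"
  proof safe
    fix x assume "bump a b n x \<noteq> 0"
    then have "x \<in> box a b"
      using bump1_eq_0 by (force simp: bump_def coord_prod_def mem_box_plane)
    then show "x \<in> cbox a b" using box_subset_cbox by blast
  qed
  then have cl: "closure {x. bump a b n x \<noteq> 0} \<subseteq> cbox a b"
    by (simp add: closure_minimal closed_cbox)
  then have "compact (closure {x. bump a b n x \<noteq> 0})"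
    using compact_Int_closed[OF compact_cbox[of a b] closed_closure[of "{x. bump a b n x \<noteq> 0}"]]
    by (simp only: Int_absorb1)
  ultimately show ?thesis using cl assms by (auto simp: test_functions_def)
qed

section \<open>The fundamental lemma of the calculus of variations\<close>

lemma set_lebesgue_integral_boxes_imp_AE_0:
  fixes g :: "'a::euclidean_space \<Rightarrow> real"
  assumes g: "integrable lebesgue g" and box: "\<And>a b. (LINT x:box a b|lebesgue. g x) = 0"
    and total: "(LINT x|lebesgue. g x) = 0"
  shows "AE x in lebesgue. g x = 0"
proof (rule density_unique_real[OF g integrable_zero, simplified])
  have int: "set_integrable lebesgue A g" if "A \<in> sets lebesgue" for A
    unfolding set_integrable_def using integrable_mult_indicator[OF that g] .
  have borel: "(LINT x:A|lebesgue. g x) = 0" if "A \<in> sets borel" for A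
  proof -
    \<comment> \<open>Pi-lambda argument: open boxes are stable under intersection and generate the
      Borel sets. The assumption \<open>total\<close> is what closes the class under
      complements.\<close>
    have "A \<in> sigma_sets UNIV (range (\<lambda>(a, b). box a b :: 'a set))"
      using that by (simp add: borel_eq_box)
    then show ?thesis
    proof (induction rule: sigma_sets_induct_disjoint[rotated 2, consumes 1, case_names basic empty compl union int_stable closed])
      case int_stable
      show ?case by (auto simp: Int_stable_def box_Int_box)
    next
      case (compl A)
      then have "A \<in> sets borel" by (simp add: borel_eq_box)
      then have A: "A \<in> sets lebesgue" by simp
      have "(LINT x|lebesgue. g x) = (LINT x:A \<union> (UNIV - A)|lebesgue. g x)"
        by (simp add: set_lebesgue_integral_def)
      also have "\<dots> = (LINT x:A|lebesgue. g x) + (LINT x:UNIV - A|lebesgue. g x)"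
        by (rule set_integral_Un) (use int[OF A] int[OF sets.Diff[OF sets.top A]] in auto)
      finally show ?case using compl total by simp
    next
      case (union A)
      have A: "A i \<in> sets lebesgue" for i
      proof -
        have "A i \<in> sigma_sets UNIV (range (\<lambda>(a, b). box a b :: 'a set))" using union(2) by auto
        then have "A i \<in> sets borel" by (simp add: borel_eq_box)
        then show ?thesis by simp
      qed
      have "(LINT x:(\<Union>i. A i)|lebesgue. g x) = (\<Sum>i. (LINT x:A i|lebesgue. g x))"
        by (rule lebesgue_integral_countable_add)
          (use A union(1) int in \<open>auto simp: disjoint_family_on_def\<close>)
      then show ?case using union by simp
    qed (auto simp: box set_lebesgue_integral_def[of lebesgue "{}"])
  qed
  fix A :: "'a set" assume "A \<in> sets lebesgue"
  \<comment> \<open>A Lebesgue set differs from a Borel set by a null set, which does not change the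
    integral.\<close>
  then obtain S N N' where A: "A = S \<union> N" "N \<subseteq> N'" "N' \<in> null_sets lborel" "S \<in> sets lborel"
    by (rule sets_completionE)
  have "AE x in lebesgue. x \<notin> N'"
    using A(3) by (intro AE_not_in null_sets_completionI)
  then have "(LINT x:A|lebesgue. g x) = (LINT x:S|lebesgue. g x)"
    unfolding set_lebesgue_integral_def
  proof (intro integral_cong_AE)
    show "AE x in lebesgue. indicat_real A x *\<^sub>R g x = indicat_real S x *\<^sub>R g x"
      if "AE x in lebesgue. x \<notin> N'"
      using that by eventually_elim (use A in \<open>auto simp: indicator_def\<close>)
    have "S \<in> sets lebesgue" using A(4) by simp
    then show "(\<lambda>x. indicat_real S x *\<^sub>R g x) \<in> borel_measurable lebesgue"
      using g by (intro borel_measurable_scaleR borel_measurable_indicator) auto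
  qed (use g \<open>A \<in> sets lebesgue\<close> in auto)
  then show "(LINT x:A|lebesgue. g x) = 0" using borel A by simp
qed

text \<open>Dominated convergence along the bumps gives a vanishing integral over every box whose
  closure lies in \<Omega>. Intersections of boxes are boxes, so the preceding criterion applies to
  the restriction of \<open>f\<close> to one such box; countably many of these boxes cover \<Omega>
  by the Lindelof property.\<close>

lemma integral_test_functions_imp_AE_0:
  assumes \<Omega>: "open \<Omega>" and f: "integrable (lebesgue_on \<Omega>) f"
    and test: "\<And>\<phi>. \<phi> \<in> test_functions \<Omega> \<Longrightarrow> (LINT x|lebesgue_on \<Omega>. f x * \<phi> x) = 0"
  shows "AE x in lebesgue_on \<Omega>. f x = 0"
proof -
  have \<Omega>m: "\<Omega> \<in> sets lebesgue" using \<Omega> by auto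
  define g where "g x = indicat_real \<Omega> x * f x" for x
  have g: "integrable lebesgue g"
    using f \<Omega>m by (simp add: integrable_restrict_space g_def[abs_def])
  have box: "(LINT x|lebesgue. indicat_real (box a b) x * g x) = 0" if ab: "cbox a b \<subseteq> \<Omega>" for a b
  proof -
    have meas: "bump a b n \<in> borel_measurable lebesgue" for n
    proof -
      have "bump a b n differentiable_on UNIV"
        using bump_test_function[OF ab, of n] unfolding test_functions_def partial_derivs_def
        by (auto dest!: spec[of _ "[]"])
      then have "continuous_on UNIV (bump a b n)" by (rule differentiable_imp_continuous_on)
      then have "bump a b n \<in> borel_measurable borel" by (rule borel_measurable_continuous_onI)
      then show ?thesis by (simp add: measurable_completion)
    qed
    have "(\<lambda>n. LINT x|lebesgue. bump a b n x * g x) \<longlonglongrightarrow> (LINT x|lebesgue. indicat_real (box a b) x * g x)"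
    proof (rule integral_dominated_convergence[where w="\<lambda>x. \<bar>g x\<bar>"])
      show "AE x in lebesgue. (\<lambda>n. bump a b n x * g x) \<longlonglongrightarrow> indicat_real (box a b) x * g x"
        by (intro AE_I2 tendsto_intros bump_tendsto)
      show "AE x in lebesgue. norm (bump a b n x * g x) \<le> \<bar>g x\<bar>" for n
        using bump_bounds[of a b n] by (auto simp: abs_mult intro!: mult_left_le_one_le)
      have "box a b \<in> sets lebesgue" by simp
      then show "(\<lambda>x. indicat_real (box a b) x * g x) \<in> borel_measurable lebesgue"
        using g by (intro borel_measurable_times borel_measurable_indicator) auto
    qed (use g meas in auto)
    moreover have "(LINT x|lebesgue. bump a b n x * g x) = 0" for n
      using test[OF bump_test_function[OF ab]] \<Omega>m
      by (simp add: integral_restrict_space g_def mult_ac)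
    ultimately show ?thesis by (simp add: LIMSEQ_const_iff)
  qed
  have AE_box: "AE x in lebesgue. x \<in> box a b \<longrightarrow> g x = 0" if ab: "cbox a b \<subseteq> \<Omega>" for a b
  proof -
    have "AE x in lebesgue. indicat_real (box a b) x * g x = 0"
    proof (rule set_lebesgue_integral_boxes_imp_AE_0)
      show "integrable lebesgue (\<lambda>x. indicat_real (box a b) x * g x)"
        using integrable_mult_indicator[OF _ g, of "box a b"] by simp
      fix c d :: plane
      obtain e h where eh: "box c d \<inter> box a b = box e h" "cbox e h = cbox c d \<inter> cbox a b"
        unfolding box_Int_box Int_interval by blast
      then have "cbox e h \<subseteq> \<Omega>" using ab by blast
      from box[OF this] eh(1) show "(LINT x:box c d|lebesgue. indicat_real (box a b) x * g x) = 0"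
        by (simp add: set_lebesgue_integral_def mult.assoc[symmetric] flip: indicator_inter_arith)
    qed (use box ab in simp)
    then show ?thesis by eventually_elim (auto simp: indicator_def)
  qed
  define \<B> where "\<B> = {box a b |a b :: plane. cbox a b \<subseteq> \<Omega>}"
  obtain \<B>' where B': "\<B>' \<subseteq> \<B>" "countable \<B>'" "\<Union>\<B>' = \<Union>\<B>"
    by (rule Lindelof[of \<B>]) (auto simp: \<B>_def open_box)
  have "\<Omega> \<subseteq> \<Union>\<B>"
  proof
    fix x assume "x \<in> \<Omega>"
    then obtain a b where "cbox a b \<subseteq> \<Omega>" "x \<in> box a b"
      using \<Omega> open_contains_cbox by metis
    then show "x \<in> \<Union>\<B>" by (auto simp: \<B>_def)
  qed
  moreover have "AE x in lebesgue. \<forall>B\<in>\<B>'. x \<in> B \<longrightarrow> g x = 0"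
    using B' AE_box by (subst AE_ball_countable) (auto simp: \<B>_def)
  ultimately have "AE x in lebesgue. x \<in> \<Omega> \<longrightarrow> g x = 0"
    using B' by (auto elim!: eventually_mono)
  then show ?thesis using \<Omega>m by (auto simp: AE_restrict_space_iff g_def elim!: eventually_mono)
qed

section \<open>Test functions on the plane\<close>

lemma partial_derivs_Nil [simp]: "partial_derivs [] f = f"
  and partial_derivs_Cons: "partial_derivs (i # is) f = partial_deriv i (partial_derivs is f)"
  and partial_derivs_append: "partial_derivs (is @ js) f = partial_derivs is (partial_derivs js f)"
  by (simp_all add: partial_derivs_def)

lemma partial_deriv_has_derivative: "(f has_derivative D) (at x) \<Longrightarrow> partial_deriv i f x = D (axis i 1)"
  unfolding partial_deriv_def by (subst frechet_derivative_at[symmetric]) auto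

lemma partial_deriv_outside_support:
  assumes "x \<notin> closure {x. f x \<noteq> 0}"
  shows "partial_deriv i f x = 0"
proof -
  have "((\<lambda>x. 0) has_derivative (\<lambda>v. 0)) (at x)" by simp
  then have "(f has_derivative (\<lambda>v. 0)) (at x)"
  proof (rule has_derivative_transform_within_open)
    show "open (- closure {x. f x \<noteq> 0})" by (intro open_Compl closed_closure)
    show "0 = f y" if "y \<in> - closure {x. f x \<noteq> 0}" for y
      using that closure_subset[of "{x. f x \<noteq> 0}"] by auto
  qed (use assms in auto)
  then show ?thesis by (simp add: partial_deriv_has_derivative)
qed

lemma test_function_differentiable:
  assumes "\<phi> \<in> test_functions \<Omega>"
  shows "partial_derivs is \<phi> differentiable (at x)"
proof -
  have "partial_derivs is \<phi> differentiable_on UNIV" using assms by (auto simp: test_functions_def)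
  then show ?thesis by (simp add: differentiable_on_def)
qed

lemma test_function_continuous:
  "\<phi> \<in> test_functions \<Omega> \<Longrightarrow> continuous_on UNIV (partial_derivs is \<phi>)"
  by (rule differentiable_imp_continuous_on) (auto simp: test_functions_def)

lemma test_function_partial_deriv:
  assumes "\<phi> \<in> test_functions \<Omega>"
  shows "partial_deriv i \<phi> \<in> test_functions \<Omega>"
proof -
  have sub: "{x. partial_deriv i \<phi> x \<noteq> 0} \<subseteq> closure {x. \<phi> x \<noteq> 0}"
    using partial_deriv_outside_support by blast
  then have cl: "closure {x. partial_deriv i \<phi> x \<noteq> 0} \<subseteq> closure {x. \<phi> x \<noteq> 0}"
    by (simp add: closure_minimal)
  have "compact (closure {x. \<phi> x \<noteq> 0})" using assms by (auto simp: test_functions_def)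
  then have "compact (closure {x. partial_deriv i \<phi> x \<noteq> 0})"
    using cl compact_Int_closed[of "closure {x. \<phi> x \<noteq> 0}" "closure {x. partial_deriv i \<phi> x \<noteq> 0}"]
    by (simp only: Int_absorb1 closed_closure)
  moreover have "partial_derivs is (partial_deriv i \<phi>) = partial_derivs (is @ [i]) \<phi>" for "is"
    by (simp add: partial_derivs_append partial_derivs_Cons)
  ultimately show ?thesis using assms cl by (auto simp: test_functions_def)
qed

lemma test_function_partial_derivs:
  "\<phi> \<in> test_functions \<Omega> \<Longrightarrow> partial_derivs is \<phi> \<in> test_functions \<Omega>"
  by (induction "is") (auto simp: partial_derivs_Cons intro: test_function_partial_deriv)

lemma partial_derivs_lincomb:
  assumes "\<phi> \<in> test_functions \<Omega>" "\<psi> \<in> test_functions \<Omega>"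
  shows "partial_derivs is (\<lambda>x. \<phi> x + c * \<psi> x) = (\<lambda>x. partial_derivs is \<phi> x + c * partial_derivs is \<psi> x)"
proof (induction "is")
  case (Cons i "is")
  have "partial_deriv i (\<lambda>x. partial_derivs is \<phi> x + c * partial_derivs is \<psi> x) x =
      partial_deriv i (partial_derivs is \<phi>) x + c * partial_deriv i (partial_derivs is \<psi>) x" for x
    unfolding partial_deriv_def[of i "partial_derivs is _"]
    by (rule partial_deriv_has_derivative)
      (intro has_derivative_add has_derivative_mult_right frechet_derivative_works[THEN iffD1]
        test_function_differentiable[OF assms(1)] test_function_differentiable[OF assms(2)])
  then show ?case using Cons by (simp add: partial_derivs_Cons)
qed simp

lemma test_function_lincomb:
  assumes "\<phi> \<in> test_functions \<Omega>" "\<psi> \<in> test_functions \<Omega>"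
  shows "(\<lambda>x. \<phi> x + c * \<psi> x) \<in> test_functions \<Omega>"
proof -
  let ?S = "closure {x. \<phi> x \<noteq> 0} \<union> closure {x. \<psi> x \<noteq> 0}"
  have "{x. \<phi> x + c * \<psi> x \<noteq> 0} \<subseteq> ?S"
  proof
    fix x assume "x \<in> {x. \<phi> x + c * \<psi> x \<noteq> 0}"
    then have "\<phi> x \<noteq> 0 \<or> \<psi> x \<noteq> 0" by auto
    then show "x \<in> ?S"
      using closure_subset[of "{x. \<phi> x \<noteq> 0}"] closure_subset[of "{x. \<psi> x \<noteq> 0}"] by blast
  qed
  then have cl: "closure {x. \<phi> x + c * \<psi> x \<noteq> 0} \<subseteq> ?S"
    by (simp add: closure_minimal closed_Un)
  have "compact ?S" using assms by (auto simp: test_functions_def)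
  then have "compact (closure {x. \<phi> x + c * \<psi> x \<noteq> 0})"
    using cl compact_Int_closed[of ?S "closure {x. \<phi> x + c * \<psi> x \<noteq> 0}"]
    by (simp only: Int_absorb1 closed_closure)
  moreover have "partial_derivs is (\<lambda>x. \<phi> x + c * \<psi> x) differentiable_on UNIV" for "is"
    using test_function_differentiable[OF assms(1)] test_function_differentiable[OF assms(2)]
    by (auto simp: partial_derivs_lincomb[OF assms] differentiable_on_def)
  moreover have "?S \<subseteq> \<Omega>" using assms by (auto simp: test_functions_def)
  ultimately show ?thesis using cl by (auto simp: test_functions_def)
qed

lemma partial_deriv_zero: "partial_deriv i (\<lambda>x. 0) = (\<lambda>x. 0)"
  by (rule ext) (simp add: partial_deriv_has_derivative[OF has_derivative_const])

lemma zero_test_function: "(\<lambda>x. 0) \<in> test_functions \<Omega>"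
proof -
  have "partial_derivs is (\<lambda>x. 0) = (\<lambda>x. 0)" for "is"
    by (induction "is") (auto simp: partial_derivs_Cons partial_deriv_zero)
  then show ?thesis by (auto simp: test_functions_def)
qed

lemma test_function_scale: "\<phi> \<in> test_functions \<Omega> \<Longrightarrow> (\<lambda>x. c * \<phi> x) \<in> test_functions \<Omega>"
  using test_function_lincomb[OF zero_test_function] by simp

lemma test_function_sum:
  assumes "\<And>i. i \<in> I \<Longrightarrow> f i \<in> test_functions \<Omega>"
  shows "(\<lambda>x. \<Sum>i\<in>I. f i x) \<in> test_functions \<Omega>"
  using assms
proof (induction I rule: infinite_finite_induct)
  case (insert i I)
  then show ?case using test_function_lincomb[of "f i" \<Omega> "\<lambda>x. \<Sum>i\<in>I. f i x" 1] by simp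
qed (auto intro: zero_test_function)

lemma test_function_eq_0: "\<phi> \<in> test_functions \<Omega> \<Longrightarrow> x \<notin> \<Omega> \<Longrightarrow> \<phi> x = 0"
  using closure_subset[of "{x. \<phi> x \<noteq> 0}"] by (auto simp: test_functions_def)

text \<open>Continuously differentiable functions with bounded support. The integral estimates on
  the plane involve products and only first derivatives, and this class is closed under products by
  a single use of the product rule.\<close>

definition C1c :: "(plane \<Rightarrow> real) \<Rightarrow> bool" where
  "C1c f \<longleftrightarrow> (\<forall>x. f differentiable (at x)) \<and> (\<forall>i. continuous_on UNIV (partial_deriv i f)) \<and>
    bounded {x. f x \<noteq> 0}"

lemma C1c_test_function: "\<phi> \<in> test_functions \<Omega> \<Longrightarrow> C1c \<phi>"
  using test_function_differentiable[of \<phi> \<Omega> "[]"] test_function_continuous[of \<phi> \<Omega> "[_]"]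
    bounded_subset[OF compact_imp_bounded closure_subset]
  by (auto simp: C1c_def partial_derivs_Cons test_functions_def)

lemma C1c_continuous: "C1c f \<Longrightarrow> continuous_on UNIV f"
  by (rule differentiable_imp_continuous_on) (auto simp: C1c_def differentiable_on_def)

lemma partial_deriv_mult:
  assumes "f differentiable (at x)" "g differentiable (at x)"
  shows "partial_deriv i (\<lambda>x. f x * g x) x = partial_deriv i f x * g x + f x * partial_deriv i g x"
proof -
  have "((\<lambda>x. f x * g x) has_derivative
     (\<lambda>h. f x * frechet_derivative g (at x) h + frechet_derivative f (at x) h * g x)) (at x)"
    using assms by (intro has_derivative_mult frechet_derivative_works[THEN iffD1])
  from partial_deriv_has_derivative[OF this] show ?thesis
    by (simp add: partial_deriv_def)
qed

lemma C1c_mult: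
  assumes f: "C1c f" and g: "C1c g"
  shows "C1c (\<lambda>x. f x * g x)"
proof -
  have "partial_deriv i (\<lambda>x. f x * g x) = (\<lambda>x. partial_deriv i f x * g x + f x * partial_deriv i g x)" for i
    using assms by (intro ext partial_deriv_mult) (auto simp: C1c_def)
  moreover have "{x. f x * g x \<noteq> 0} \<subseteq> {x. f x \<noteq> 0}" by auto
  ultimately show ?thesis
    using assms C1c_continuous[OF f] C1c_continuous[OF g] bounded_subset
    by (auto simp: C1c_def intro!: continuous_intros)
qed

lemma C1c_support:
  assumes "C1c f"
  obtains R where "R > 0" "\<And>x. norm x \<ge> R \<Longrightarrow> f x = 0" "\<And>i x. norm x \<ge> R \<Longrightarrow> partial_deriv i f x = 0"
proof -
  obtain B where B: "B > 0" "{x. f x \<noteq> 0} \<subseteq> cball 0 B"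
    using assms unfolding C1c_def bounded_pos by (auto simp: subset_iff mem_cball_0)
  then have "closure {x. f x \<noteq> 0} \<subseteq> cball 0 B" by (simp add: closure_minimal)
  then have "x \<notin> closure {x. f x \<noteq> 0}" if "norm x \<ge> B + 1" for x
    using that by (auto simp: subset_iff mem_cball_0)
  then show ?thesis
    using B by (intro that[of "B + 1"] partial_deriv_outside_support) (auto simp: subset_iff mem_cball_0)
qed

section \<open>Integration along coordinate lines\<close>

definition line :: "2 \<Rightarrow> real \<Rightarrow> real \<Rightarrow> plane" where
  "line i s t = (\<chi> j. if j = i then s else t)"

lemma norm_line_ge: "\<bar>s\<bar> \<le> norm (line i s t)"
  using component_le_norm_cart[of "line i s t" i] by (simp add: line_def)

lemma line_swap: "i \<noteq> j \<Longrightarrow> line i s t = line j t s"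
  using exhaust_2[of i] exhaust_2[of j] by (auto simp: line_def vec_eq_iff forall_2)

lemma continuous_line: "continuous_on UNIV (\<lambda>z. line i (fst z) (snd z))"
proof -
  have "continuous_on UNIV (\<lambda>z::real \<times> real. if j = i then fst z else snd z)" for j
    by (cases "j = i") (auto intro!: continuous_intros)
  then show ?thesis unfolding line_def by (intro continuous_on_vec_lambda)
qed

lemma measurable_line [measurable]: "(\<lambda>(s, t). line i s t) \<in> lborel \<Otimes>\<^sub>M lborel \<rightarrow>\<^sub>M borel"
proof -
  have "(\<lambda>z. line i (fst z) (snd z)) \<in> borel_measurable borel"
    by (rule borel_measurable_continuous_onI[OF continuous_line])
  then show ?thesis by (simp add: borel_prod[symmetric] case_prod_unfold cong: measurable_cong_sets)
qed

lemma mem_box_line: "line i s t \<in> box l u \<longleftrightarrow> s \<in> {l $ i<..<u $ i} \<and> (\<forall>j. j \<noteq> i \<longrightarrow> t \<in> {l $ j<..<u $ j})"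
  by (auto simp: mem_box_cart line_def)

text \<open>Lebesgue measure is determined by the volumes of boxes, and the preimage of a box is a
  rectangle. Having this for either \<open>i\<close> allows Fubini's theorem with either coordinate
  as the inner variable.\<close>

lemma lborel_plane: "distr (lborel \<Otimes>\<^sub>M lborel) borel (\<lambda>(s, t). line i s t) = lborel"
proof (rule lborel_eqI[symmetric])
  fix l u :: plane assume le: "\<And>b. b \<in> Basis \<Longrightarrow> l \<bullet> b \<le> u \<bullet> b"
  then have le: "l $ j \<le> u $ j" for j
    using le[of "axis j 1"] by (auto simp: inner_axis axis_in_Basis_iff)
  obtain j where j: "j \<noteq> i" "\<And>k. k \<noteq> i \<Longrightarrow> k = j"
    using exhaust_2[of i] by (metis exhaust_2 zero_neq_one one_neq_zero numeral_One)
  have all: "(\<forall>k. k \<noteq> i \<longrightarrow> Q k) \<longleftrightarrow> Q j" for Q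
    using j by blast
  have "(\<lambda>(s, t). line i s t) -` box l u = {l $ i<..<u $ i} \<times> {l $ j<..<u $ j}"
    by (auto simp: mem_box_line all)
  then have "emeasure (distr (lborel \<Otimes>\<^sub>M lborel) borel (\<lambda>(s, t). line i s t)) (box l u) =
      emeasure (lborel \<Otimes>\<^sub>M lborel) ({l $ i<..<u $ i} \<times> {l $ j<..<u $ j})"
    by (subst emeasure_distr) (auto simp: space_pair_measure)
  also have "\<dots> = ennreal ((u $ i - l $ i) * (u $ j - l $ j))"
    using le by (simp add: lborel.emeasure_pair_measure_Times ennreal_mult)
  also have "(u $ i - l $ i) * (u $ j - l $ j) = (\<Prod>b\<in>Basis. (u - l) \<bullet> b)"
  proof -
    have "(\<Prod>b\<in>Basis. (u - l) \<bullet> b) = (\<Prod>k\<in>UNIV. (u - l) $ k)"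
      by (rule prod.reindex_bij_witness[of _ "\<lambda>k. axis k 1" axis_index])
        (auto simp: inner_axis Basis_vec_def axis_index_axis)
    also have "UNIV = {i, j}" using j(2) by blast
    finally show ?thesis using j(1) by simp
  qed
  finally show "emeasure (distr (lborel \<Otimes>\<^sub>M lborel) borel (\<lambda>(s, t). line i s t)) (box l u) =
    (\<Prod>b\<in>Basis. (u - l) \<bullet> b)" .
qed simp

lemma nn_integral_plane:
  assumes [measurable]: "f \<in> borel_measurable borel"
  shows "(\<integral>\<^sup>+x. f x \<partial>lborel) = (\<integral>\<^sup>+t. (\<integral>\<^sup>+s. f (line i s t) \<partial>lborel) \<partial>lborel)"
proof -
  have "(\<integral>\<^sup>+x. f x \<partial>lborel) = (\<integral>\<^sup>+z. f ((\<lambda>(s, t). line i s t) z) \<partial>(lborel \<Otimes>\<^sub>M lborel))"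
    by (subst lborel_plane[of i, symmetric], subst nn_integral_distr) auto
  also have "\<dots> = (\<integral>\<^sup>+t. (\<integral>\<^sup>+s. f (line i s t) \<partial>lborel) \<partial>lborel)"
    by (subst lborel_pair.nn_integral_snd[symmetric]) (auto simp: case_prod_unfold)
  finally show ?thesis .
qed

lemma line_has_derivative:
  assumes "f differentiable (at (line i s t))"
  shows "((\<lambda>s. f (line i s t)) has_real_derivative partial_deriv i f (line i s t)) (at s)"
proof -
  let ?D = "frechet_derivative f (at (line i s t))"
  have eq: "(\<lambda>r. line i r t) = (\<lambda>r. r *\<^sub>R axis i 1 + line i 0 t)"
    by (simp add: line_def axis_def vec_eq_iff fun_eq_iff)
  have "((\<lambda>r. line i r t) has_derivative (\<lambda>h. h *\<^sub>R axis i 1)) (at s)"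
    unfolding eq by (auto intro!: derivative_eq_intros)
  from has_derivative_compose[OF this frechet_derivative_works[THEN iffD1, OF assms]]
  have "((\<lambda>s. f (line i s t)) has_derivative (\<lambda>h. ?D (h *\<^sub>R axis i 1))) (at s)" .
  moreover have "linear ?D" using assms by (rule linear_frechet_derivative)
  ultimately show ?thesis
    by (simp add: has_field_derivative_def partial_deriv_def linear_cmul mult_commute_abs)
qed

context
  fixes f assumes f: "C1c f"
begin

lemma C1c_line_FTC:
  assumes "a \<le> b"
  shows "has_bochner_integral lborel (\<lambda>s. partial_deriv i f (line i s t) * indicator {a..b} s)
    (f (line i b t) - f (line i a t))"
proof (rule has_bochner_integral_FTC_Icc_real[OF assms])
  show "((\<lambda>s. f (line i s t)) has_real_derivative partial_deriv i f (line i s t)) (at s)" for s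
    using f by (intro line_has_derivative) (simp add: C1c_def)
  have "continuous_on UNIV (\<lambda>s. (s, t))" by (intro continuous_intros)
  then have "continuous_on UNIV (\<lambda>s. line i (fst (s, t)) (snd (s, t)))"
    by (rule continuous_on_compose2[OF continuous_line]) auto
  then have line: "continuous_on UNIV (\<lambda>s. line i s t)" by simp
  have "continuous_on UNIV (partial_deriv i f)" using f by (simp add: C1c_def)
  then have "continuous_on UNIV (\<lambda>s. partial_deriv i f (line i s t))"
    by (rule continuous_on_compose2[OF _ line]) auto
  then show "isCont (\<lambda>s. partial_deriv i f (line i s t)) s" for s
    by (simp add: continuous_on_eq_continuous_at)
qed

lemma C1c_line_integral: "(LINT s|lborel. partial_deriv i f (line i s t)) = 0"
proof -
  obtain R where R: "R > 0" "\<And>x. norm x \<ge> R \<Longrightarrow> f x = 0" "\<And>i x. norm x \<ge> R \<Longrightarrow> partial_deriv i f x = 0"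
    using C1c_support[OF f] by blast
  have ge: "norm (line i s t) \<ge> R" if "\<bar>s\<bar> \<ge> R" for s
    using norm_line_ge[of s i t] that by linarith
  have eq: "partial_deriv i f (line i s t) * indicator {-R..R} s = partial_deriv i f (line i s t)" for s
  proof (cases "\<bar>s\<bar> \<ge> R")
    case True
    then show ?thesis using ge R by simp
  qed (auto simp: indicator_def)
  then show ?thesis
    using has_bochner_integral_integral_eq[OF C1c_line_FTC[of "-R" R i t]] R(1) ge R(2)
    unfolding eq by simp
qed

text \<open>Far out on the line \<open>f\<close> vanishes, so its value is the integral of its
  derivative from there to \<open>s\<close>. The bound depends on the line but not on
  \<open>s\<close>.\<close>

lemma C1c_line_bound: "ennreal \<bar>f (line i s t)\<bar> \<le> (\<integral>\<^sup>+r. ennreal \<bar>partial_deriv i f (line i r t)\<bar> \<partial>lborel)"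
proof -
  obtain R where R: "R > 0" "\<And>x. norm x \<ge> R \<Longrightarrow> f x = 0"
    using C1c_support[OF f] by metis
  have ge: "norm (line i s t) \<ge> R" if "\<bar>s\<bar> \<ge> R" for s
    using norm_line_ge[of s i t] that by linarith
  show ?thesis
  proof (cases "s \<le> -R")
    case True
    then have "f (line i s t) = 0" using ge[of s] R by auto
    then show ?thesis by simp
  next
    case False
    have zero: "f (line i (-R) t) = 0" using ge[of "-R"] R by auto
    have int: "has_bochner_integral lborel (\<lambda>r. partial_deriv i f (line i r t) * indicator {-R..s} r)
        (f (line i s t))"
      using C1c_line_FTC[of "-R" s i t] False zero by simp
    have "ennreal (norm (f (line i s t))) \<le>
        (\<integral>\<^sup>+r. ennreal (norm (partial_deriv i f (line i r t) * indicator {-R..s} r)) \<partial>lborel)"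
      using integral_norm_bound_ennreal[OF integrable.intros[OF int]]
      by (simp add: has_bochner_integral_integral_eq[OF int])
    also have "\<dots> \<le> (\<integral>\<^sup>+r. ennreal \<bar>partial_deriv i f (line i r t)\<bar> \<partial>lborel)"
      by (intro nn_integral_mono ennreal_leI) (auto simp: indicator_def)
    finally show ?thesis by simp
  qed
qed

lemma C1c_integrable_partial_deriv: "integrable lborel (partial_deriv i f)"
proof -
  obtain R where R: "R > 0" "\<And>i x. norm x \<ge> R \<Longrightarrow> partial_deriv i f x = 0"
    using C1c_support[OF f] by metis
  have "integrable lborel (\<lambda>x. indicator (cball 0 R) x *\<^sub>R partial_deriv i f x)"
    by (rule borel_integrable_compact) (use f in \<open>auto simp: C1c_def intro: continuous_on_subset\<close>)
  moreover have "(\<lambda>x. indicator (cball 0 R) x *\<^sub>R partial_deriv i f x) = partial_deriv i f"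
    using R by (auto simp: indicator_def fun_eq_iff mem_cball_0)
  ultimately show ?thesis by simp
qed

text \<open>Fubini's theorem with the direction of differentiation as inner variable: along each
  line the integral of the derivative is 0 by compact support.\<close>

lemma C1c_integral_partial_deriv: "(LINT x|lborel. partial_deriv i f x) = 0"
proof -
  have int: "integrable (lborel \<Otimes>\<^sub>M lborel) (\<lambda>z. partial_deriv i f ((\<lambda>(s, t). line i s t) z))"
    using C1c_integrable_partial_deriv[of i]
    by (subst (asm) lborel_plane[of i, symmetric], subst (asm) integrable_distr_eq) auto
  have "(LINT x|lborel. partial_deriv i f x) =
      (LINT z|(lborel \<Otimes>\<^sub>M lborel). partial_deriv i f ((\<lambda>(s, t). line i s t) z))"
    using C1c_integrable_partial_deriv[of i]
    by (subst lborel_plane[of i, symmetric], subst integral_distr) auto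
  also have "\<dots> = (LINT t|lborel. (LINT s|lborel. partial_deriv i f (line i s t)))"
    using lborel_pair.integral_snd[of "\<lambda>s t. partial_deriv i f (line i s t)"] int
    by (simp add: case_prod_unfold)
  finally show ?thesis by (simp add: C1c_line_integral)
qed

end

lemma C1c_borel_measurable: "C1c f \<Longrightarrow> f \<in> borel_measurable borel"
  by (intro borel_measurable_continuous_onI C1c_continuous)

lemma C1c_borel_measurable_partial: "C1c f \<Longrightarrow> partial_deriv i f \<in> borel_measurable borel"
  by (intro borel_measurable_continuous_onI) (simp add: C1c_def)

text \<open>Ladyzhenskaya's inequality: \<open>f\<^sup>2\<close> at a point is bounded by the integral of its derivative
  along either coordinate line through the point.\<close>

lemma ladyzhenskaya:
  assumes f: "C1c f"
  shows "(\<integral>\<^sup>+x. ennreal (f x ^ 4) \<partial>lborel) \<le>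
    (\<integral>\<^sup>+x. ennreal ((f x)\<^sup>2 + (partial_deriv 1 f x)\<^sup>2) \<partial>lborel) *
    (\<integral>\<^sup>+x. ennreal ((f x)\<^sup>2 + (partial_deriv 2 f x)\<^sup>2) \<partial>lborel)"
proof -
  define g where "g x = f x * f x" for x
  have g: "C1c g" unfolding g_def using C1c_mult[OF f f] .
  note [measurable] = C1c_borel_measurable[OF f] C1c_borel_measurable_partial[OF f]
    C1c_borel_measurable_partial[OF g]
  have pd: "partial_deriv i g x = 2 * f x * partial_deriv i f x" for i x
    using partial_deriv_mult[of f x f i] f by (simp add: g_def[abs_def] C1c_def)
  have le: "\<bar>partial_deriv i g x\<bar> \<le> (f x)\<^sup>2 + (partial_deriv i f x)\<^sup>2" for i x
    using sum_squares_bound[of "\<bar>f x\<bar>" "\<bar>partial_deriv i f x\<bar>"] by (simp add: pd abs_mult)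
  define A where "A i t = (\<integral>\<^sup>+r. ennreal \<bar>partial_deriv i g (line i r t)\<bar> \<partial>lborel)" for i t
  have [measurable]: "A i \<in> borel_measurable lborel" for i
    unfolding A_def by (rule lborel.borel_measurable_nn_integral) (simp add: case_prod_unfold, measurable)
  have A: "(\<integral>\<^sup>+t. A i t \<partial>lborel) \<le> (\<integral>\<^sup>+x. ennreal ((f x)\<^sup>2 + (partial_deriv i f x)\<^sup>2) \<partial>lborel)" for i
    unfolding A_def
    by (subst nn_integral_plane[of "\<lambda>x. ennreal \<bar>partial_deriv i g x\<bar>", symmetric])
      (auto intro!: nn_integral_mono ennreal_leI le simp del: ennreal_plus)
  have "(\<integral>\<^sup>+x. ennreal (f x ^ 4) \<partial>lborel) = (\<integral>\<^sup>+t. \<integral>\<^sup>+s. ennreal (f (line 1 s t) ^ 4) \<partial>lborel \<partial>lborel)"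
    by (rule nn_integral_plane) measurable
  also have "\<dots> \<le> (\<integral>\<^sup>+t. \<integral>\<^sup>+s. A 1 t * A 2 s \<partial>lborel \<partial>lborel)"
  proof (intro nn_integral_mono)
    fix s t
    \<comment> \<open>The same point is reached along the first and along the second direction. One
      factor is bounded free of \<open>s\<close> and the other free of \<open>t\<close>, so the
      double integral of the bound factorizes.\<close>
    have "ennreal (f (line 1 s t) ^ 4) = ennreal \<bar>g (line 1 s t)\<bar> * ennreal \<bar>g (line 2 t s)\<bar>"
      using line_swap[of 1 2 s t]
      by (simp add: g_def ennreal_mult[symmetric] abs_mult power4_eq_xxxx mult_ac)
    also have "\<dots> \<le> A 1 t * A 2 s"
      unfolding A_def by (intro mult_mono C1c_line_bound g) auto
    finally show "ennreal (f (line 1 s t) ^ 4) \<le> A 1 t * A 2 s" .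
  qed
  also have "\<dots> = (\<integral>\<^sup>+t. A 1 t \<partial>lborel) * (\<integral>\<^sup>+s. A 2 s \<partial>lborel)"
    by (simp add: nn_integral_cmult nn_integral_multc)
  also have "\<dots> \<le> (\<integral>\<^sup>+x. ennreal ((f x)\<^sup>2 + (partial_deriv 1 f x)\<^sup>2) \<partial>lborel) *
    (\<integral>\<^sup>+x. ennreal ((f x)\<^sup>2 + (partial_deriv 2 f x)\<^sup>2) \<partial>lborel)"
    by (intro mult_mono A) auto
  finally show ?thesis .
qed

section \<open>Sobolev spaces\<close>

lemma test_function_borel_measurable:
  "\<phi> \<in> test_functions \<Omega> \<Longrightarrow> \<phi> \<in> borel_measurable borel"
  by (rule C1c_borel_measurable[OF C1c_test_function])

lemma finite_index_lists: "finite {is :: 2 list. length is \<le> k}"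
  using finite_lists_length_le[of "UNIV :: 2 set" k] by simp

locale plane_domain =
  fixes \<Omega> :: "plane set"
  assumes open_domain: "open \<Omega>" and bounded_domain: "bounded \<Omega>"
begin

abbreviation "leb \<equiv> lebesgue_on \<Omega>"
abbreviation "tests \<equiv> test_functions \<Omega>"
abbreviation "inner2 \<equiv> l2_inner \<Omega>"
abbreviation "sqdist f g \<equiv> inner2 (\<lambda>x. f x - g x) (\<lambda>x. f x - g x)"

lemma lmeasurable_domain: "\<Omega> \<in> lmeasurable"
  using open_domain bounded_domain by (simp add: bounded_set_imp_lmeasurable)

lemma sets_domain: "\<Omega> \<in> sets lebesgue"
  using open_domain by auto

lemma borel_imp_measurable:
  assumes "f \<in> borel_measurable borel"
  shows "f \<in> borel_measurable leb"
  using assms by (intro measurable_restrict_space1 measurable_completion) simp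

lemma test_L2:
  assumes "\<phi> \<in> tests"
  shows "\<phi> \<in> L2 \<Omega>"
proof -
  let ?K = "closure {x. \<phi> x \<noteq> 0}"
  have "compact (\<phi> ` ?K)"
    using assms C1c_continuous[OF C1c_test_function[OF assms]]
    by (intro compact_continuous_image) (auto simp: test_functions_def intro: continuous_on_subset)
  then obtain B where "B > 0" "\<And>y. y \<in> \<phi> ` ?K \<Longrightarrow> norm y \<le> B"
    using compact_imp_bounded bounded_pos by metis
  then have "norm (\<phi> x) \<le> B" for x
    using closure_subset[of "{x. \<phi> x \<noteq> 0}"] by (cases "\<phi> x = 0") auto
  then show ?thesis
    using assms test_function_borel_measurable lmeasurable_domain borel_imp_measurable
    by (intro L2_bounded[where C=B]) auto
qed

section \<open>Integration by parts on the domain and weak derivatives\<close>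

lemma integral_domain_eq:
  fixes f :: "plane \<Rightarrow> real"
  assumes "f \<in> borel_measurable borel" "\<And>x. x \<notin> \<Omega> \<Longrightarrow> f x = 0"
  shows "(LINT x|leb. f x) = (LINT x|lborel. f x)"
proof -
  have "(\<lambda>x. indicat_real \<Omega> x * f x) = f"
    using assms(2) by (auto simp: fun_eq_iff indicator_def)
  then show ?thesis
    using assms(1) sets_domain by (simp add: integral_restrict_space integral_completion)
qed

lemma nn_integral_domain_eq:
  fixes f :: "plane \<Rightarrow> ennreal"
  assumes "\<And>x. x \<notin> \<Omega> \<Longrightarrow> f x = 0"
  shows "(\<integral>\<^sup>+x. f x \<partial>leb) = (\<integral>\<^sup>+x. f x \<partial>lborel)"
proof -
  have "(\<lambda>x. f x * indicator \<Omega> x) = f"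
    using assms by (auto simp: fun_eq_iff indicator_def)
  then show ?thesis
    using sets_domain by (simp add: nn_integral_restrict_space nn_integral_completion)
qed

lemma integration_by_parts:
  assumes "\<phi> \<in> tests" "\<psi> \<in> tests"
  shows "(LINT x|leb. \<phi> x * partial_deriv i \<psi> x) =
    - (LINT x|leb. partial_deriv i \<phi> x * \<psi> x)"
proof -
  have C: "C1c \<phi>" "C1c \<psi>" using assms by (auto intro: C1c_test_function)
  have pd: "partial_deriv i (\<lambda>x. \<phi> x * \<psi> x) x =
      partial_deriv i \<phi> x * \<psi> x + \<phi> x * partial_deriv i \<psi> x" for x
    using C by (intro partial_deriv_mult) (auto simp: C1c_def)
  note L2 = test_L2[OF assms(1)] test_L2[OF assms(2)]
    test_L2[OF test_function_partial_deriv[OF assms(1), of i]]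
    test_L2[OF test_function_partial_deriv[OF assms(2), of i]]
  have "0 = (LINT x|lborel. partial_deriv i (\<lambda>x. \<phi> x * \<psi> x) x)"
    by (rule C1c_integral_partial_deriv[OF C1c_mult[OF C], symmetric])
  also have "\<dots> = (LINT x|leb. partial_deriv i (\<lambda>x. \<phi> x * \<psi> x) x)"
    by (rule integral_domain_eq[OF C1c_borel_measurable_partial[OF C1c_mult[OF C]], symmetric])
      (simp add: pd test_function_eq_0[OF assms(1)] test_function_eq_0[OF assms(2)])
  also have "\<dots> = (LINT x|leb. partial_deriv i \<phi> x * \<psi> x) +
      (LINT x|leb. \<phi> x * partial_deriv i \<psi> x)"
    unfolding pd by (rule Bochner_Integration.integral_add) (intro L2_mult_integrable L2)+
  finally show ?thesis by simp
qed

text \<open>Integration by parts moves the outermost derivative off the test function first, and it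
  becomes the innermost one on \<phi>; hence the reversed list.\<close>

lemma has_weak_deriv_test:
  assumes "\<phi> \<in> tests"
  shows "has_weak_deriv \<Omega> is \<phi> (partial_derivs (rev is) \<phi>)"
  using assms
proof (induction "is" arbitrary: \<phi>)
  case Nil
  then show ?case by (simp add: has_weak_deriv_def)
next
  case (Cons i "is")
  show ?case unfolding has_weak_deriv_def
  proof
    fix \<psi> assume \<psi>: "\<psi> \<in> tests"
    have "(LINT x|leb. \<phi> x * partial_derivs (i # is) \<psi> x) =
        - (LINT x|leb. partial_deriv i \<phi> x * partial_derivs is \<psi> x)"
      unfolding partial_derivs_Cons
      by (rule integration_by_parts[OF Cons.prems test_function_partial_derivs[OF \<psi>]])
    also have "\<dots> = - ((-1) ^ length is *
        (LINT x|leb. partial_derivs (rev is) (partial_deriv i \<phi>) x * \<psi> x))"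
      using Cons.IH[OF test_function_partial_deriv[OF Cons.prems]] \<psi> by (simp add: has_weak_deriv_def)
    finally show "(LINT x|leb. \<phi> x * partial_derivs (i # is) \<psi> x) =
        (-1) ^ length (i # is) * (LINT x|leb. partial_derivs (rev (i # is)) \<phi> x * \<psi> x)"
      by (simp add: partial_derivs_append partial_derivs_Cons)
  qed
qed

lemma L2_integrable_fun: "f \<in> L2 \<Omega> \<Longrightarrow> integrable leb f" for f :: "plane \<Rightarrow> real"
  using L2_mult_integrable[of f \<Omega> "\<lambda>x. 1"] L2_bounded[of "\<lambda>x. 1 :: real" \<Omega> 1] lmeasurable_domain
  by simp

text \<open>The difference of two weak derivatives is orthogonal to all test functions. This is what
  turns identities for the chosen representative \<open>wderiv\<close> into identities almost
  everywhere.\<close>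

lemma has_weak_deriv_unique:
  assumes "g \<in> L2 \<Omega>" "g' \<in> L2 \<Omega>" "has_weak_deriv \<Omega> is f g" "has_weak_deriv \<Omega> is f g'"
  shows "AE x in leb. g x = g' x"
proof -
  have "AE x in leb. g x - g' x = 0"
  proof (rule integral_test_functions_imp_AE_0[OF open_domain])
    show "integrable leb (\<lambda>x. g x - g' x)"
      using assms by (intro Bochner_Integration.integrable_diff L2_integrable_fun)
    fix \<phi> assume \<phi>: "\<phi> \<in> tests"
    have "(LINT x|leb. g x * \<phi> x) = (LINT x|leb. g' x * \<phi> x)"
      using assms(3,4) \<phi> by (simp add: has_weak_deriv_def)
    then show "(LINT x|leb. (g x - g' x) * \<phi> x) = 0"
      using assms L2_mult_integrable[OF _ test_L2[OF \<phi>]]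
      by (simp add: left_diff_distrib)
  qed
  then show ?thesis by simp
qed

lemma has_weak_deriv_lincomb:
  assumes "f \<in> L2 \<Omega>" "f' \<in> L2 \<Omega>" "g \<in> L2 \<Omega>" "g' \<in> L2 \<Omega>"
    "has_weak_deriv \<Omega> is f g" "has_weak_deriv \<Omega> is f' g'"
  shows "has_weak_deriv \<Omega> is (\<lambda>x. f x + c * f' x) (\<lambda>x. g x + c * g' x)"
  unfolding has_weak_deriv_def
proof
  fix \<phi> assume \<phi>: "\<phi> \<in> tests"
  note int = L2_mult_integrable[OF _ test_L2[OF test_function_partial_derivs[OF \<phi>]]]
    L2_mult_integrable[OF _ test_L2[OF \<phi>]]
  have "(LINT x|leb. (f x + c * f' x) * partial_derivs is \<phi> x) =
      (LINT x|leb. f x * partial_derivs is \<phi> x) +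
      c * (LINT x|leb. f' x * partial_derivs is \<phi> x)"
    using assms int by (simp add: distrib_right mult.assoc)
  also have "\<dots> = (-1) ^ length is *
      ((LINT x|leb. g x * \<phi> x) + c * (LINT x|leb. g' x * \<phi> x))"
    using assms(5,6) \<phi> by (simp add: has_weak_deriv_def algebra_simps)
  also have "(LINT x|leb. g x * \<phi> x) + c * (LINT x|leb. g' x * \<phi> x) =
      (LINT x|leb. (g x + c * g' x) * \<phi> x)"
    using assms int by (simp add: distrib_right mult.assoc)
  finally show "(LINT x|leb. (f x + c * f' x) * partial_derivs is \<phi> x) =
      (-1) ^ length is * (LINT x|leb. (g x + c * g' x) * \<phi> x)" .
qed

lemma
  assumes "g \<in> L2 \<Omega>" "has_weak_deriv \<Omega> is f g"
  shows wderiv_in_L2: "wderiv \<Omega> is f \<in> L2 \<Omega>" and wderiv_weak: "has_weak_deriv \<Omega> is f (wderiv \<Omega> is f)"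
    and wderiv_AE: "AE x in leb. wderiv \<Omega> is f x = g x"
proof -
  have "wderiv \<Omega> is f \<in> L2 \<Omega> \<and> has_weak_deriv \<Omega> is f (wderiv \<Omega> is f)"
    unfolding wderiv_def by (rule someI[of _ g]) (use assms in simp)
  then show "wderiv \<Omega> is f \<in> L2 \<Omega>" "has_weak_deriv \<Omega> is f (wderiv \<Omega> is f)" by auto
  then show "AE x in leb. wderiv \<Omega> is f x = g x"
    using assms has_weak_deriv_unique by blast
qed

lemma W2_imp_L2: "f \<in> W2 \<Omega> k \<Longrightarrow> f \<in> L2 \<Omega>"
  by (simp add: W2_def)

lemma
  assumes "f \<in> W2 \<Omega> k" "length is \<le> k"
  shows wderiv_L2: "wderiv \<Omega> is f \<in> L2 \<Omega>"
    and wderiv_has_weak_deriv: "has_weak_deriv \<Omega> is f (wderiv \<Omega> is f)"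
  using assms wderiv_in_L2 wderiv_weak unfolding W2_def by blast+

lemma W2_lincomb:
  assumes "f \<in> W2 \<Omega> k" "g \<in> W2 \<Omega> k"
  shows "(\<lambda>x. f x + c * g x) \<in> W2 \<Omega> k"
  unfolding W2_def
proof (clarsimp, intro conjI allI impI)
  show "(\<lambda>x. f x + c * g x) \<in> L2 \<Omega>"
    using assms by (intro L2_add L2_cmult W2_imp_L2)
  fix "is" :: "2 list" assume "length is \<le> k"
  then show "\<exists>h\<in>L2 \<Omega>. has_weak_deriv \<Omega> is (\<lambda>x. f x + c * g x) h"
    using assms
    by (intro bexI[where x="\<lambda>x. wderiv \<Omega> is f x + c * wderiv \<Omega> is g x"] has_weak_deriv_lincomb
        L2_add L2_cmult W2_imp_L2[of _ k] wderiv_L2[of _ k] wderiv_has_weak_deriv[of _ k])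
qed

lemma wderiv_lincomb:
  assumes "f \<in> W2 \<Omega> k" "g \<in> W2 \<Omega> k" "length is \<le> k"
  shows "AE x in leb. wderiv \<Omega> is (\<lambda>x. f x + c * g x) x = wderiv \<Omega> is f x + c * wderiv \<Omega> is g x"
  using assms
  by (intro wderiv_AE has_weak_deriv_lincomb L2_add L2_cmult W2_imp_L2[of _ k] wderiv_L2[of _ k]
      wderiv_has_weak_deriv[of _ k])

lemma test_W2: "\<phi> \<in> tests \<Longrightarrow> \<phi> \<in> W2 \<Omega> k"
  unfolding W2_def
proof (intro CollectI conjI allI impI)
  show "\<exists>g\<in>L2 \<Omega>. has_weak_deriv \<Omega> is \<phi> g" if "\<phi> \<in> tests" for "is"
    using has_weak_deriv_test[OF that] test_L2[OF test_function_partial_derivs[OF that]] by (rule bexI)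
qed (auto intro: test_L2)

lemma wderiv_test:
  "\<phi> \<in> tests \<Longrightarrow> AE x in leb. wderiv \<Omega> is \<phi> x = partial_derivs (rev is) \<phi> x"
  by (intro wderiv_AE has_weak_deriv_test test_L2 test_function_partial_derivs)

lemma wderiv_Nil: "f \<in> L2 \<Omega> \<Longrightarrow> AE x in leb. wderiv \<Omega> [] f x = f x"
  by (intro wderiv_AE) (simp_all add: has_weak_deriv_def)

lemma sobolev_norm_tendsto_0_iff:
  "(\<lambda>n. sobolev_norm \<Omega> k (f n)) \<longlonglongrightarrow> 0 \<longleftrightarrow>
    (\<forall>is. length is \<le> k \<longrightarrow> (\<lambda>n. inner2 (wderiv \<Omega> is (f n)) (wderiv \<Omega> is (f n))) \<longlonglongrightarrow> 0)"
    (is "?L \<longleftrightarrow> ?R")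
proof
  let ?S = "\<lambda>n. \<Sum>is | length is \<le> k. inner2 (wderiv \<Omega> is (f n)) (wderiv \<Omega> is (f n))"
  have nonneg: "?S n \<ge> 0" for n by (intro sum_nonneg l2_inner_self_nonneg)
  {
    assume ?L
    then have "(\<lambda>n. (sobolev_norm \<Omega> k (f n))\<^sup>2) \<longlonglongrightarrow> 0\<^sup>2" by (intro tendsto_power)
    then have S: "?S \<longlonglongrightarrow> 0" using nonneg by (simp add: sobolev_norm_def)
    show ?R
    proof (intro allI impI)
      fix "is" :: "2 list" assume "length is \<le> k"
      then have "inner2 (wderiv \<Omega> is (f n)) (wderiv \<Omega> is (f n)) \<le> ?S n" for n
        using finite_index_lists by (intro member_le_sum) (auto intro: l2_inner_self_nonneg)
      then show "(\<lambda>n. inner2 (wderiv \<Omega> is (f n)) (wderiv \<Omega> is (f n))) \<longlonglongrightarrow> 0"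
        by (intro tendsto_sandwich[OF _ _ tendsto_const S] always_eventually allI l2_inner_self_nonneg)
    qed
  }
  assume ?R
  then have "(\<lambda>n. sqrt (?S n)) \<longlonglongrightarrow> sqrt (\<Sum>is::2 list | length is \<le> k. 0)"
    by (intro tendsto_real_sqrt tendsto_sum) auto
  then show ?L by (simp add: sobolev_norm_def)
qed

text \<open>By the reversal in the order of differentiation, \<open>partial_derivs (rev is)\<close> is the classical
  counterpart of \<open>wderiv \<Omega> is\<close>.\<close>

lemma W20_iff:
  "f \<in> W20 \<Omega> k \<longleftrightarrow> f \<in> W2 \<Omega> k \<and> (\<exists>\<phi>. (\<forall>n. \<phi> n \<in> tests) \<and>
    (\<forall>is. length is \<le> k \<longrightarrow>
      (\<lambda>n. sqdist (wderiv \<Omega> is f) (partial_derivs (rev is) (\<phi> n))) \<longlonglongrightarrow> 0))"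
proof -
  have eq: "inner2 (wderiv \<Omega> is (\<lambda>x. f x - \<phi> x)) (wderiv \<Omega> is (\<lambda>x. f x - \<phi> x)) =
      sqdist (wderiv \<Omega> is f) (partial_derivs (rev is) \<phi>)"
    if f: "f \<in> W2 \<Omega> k" and \<phi>: "\<phi> \<in> tests" and "is": "length is \<le> k" for \<phi> "is"
  proof -
    have "AE x in leb. wderiv \<Omega> is (\<lambda>x. f x + (-1) * \<phi> x) x =
        wderiv \<Omega> is f x + (-1) * wderiv \<Omega> is \<phi> x"
      by (rule wderiv_lincomb[OF f test_W2[OF \<phi>] "is"])
    then have "AE x in leb. wderiv \<Omega> is (\<lambda>x. f x - \<phi> x) x =
        wderiv \<Omega> is f x - partial_derivs (rev is) \<phi> x"
      using wderiv_test[OF \<phi>, of "is"] by eventually_elim simp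
    moreover have "wderiv \<Omega> is (\<lambda>x. f x - \<phi> x) \<in> L2 \<Omega>"
      using wderiv_L2[OF W2_lincomb[OF f test_W2[OF \<phi>], of "-1"] "is"] by simp
    ultimately show ?thesis
      using wderiv_L2[OF f "is"] test_L2[OF test_function_partial_derivs[OF \<phi>]]
      by (intro l2_inner_cong_AE L2_diff) auto
  qed
  show ?thesis
    unfolding W20_def sobolev_norm_tendsto_0_iff mem_Collect_eq
    by (intro conj_cong refl arg_cong[where f=Ex] ext) (simp add: eq)
qed

lemma W20_imp_W2: "f \<in> W20 \<Omega> k \<Longrightarrow> f \<in> W2 \<Omega> k"
  by (simp add: W20_def)

lemma W20_approx:
  assumes "f \<in> W20 \<Omega> k"
  obtains \<phi> where "\<And>n. \<phi> n \<in> tests"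
    "\<And>is. length is \<le> k \<Longrightarrow>
      (\<lambda>n. sqdist (wderiv \<Omega> is f) (partial_derivs (rev is) (\<phi> n))) \<longlonglongrightarrow> 0"
  using assms unfolding W20_iff by blast

lemma l2_inner_lincomb_le:
  fixes f g :: "plane \<Rightarrow> real"
  assumes "f \<in> L2 \<Omega>" "g \<in> L2 \<Omega>"
  shows "inner2 (\<lambda>x. f x + c * g x) (\<lambda>x. f x + c * g x) \<le> 2 * inner2 f f + 2 * c\<^sup>2 * inner2 g g"
proof -
  have "inner2 (\<lambda>x. f x + c * g x) (\<lambda>x. f x + c * g x) \<le>
      (LINT x|leb. 2 * (f x * f x) + 2 * c\<^sup>2 * (g x * g x))"
    unfolding l2_inner_def inner_real_def
  proof (rule integral_mono)
    fix x
    show "(f x + c * g x) * (f x + c * g x) \<le> 2 * (f x * f x) + 2 * c\<^sup>2 * (g x * g x)"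
      using zero_le_power2[of "f x - c * g x"] by (simp add: power2_eq_square algebra_simps)
  qed (intro L2_mult_integrable L2_add L2_cmult assms Bochner_Integration.integrable_add
      integrable_mult_right)+
  also have "\<dots> = 2 * inner2 f f + 2 * c\<^sup>2 * inner2 g g"
    using assms L2_mult_integrable by (simp add: l2_inner_def)
  finally show ?thesis .
qed

lemma W20_lincomb:
  assumes f: "f \<in> W20 \<Omega> k" and g: "g \<in> W20 \<Omega> k"
  shows "(\<lambda>x. f x + c * g x) \<in> W20 \<Omega> k"
proof -
  obtain \<phi> where \<phi>: "\<And>n. \<phi> n \<in> tests" "\<And>is. length is \<le> k \<Longrightarrow>
      (\<lambda>n. sqdist (wderiv \<Omega> is f) (partial_derivs (rev is) (\<phi> n))) \<longlonglongrightarrow> 0"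
    using W20_approx[OF f] by blast
  obtain \<psi> where \<psi>: "\<And>n. \<psi> n \<in> tests" "\<And>is. length is \<le> k \<Longrightarrow>
      (\<lambda>n. sqdist (wderiv \<Omega> is g) (partial_derivs (rev is) (\<psi> n))) \<longlonglongrightarrow> 0"
    using W20_approx[OF g] by blast
  show ?thesis unfolding W20_iff
  proof (intro conjI exI[of _ "\<lambda>n x. \<phi> n x + c * \<psi> n x"] allI impI)
    show "(\<lambda>x. f x + c * g x) \<in> W2 \<Omega> k" using f g by (intro W2_lincomb W20_imp_W2)
    show "(\<lambda>x. \<phi> n x + c * \<psi> n x) \<in> tests" for n
      using \<phi>(1) \<psi>(1) by (rule test_function_lincomb)
    fix "is" :: "2 list" assume k: "length is \<le> k"
    let ?a = "\<lambda>n x. wderiv \<Omega> is f x - partial_derivs (rev is) (\<phi> n) x"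
    let ?b = "\<lambda>n x. wderiv \<Omega> is g x - partial_derivs (rev is) (\<psi> n) x"
    let ?d = "\<lambda>n x. wderiv \<Omega> is (\<lambda>x. f x + c * g x) x - partial_derivs (rev is) (\<lambda>x. \<phi> n x + c * \<psi> n x) x"
    have ab: "?a n \<in> L2 \<Omega>" "?b n \<in> L2 \<Omega>" for n
      using wderiv_L2[OF W20_imp_W2[OF f] k] wderiv_L2[OF W20_imp_W2[OF g] k]
        test_L2[OF test_function_partial_derivs[OF \<phi>(1)]] test_L2[OF test_function_partial_derivs[OF \<psi>(1)]]
      by (auto intro: L2_diff)
    \<comment> \<open>Being a chosen representative, \<open>wderiv\<close> is linear only almost
      everywhere, which suffices inside the integral.\<close>
    have "inner2 (?d n) (?d n) = inner2 (\<lambda>x. ?a n x + c * ?b n x) (\<lambda>x. ?a n x + c * ?b n x)" for n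
    proof -
      have "AE x in leb. ?d n x = ?a n x + c * ?b n x"
        using wderiv_lincomb[OF W20_imp_W2[OF f] W20_imp_W2[OF g] k, of c]
        by eventually_elim (simp add: partial_derivs_lincomb[OF \<phi>(1) \<psi>(1)] algebra_simps)
      moreover have "?d n \<in> L2 \<Omega>"
        using wderiv_L2[OF W2_lincomb[OF W20_imp_W2[OF f] W20_imp_W2[OF g]] k]
          test_L2[OF test_function_partial_derivs[OF test_function_lincomb[OF \<phi>(1) \<psi>(1)]]]
        by (intro L2_diff)
      ultimately show ?thesis
        by (intro l2_inner_cong_AE L2_add L2_cmult ab)
    qed
    then have le: "inner2 (?d n) (?d n) \<le> 2 * inner2 (?a n) (?a n) + 2 * c\<^sup>2 * inner2 (?b n) (?b n)" for n
      using l2_inner_lincomb_le[OF ab] by simp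
    have "(\<lambda>n. 2 * inner2 (?a n) (?a n) + 2 * c\<^sup>2 * inner2 (?b n) (?b n)) \<longlonglongrightarrow> 2 * 0 + 2 * c\<^sup>2 * 0"
      by (intro tendsto_intros \<phi>(2)[OF k] \<psi>(2)[OF k])
    then have "(\<lambda>n. 2 * inner2 (?a n) (?a n) + 2 * c\<^sup>2 * inner2 (?b n) (?b n)) \<longlonglongrightarrow> 0"
      by (simp only: mult_zero_right add_0_right)
    then show "(\<lambda>n. inner2 (?d n) (?d n)) \<longlonglongrightarrow> 0"
      by (rule tendsto_sandwich[OF _ _ tendsto_const, rotated 2])
        (intro always_eventually allI l2_inner_self_nonneg le)+
  qed
qed

lemma W20_diff: "f \<in> W20 \<Omega> k \<Longrightarrow> g \<in> W20 \<Omega> k \<Longrightarrow> (\<lambda>x. f x - g x) \<in> W20 \<Omega> k"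
  using W20_lincomb[of f k g "-1"] by simp

lemma test_W20:
  assumes "\<phi> \<in> tests"
  shows "\<phi> \<in> W20 \<Omega> k"
  unfolding W20_iff
proof (intro conjI exI[of _ "\<lambda>n. \<phi>"] allI impI)
  fix "is" :: "2 list"
  have "sqdist (wderiv \<Omega> is \<phi>) (partial_derivs (rev is) \<phi>) = inner2 (\<lambda>x. 0 :: real) (\<lambda>x. 0)"
    using wderiv_test[OF assms, of "is"] wderiv_L2[OF test_W2[OF assms] order_refl]
      test_L2[OF test_function_partial_derivs[OF assms]]
    by (intro l2_inner_cong_AE L2_diff L2_zero) auto
  then show "(\<lambda>n. sqdist (wderiv \<Omega> is \<phi>) (partial_derivs (rev is) \<phi>)) \<longlonglongrightarrow> 0"
    by (simp add: l2_inner_def)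
qed (use assms test_W2 in auto)

lemma l2_inner_bounded_of_tendsto:
  fixes f :: "plane \<Rightarrow> real"
  assumes "f \<in> L2 \<Omega>" "\<And>n. g n \<in> L2 \<Omega>"
    "(\<lambda>n. sqdist f (g n)) \<longlonglongrightarrow> 0"
  obtains C where "\<And>n. inner2 (g n) (g n) \<le> C"
proof -
  obtain B where B: "\<And>n. \<bar>sqdist f (g n)\<bar> \<le> B"
    using convergent_imp_Bseq[OF convergentI[OF assms(3)]] by (auto simp: Bseq_def)
  have "inner2 (g n) (g n) \<le> 2 * inner2 f f + 2 * B" for n
    using l2_inner_lincomb_le[OF assms(1) L2_diff[OF assms(1) assms(2)[of n]], of "-1"] B[of n]
    by simp
  then show ?thesis using that by blast
qed

text \<open>Ladyzhenskaya's inequality; each of its two factors is the sum of two squared norms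
  bounded by \<open>C\<close>. Test functions and their derivatives vanish off \<Omega>, so
  integrals over the plane and over \<Omega> agree.\<close>

lemma test_nn_integral_power4:
  assumes \<phi>: "\<phi> \<in> tests"
    and "inner2 \<phi> \<phi> \<le> C" "\<And>i. inner2 (partial_deriv i \<phi>) (partial_deriv i \<phi>) \<le> C"
  shows "(\<integral>\<^sup>+x. ennreal ((\<phi> x)^4) \<partial>leb) \<le> ennreal (2 * C) * ennreal (2 * C)"
proof -
  have L2: "\<phi> \<in> L2 \<Omega>" "partial_deriv i \<phi> \<in> L2 \<Omega>" for i
    using test_L2[OF \<phi>] test_L2[OF test_function_partial_deriv[OF \<phi>]] by auto
  have le: "(\<integral>\<^sup>+x. ennreal ((\<phi> x)\<^sup>2 + (partial_deriv i \<phi> x)\<^sup>2) \<partial>lborel) \<le> ennreal (2 * C)" for i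
  proof -
    have "(\<integral>\<^sup>+x. ennreal ((\<phi> x)\<^sup>2 + (partial_deriv i \<phi> x)\<^sup>2) \<partial>lborel) =
        (\<integral>\<^sup>+x. ennreal ((\<phi> x)\<^sup>2 + (partial_deriv i \<phi> x)\<^sup>2) \<partial>leb)"
      by (rule nn_integral_domain_eq[symmetric])
        (simp add: test_function_eq_0[OF \<phi>] test_function_eq_0[OF test_function_partial_deriv[OF \<phi>]])
    also have "\<dots> = ennreal (LINT x|leb. (\<phi> x)\<^sup>2 + (partial_deriv i \<phi> x)\<^sup>2)"
      using L2_integrable[OF L2(1)] L2_integrable[OF L2(2)[of i]]
      by (intro nn_integral_eq_integral) auto
    also have "(LINT x|leb. (\<phi> x)\<^sup>2 + (partial_deriv i \<phi> x)\<^sup>2) =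
        inner2 \<phi> \<phi> + inner2 (partial_deriv i \<phi>) (partial_deriv i \<phi>)"
      using L2_integrable[OF L2(1)] L2_integrable[OF L2(2)[of i]]
      by (simp add: l2_inner_self)
    also have "ennreal \<dots> \<le> ennreal (2 * C)"
      using assms(2) assms(3)[of i] by (intro ennreal_leI) linarith
    finally show ?thesis .
  qed
  have "(\<integral>\<^sup>+x. ennreal ((\<phi> x)^4) \<partial>leb) = (\<integral>\<^sup>+x. ennreal ((\<phi> x)^4) \<partial>lborel)"
    by (rule nn_integral_domain_eq) (simp add: test_function_eq_0[OF \<phi>])
  also have "\<dots> \<le> ennreal (2 * C) * ennreal (2 * C)"
    by (rule order_trans[OF ladyzhenskaya[OF C1c_test_function[OF \<phi>]]]) (intro mult_mono le, auto)
  finally show ?thesis .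
qed

text \<open>Bounded derivatives of the approximants give a uniform bound on the integrals of their
  fourth powers, and Fatou's lemma along an almost everywhere convergent subsequence transfers it to
  \<open>f\<close>. This is the route to gradients in \<open>L4\<close>.\<close>

lemma square_in_L2_of_test_limit:
  fixes f :: "plane \<Rightarrow> real"
  assumes f: "f \<in> L2 \<Omega>" and \<phi>: "\<And>n. \<phi> n \<in> tests"
    and lim: "(\<lambda>n. sqdist f (\<phi> n)) \<longlonglongrightarrow> 0"
    and C: "\<And>n i. inner2 (partial_deriv i (\<phi> n)) (partial_deriv i (\<phi> n)) \<le> C"
  shows "(\<lambda>x. (f x)\<^sup>2) \<in> L2 \<Omega>"
proof -
  have [measurable]: "f \<in> borel_measurable leb" "\<phi> n \<in> borel_measurable leb" for n
    using f test_L2[OF \<phi>] by (auto intro: L2_measurable)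
  obtain C' where C': "\<And>n. inner2 (\<phi> n) (\<phi> n) \<le> C'"
    using l2_inner_bounded_of_tendsto[OF f test_L2[OF \<phi>] lim] by blast
  define D where "D = max C C'"
  have bound: "(\<integral>\<^sup>+x. ennreal ((\<phi> n x)^4) \<partial>leb) \<le> ennreal (2 * D) * ennreal (2 * D)" for n
    by (rule test_nn_integral_power4[OF \<phi>]) (use C C' in \<open>auto simp: D_def le_max_iff_disj\<close>)
  have "\<exists>r::nat\<Rightarrow>nat. strict_mono r \<and> (AE x in leb. (\<lambda>n. (f x - \<phi> (r n) x)\<^sup>2) \<longlonglongrightarrow> 0)"
  proof (rule tendsto_L1_AE_subseq)
    show "integrable leb (\<lambda>x. (f x - \<phi> n x)\<^sup>2)" for n
      using L2_integrable[OF L2_diff[OF f test_L2[OF \<phi>]]] by simp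
    show "(\<lambda>n. LINT x|leb. norm ((f x - \<phi> n x)\<^sup>2)) \<longlonglongrightarrow> 0"
      using lim by (simp add: l2_inner_self)
  qed
  then obtain r where r: "AE x in leb. (\<lambda>n. (f x - \<phi> (r n) x)\<^sup>2) \<longlonglongrightarrow> 0" by blast
  have "(\<integral>\<^sup>+x. ennreal ((f x)^4) \<partial>leb) =
      (\<integral>\<^sup>+x. liminf (\<lambda>n. ennreal ((\<phi> (r n) x)^4)) \<partial>leb)"
  proof (rule nn_integral_cong_AE, use r in eventually_elim)
    fix x assume "(\<lambda>n. (f x - \<phi> (r n) x)\<^sup>2) \<longlonglongrightarrow> 0"
    then have "(\<lambda>n. sqrt ((f x - \<phi> (r n) x)\<^sup>2)) \<longlonglongrightarrow> sqrt 0" by (rule tendsto_real_sqrt)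
    then have "(\<lambda>n. f x - \<phi> (r n) x) \<longlonglongrightarrow> 0" by (simp add: tendsto_rabs_zero_iff)
    then have "(\<lambda>n. f x - (f x - \<phi> (r n) x)) \<longlonglongrightarrow> f x - 0" by (intro tendsto_diff tendsto_const)
    then have "(\<lambda>n. \<phi> (r n) x) \<longlonglongrightarrow> f x" by simp
    then have "(\<lambda>n. ennreal ((\<phi> (r n) x)^4)) \<longlonglongrightarrow> ennreal ((f x)^4)"
      by (intro tendsto_ennrealI tendsto_power)
    then show "ennreal ((f x)^4) = liminf (\<lambda>n. ennreal ((\<phi> (r n) x)^4))"
      by (rule lim_imp_Liminf[OF sequentially_bot, symmetric])
  qed
  also have "\<dots> \<le> liminf (\<lambda>n. \<integral>\<^sup>+x. ennreal ((\<phi> (r n) x)^4) \<partial>leb)"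
    by (rule nn_integral_liminf) measurable
  also have "\<dots> \<le> liminf (\<lambda>n. ennreal (2 * D) * ennreal (2 * D))"
    by (intro Liminf_mono always_eventually allI bound)
  also have "\<dots> < \<infinity>"
    by (simp add: Liminf_const ennreal_mult_less_top)
  finally have fin: "(\<integral>\<^sup>+x. ennreal ((f x)^4) \<partial>leb) < \<infinity>" .
  have "integrable leb (\<lambda>x. (f x)^4)"
    by (rule integrableI_bounded) (use fin in auto)
  then show ?thesis by (simp add: L2_def flip: power_mult)
qed

text \<open>Both sides of the equilibrium equation are continuous in the Sobolev norm of the test
  function, and test functions are dense in \<open>W20\<close> by definition. It serves for each row
  of \<open>N\<close> as well as for \<open>Q\<close>.\<close>

lemma pairing_extends_to_W20:
  fixes q :: "plane \<Rightarrow> real^2"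
  assumes q: "q \<in> L2 \<Omega>" and s: "s \<in> L2 \<Omega>"
    and test: "\<And>\<phi>. \<phi> \<in> tests \<Longrightarrow>
      - (\<Sum>\<beta>\<in>UNIV. LINT x|leb. q x $ \<beta> * partial_deriv \<beta> \<phi> x) + (LINT x|leb. s x * \<phi> x) = 0"
    and f: "f \<in> W20 \<Omega> k" and k: "k \<ge> 1"
  shows "(\<Sum>\<beta>\<in>UNIV. inner2 (wderiv \<Omega> [\<beta>] f) (\<lambda>x. q x $ \<beta>)) = inner2 f s"
proof -
  obtain \<phi> where \<phi>: "\<And>n. \<phi> n \<in> tests" "\<And>is. length is \<le> k \<Longrightarrow>
      (\<lambda>n. sqdist (wderiv \<Omega> is f) (partial_derivs (rev is) (\<phi> n))) \<longlonglongrightarrow> 0"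
    using W20_approx[OF f] by blast
  have lim: "(\<lambda>n. inner2 (partial_derivs (rev is) (\<phi> n)) g) \<longlonglongrightarrow> inner2 (wderiv \<Omega> is f) g"
    if "length is \<le> k" "g \<in> L2 \<Omega>" for "is" g
    by (rule l2_inner_tendsto[OF test_L2[OF test_function_partial_derivs[OF \<phi>(1)]]
          wderiv_L2[OF W20_imp_W2[OF f] that(1)] that(2) \<phi>(2)[OF that(1)]])
  have "(\<lambda>n. \<Sum>\<beta>\<in>UNIV. inner2 (partial_derivs (rev [\<beta>]) (\<phi> n)) (\<lambda>x. q x $ \<beta>)) \<longlonglongrightarrow>
      (\<Sum>\<beta>\<in>UNIV. inner2 (wderiv \<Omega> [\<beta>] f) (\<lambda>x. q x $ \<beta>))"
    using k q by (intro tendsto_sum lim L2_nth) auto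
  \<comment> \<open>Writing the test function as its derivative along the empty list lets
    \<open>lim\<close> cover both sides of the equation.\<close>
  moreover have "(\<Sum>\<beta>\<in>UNIV. inner2 (partial_derivs (rev [\<beta>]) (\<phi> n)) (\<lambda>x. q x $ \<beta>)) =
      inner2 (partial_derivs (rev []) (\<phi> n)) s" for n
    using test[OF \<phi>(1)[of n]] by (simp add: l2_inner_def partial_derivs_Cons mult.commute)
  ultimately have "(\<lambda>n. inner2 (partial_derivs (rev []) (\<phi> n)) s) \<longlonglongrightarrow>
      (\<Sum>\<beta>\<in>UNIV. inner2 (wderiv \<Omega> [\<beta>] f) (\<lambda>x. q x $ \<beta>))" by simp
  moreover have "(\<lambda>n. inner2 (partial_derivs (rev []) (\<phi> n)) s) \<longlonglongrightarrow> inner2 (wderiv \<Omega> [] f) s"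
    by (rule lim) (use s in auto)
  ultimately have "(\<Sum>\<beta>\<in>UNIV. inner2 (wderiv \<Omega> [\<beta>] f) (\<lambda>x. q x $ \<beta>)) = inner2 (wderiv \<Omega> [] f) s"
    by (rule LIMSEQ_unique)
  also have "\<dots> = inner2 f s"
    by (intro l2_inner_cong_AE wderiv_Nil)
      (use s W2_imp_L2[OF W20_imp_W2[OF f]] wderiv_L2[OF W20_imp_W2[OF f], of "[]"] in auto)
  finally show ?thesis .
qed

end

section \<open>Tensors and matrices\<close>

lemma transpose_nth: "transpose A $ i $ j = A $ j $ i"
  by (simp add: transpose_def)

lemma transpose_add_scale:
  "transpose (A + B) = transpose A + (transpose B :: real^'n^'m)"
  "transpose (A - B) = transpose A - (transpose B :: real^'n^'m)"
  "transpose (c *\<^sub>R A) = c *\<^sub>R (transpose A :: real^'n^'m)"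
  by (simp_all add: transpose_def vec_eq_iff)

lemma transpose_eq_iff: "transpose A = A \<longleftrightarrow> (\<forall>i j. A $ i $ j = A $ j $ i)"
  by (auto simp: transpose_def vec_eq_iff)

lemma inner_matrix: "A \<bullet> B = (\<Sum>i\<in>UNIV. \<Sum>j\<in>UNIV. A $ i $ j * B $ i $ j)"
  for A B :: "real^'n^'m"
  by (simp add: inner_vec_def)

lemma inner_transpose: "transpose A \<bullet> transpose B = (A :: real^'n^'m) \<bullet> B"
  unfolding inner_matrix transpose_nth by (rule sum.swap)

definition sym_part :: "real^2^2 \<Rightarrow> real^2^2" where
  "sym_part T = (1/2) *\<^sub>R (T + transpose T)"

lemma transpose_sym_part: "transpose (sym_part T) = sym_part T"
  by (simp add: sym_part_def transpose_add_scale add.commute)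

lemma sym_part_id: "transpose T = T \<Longrightarrow> sym_part T = T"
  by (simp add: sym_part_def flip: scaleR_2)

lemma sym_part_nth: "sym_part T $ i $ j = (T $ i $ j + T $ j $ i) / 2"
  by (simp add: sym_part_def transpose_nth)

lemma linear_sym_part: "linear sym_part"
  by (simp add: linear_iff sym_part_def transpose_add_scale algebra_simps)

lemma sym_part_inner:
  assumes "transpose S = S"
  shows "sym_part T \<bullet> S = T \<bullet> S"
proof -
  have "transpose T \<bullet> S = T \<bullet> S" using inner_transpose[of T S] assms by simp
  then show ?thesis by (simp add: sym_part_def inner_add_left)
qed

section \<open>Fourth order tensors as operators on matrices\<close>

lemma tensor_app_nth: "tensor_app H T $ \<alpha> $ \<beta> = (\<Sum>\<rho>\<in>UNIV. \<Sum>\<mu>\<in>UNIV. H \<alpha> \<beta> \<rho> \<mu> * T $ \<rho> $ \<mu>)"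
  by (simp add: tensor_app_def)

lemma linear_tensor_app: "linear (tensor_app H)"
  by (simp add: linear_iff tensor_app_def vec_eq_iff sum.distrib algebra_simps sum_distrib_left)

lemma bounded_linear_tensor_app: "bounded_linear (tensor_app H)"
  using linear_tensor_app linear_conv_bounded_linear by blast

lemmas tensor_app_add = linear_add[OF linear_tensor_app]
  and tensor_app_diff = linear_diff[OF linear_tensor_app]
  and tensor_app_scaleR = linear_scale[OF linear_tensor_app]

lemma transpose_tensor_app: "minor_symmetric H \<Longrightarrow> transpose (tensor_app H T) = tensor_app H T"
  unfolding transpose_eq_iff tensor_app_nth by (auto simp: minor_symmetric_def intro!: sum.cong)

lemma tensor_app_transpose: "minor_symmetric H \<Longrightarrow> tensor_app H (transpose T) = tensor_app H T"
  unfolding vec_eq_iff tensor_app_nth transpose_nth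
  by (subst sum.swap) (auto simp: minor_symmetric_def intro!: sum.cong)

lemma tensor_app_sym_part:
  assumes "minor_symmetric H"
  shows "tensor_app H (sym_part T) = tensor_app H T"
  using tensor_app_transpose[OF assms, of T]
  by (simp add: sym_part_def tensor_app_add tensor_app_scaleR flip: scaleR_2)

lemma tensor_app_inner_commute:
  assumes "\<And>\<alpha> \<beta> \<rho> \<mu>. H \<alpha> \<beta> \<rho> \<mu> = H \<rho> \<mu> \<alpha> \<beta>"
  shows "S \<bullet> tensor_app H T = T \<bullet> tensor_app H S"
  unfolding inner_matrix tensor_app_nth by (simp add: sum_2 assms algebra_simps)

lemma tensor_form_nonneg:
  assumes "minor_symmetric H" "pos_def_tensor H"
  shows "0 \<le> T \<bullet> tensor_app H T"
proof -
  have "T \<bullet> tensor_app H T = sym_part T \<bullet> tensor_app H (sym_part T)"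
    by (simp add: assms tensor_app_sym_part sym_part_inner transpose_tensor_app)
  also have "\<dots> \<ge> 0"
    using assms(2) transpose_sym_part[of T] unfolding pos_def_tensor_def
    by (cases "sym_part T = 0") (auto intro: less_imp_le)
  finally show ?thesis .
qed

text \<open>\<open>H\<close> annihilates antisymmetric matrices, so linear algebra on the full
  matrix space is applied to \<open>L\<close>, which agrees with \<open>H\<close> on symmetric
  matrices and adds the antisymmetric part. The two summands of \<open>L T\<close> are symmetric and
  antisymmetric, hence \<open>L\<close> is injective and, by dimension, surjective.\<close>

lemma tensor_symmetric_range:
  assumes "minor_symmetric H" "pos_def_tensor H"
  obtains G where "linear G" "\<And>T. transpose T = T \<Longrightarrow> G (tensor_app H T) = T"
    "\<And>S. transpose S = S \<Longrightarrow> \<exists>T. transpose T = T \<and> S = tensor_app H T"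
proof -
  define L where "L T = tensor_app H T + (T - transpose T)" for T
  have trL: "transpose (L T) = tensor_app H T - (T - transpose T)" for T
    by (simp add: L_def transpose_add_scale transpose_tensor_app[OF assms(1)])
  have L: "linear L"
    by (simp add: L_def linear_iff tensor_app_add tensor_app_scaleR transpose_add_scale algebra_simps)
  have "inj L" unfolding linear_injective_0[OF L]
  proof (intro allI impI)
    fix T assume 0: "L T = 0"
    then have "transpose (L T) = 0" by (simp only: transpose_def vec_eq_iff) simp
    with trL[of T] have "tensor_app H T - (T - transpose T) = 0" by simp
    with 0 have eq: "tensor_app H T + (T - transpose T) = 0" "tensor_app H T - (T - transpose T) = 0"
      by (simp_all add: L_def)
    have "2 *\<^sub>R tensor_app H T = (tensor_app H T + (T - transpose T)) + (tensor_app H T - (T - transpose T))"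
      by (simp add: scaleR_2)
    then have "tensor_app H T = 0" using eq by simp
    moreover from this have "transpose T = T" using eq(1) by simp
    ultimately show "T = 0" using assms(2) unfolding pos_def_tensor_def by force
  qed
  obtain G where G: "linear G" "G \<circ> L = id"
    using linear_injective_left_inverse[OF L \<open>inj L\<close>] by blast
  show ?thesis
  proof (rule that[OF G(1)])
    show "G (tensor_app H T) = T" if "transpose T = T" for T
      using fun_cong[OF G(2), of T] that by (simp add: L_def)
    fix S :: "real^2^2" assume S: "transpose S = S"
    obtain T where T: "L T = S"
      using linear_injective_imp_surjective[OF L \<open>inj L\<close>] by (metis surjD)
    have "2 *\<^sub>R (T - transpose T) = L T - transpose (L T)"
      unfolding trL by (simp add: L_def scaleR_2)
    then have "transpose T = T" using T S by simp
    then show "\<exists>T. transpose T = T \<and> S = tensor_app H T" using T by (auto simp: L_def)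
  qed
qed

lemma matrix_unit_expansion: "T = (\<Sum>\<rho>\<in>UNIV. \<Sum>\<mu>\<in>UNIV. T $ \<rho> $ \<mu> *\<^sub>R axis \<rho> (axis \<mu> 1))"
  for T :: "real^2^2"
  by (simp add: vec_eq_iff forall_2 sum_2 axis_def)

text \<open>Justifies the definite description behind \<open>tensor_inv\<close>: existence comes
  from symmetrizing the inverse \<open>G\<close>, uniqueness from testing on symmetrized matrix
  units.\<close>

lemma
  assumes "minor_symmetric H" "pos_def_tensor H"
  shows minor_symmetric_tensor_inv: "minor_symmetric (tensor_inv H)"
    and tensor_inv_left: "transpose T = T \<Longrightarrow> tensor_app (tensor_inv H) (tensor_app H T) = T"
proof -
  obtain G where G: "linear G" "\<And>T. transpose T = T \<Longrightarrow> G (tensor_app H T) = T"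
    "\<And>S. transpose S = S \<Longrightarrow> \<exists>T. transpose T = T \<and> S = tensor_app H T"
    using tensor_symmetric_range[OF assms] by blast
  let ?P = "\<lambda>B. minor_symmetric B \<and> (\<forall>T. transpose T = T \<longrightarrow> tensor_app B (tensor_app H T) = T)"
  \<comment> \<open>The outer symmetrization makes the coefficients symmetric in the first index
    pair, the inner one in the second; on symmetric matrices neither changes the left inverse
    property.\<close>
  define C where "C T = sym_part (G (sym_part T))" for T
  have linC: "linear C"
    unfolding C_def using linear_compose[OF linear_compose[OF linear_sym_part G(1)] linear_sym_part]
    by (simp add: o_def)
  define B where "B \<alpha> \<beta> \<rho> \<mu> = C (axis \<rho> (axis \<mu> 1)) $ \<alpha> $ \<beta>" for \<alpha> \<beta> \<rho> \<mu>
  have app: "tensor_app B T = C T" for T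
  proof -
    have "C T = (\<Sum>\<rho>\<in>UNIV. \<Sum>\<mu>\<in>UNIV. T $ \<rho> $ \<mu> *\<^sub>R C (axis \<rho> (axis \<mu> 1)))"
      by (subst matrix_unit_expansion[of T]) (simp add: linear_sum[OF linC] linear_scale[OF linC])
    then show ?thesis by (simp add: vec_eq_iff tensor_app_nth B_def mult.commute)
  qed
  have "?P B"
  proof (intro conjI allI impI)
    show "minor_symmetric B" unfolding minor_symmetric_def
    proof (intro allI conjI)
      fix \<alpha> \<beta> \<rho> \<mu> :: 2
      show "B \<alpha> \<beta> \<rho> \<mu> = B \<beta> \<alpha> \<rho> \<mu>"
        by (simp add: B_def C_def sym_part_nth)
      have "sym_part (axis \<rho> (axis \<mu> 1)) = sym_part (axis \<mu> (axis \<rho> 1))"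
        by (auto simp: vec_eq_iff sym_part_nth axis_def)
      then show "B \<alpha> \<beta> \<rho> \<mu> = B \<alpha> \<beta> \<mu> \<rho>"
        by (simp add: B_def C_def)
    qed
    fix T :: "real^2^2" assume "transpose T = T"
    then show "tensor_app B (tensor_app H T) = T"
      by (simp add: app C_def sym_part_id transpose_tensor_app assms G)
  qed
  moreover have "B' = B" if "?P B'" for B'
  proof (intro ext)
    fix \<alpha> \<beta> \<rho> \<mu> :: 2
    \<comment> \<open>This matrix is symmetric, hence in the range of \<open>H\<close>, where any
      two left inverses agree; by minor symmetry its image reads off twice the coefficient.\<close>
    define S :: "real^2^2" where "S = axis \<rho> (axis \<mu> 1) + axis \<mu> (axis \<rho> 1)"
    have S: "transpose S = S" by (auto simp: transpose_eq_iff S_def axis_def)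
    have coeff: "tensor_app D S $ \<alpha> $ \<beta> = 2 * D \<alpha> \<beta> \<rho> \<mu>" if "minor_symmetric D" for D
    proof -
      have unit: "tensor_app D (axis r (axis m 1)) $ \<alpha> $ \<beta> = D \<alpha> \<beta> r m" for r m
        using exhaust_2[of r] exhaust_2[of m] by (auto simp: tensor_app_nth sum_2 axis_def)
      show ?thesis
        using that unfolding S_def tensor_app_add vector_add_component unit
        by (simp add: minor_symmetric_def)
    qed
    obtain T where "transpose T = T" "S = tensor_app H T" using G(3)[OF S] by blast
    then have "tensor_app B' S = tensor_app B S" using that \<open>?P B\<close> by simp
    then show "B' \<alpha> \<beta> \<rho> \<mu> = B \<alpha> \<beta> \<rho> \<mu>" using coeff that \<open>?P B\<close> by (metis mult_cancel_left zero_neq_numeral)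
  qed
  ultimately have "?P (tensor_inv H)"
    unfolding tensor_inv_def by (rule theI)
  then show "minor_symmetric (tensor_inv H)"
    "transpose T = T \<Longrightarrow> tensor_app (tensor_inv H) (tensor_app H T) = T" by auto
qed

lemma tensor_inv_right:
  assumes "minor_symmetric H" "pos_def_tensor H" "transpose S = S"
  shows "tensor_app H (tensor_app (tensor_inv H) S) = S"
proof -
  obtain T where "transpose T = T" "S = tensor_app H T"
    using tensor_symmetric_range[OF assms(1,2)] assms(3) by metis
  then show ?thesis using tensor_inv_left[OF assms(1,2)] by simp
qed

context
  fixes H assumes H: "symmetric_tensor H" and pos: "pos_def_tensor H"
begin

lemma minor_symmetric_H: "minor_symmetric H"
  using H by (simp add: symmetric_tensor_def)

lemma tensor_H_inner_commute: "S \<bullet> tensor_app H T = T \<bullet> tensor_app H S"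
  using H by (intro tensor_app_inner_commute) (simp add: symmetric_tensor_def)

lemma tensor_inv_inner_commute:
  assumes "transpose S = S" "transpose T = T"
  shows "S \<bullet> tensor_app (tensor_inv H) T = T \<bullet> tensor_app (tensor_inv H) S"
  using tensor_H_inner_commute[of "tensor_app (tensor_inv H) S" "tensor_app (tensor_inv H) T"]
    tensor_inv_right[OF minor_symmetric_H pos assms(1)] tensor_inv_right[OF minor_symmetric_H pos assms(2)]
  by (simp add: inner_commute)

text \<open>The gap between the two sides is half the nonnegative form of \<open>H\<close> at
  \<gamma> minus the inverse tensor applied to \<open>N\<close>, so it closes when that difference
  is zero.\<close>

lemma tensor_fenchel_young:
  assumes "transpose N = N"
  shows "\<gamma> \<bullet> N \<le> 1/2 * (\<gamma> \<bullet> tensor_app H \<gamma>) + 1/2 * (N \<bullet> tensor_app (tensor_inv H) N)"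
proof -
  let ?T = "tensor_app (tensor_inv H) N"
  have HT: "tensor_app H ?T = N" by (rule tensor_inv_right[OF minor_symmetric_H pos assms])
  have "0 \<le> (\<gamma> - ?T) \<bullet> tensor_app H (\<gamma> - ?T)"
    by (rule tensor_form_nonneg[OF minor_symmetric_H pos])
  also have "\<dots> = \<gamma> \<bullet> tensor_app H \<gamma> - 2 * (\<gamma> \<bullet> N) + N \<bullet> ?T"
    using tensor_H_inner_commute[of ?T \<gamma>]
    by (simp add: tensor_app_diff inner_diff_left inner_diff_right HT inner_commute)
  finally show ?thesis by simp
qed

lemma tensor_fenchel_young_eq:
  assumes "transpose N = N" "\<gamma> = tensor_app (tensor_inv H) N"
  shows "\<gamma> \<bullet> N = 1/2 * (\<gamma> \<bullet> tensor_app H \<gamma>) + 1/2 * (N \<bullet> tensor_app (tensor_inv H) N)"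
  using tensor_inv_right[OF minor_symmetric_H pos assms(1)] assms(2) by (simp add: inner_commute)

end

text \<open>The rank-one matrix with which a quadratic form becomes an inner product of matrices,
  linear in the matrix.\<close>

definition outer :: "real^2 \<Rightarrow> real^2 \<Rightarrow> real^2^2" where
  "outer x y = (\<chi> \<alpha> \<beta>. x $ \<alpha> * y $ \<beta>)"

lemma outer_nth: "outer x y $ \<alpha> $ \<beta> = x $ \<alpha> * y $ \<beta>"
  by (simp add: outer_def)

lemma transpose_outer_self: "transpose (outer x x) = outer x x"
  by (simp add: transpose_eq_iff outer_nth mult.commute)

lemma inner_matrix_vector: "x \<bullet> (A *v y) = A \<bullet> outer x y"
  for x y :: "real^2"
  by (simp add: inner_vec_def matrix_vector_mult_def outer_nth sum_2 algebra_simps)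

lemma norm_outer: "norm (outer x y) = norm x * norm y"
proof -
  have "(norm (outer x y))\<^sup>2 = (norm x * norm y)\<^sup>2"
    unfolding power_mult_distrib power2_norm_eq_inner
    by (simp add: inner_vec_def outer_nth sum_2 algebra_simps)
  then show ?thesis by simp
qed

lemma abs_quadratic_form_le: "\<bar>x \<bullet> (A *v x)\<bar> \<le> norm A * (norm x)\<^sup>2"
  for x :: "real^2"
  using Cauchy_Schwarz_ineq2[of A "outer x x"]
  by (simp add: inner_matrix_vector norm_outer power2_eq_square)

text \<open>\<open>norm A\<close> is the Frobenius norm: the square of \<open>norm (A *v x)\<close>
  is the inner product of \<open>A\<close> with a rank-one matrix, and Cauchy-Schwarz followed by
  cancelling one factor gives the bound.\<close>

lemma norm_matrix_vector_mult_le: "norm (A *v x) \<le> norm A * norm x" for A :: "real^2^2"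
proof -
  have "(norm (A *v x))\<^sup>2 = A \<bullet> outer (A *v x) x"
    by (simp add: power2_norm_eq_inner inner_matrix_vector)
  also have "\<dots> \<le> norm A * (norm (A *v x) * norm x)"
    using norm_cauchy_schwarz[of A "outer (A *v x) x"] by (simp add: norm_outer)
  finally show ?thesis
    by (cases "A *v x = 0") (simp_all add: power2_eq_square mult.assoc mult.left_commute)
qed

lemma symmetric_matrix_inner:
  fixes A :: "real^2^2"
  assumes "transpose A = A"
  shows "(A *v x) \<bullet> y = x \<bullet> (A *v y)"
proof -
  have "A $ 2 $ 1 = A $ 1 $ 2" using assms unfolding transpose_eq_iff by blast
  then show ?thesis by (simp add: inner_vec_def matrix_vector_mult_def sum_2 algebra_simps)
qed

section \<open>Positive definite two by two matrices\<close>

lemma pos_def_matrix_invertible: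
  assumes "pos_def_matrix A"
  shows "invertible A"
proof -
  have "x = 0" if "A *v x = 0" for x
    using assms that unfolding pos_def_matrix_def by (metis inner_zero_right less_irrefl)
  then have "\<exists>B. B ** A = mat 1" using matrix_left_invertible_ker by blast
  then show ?thesis using invertible_left_inverse by blast
qed

lemma invertible_matrix_inv:
  fixes A :: "real^'n^'n"
  assumes "invertible A"
  shows "A ** matrix_inv A = mat 1" "matrix_inv A ** A = mat 1"
  using someI_ex[OF assms[unfolded invertible_def]] by (simp_all add: matrix_inv_def)

lemma pos_def_matrix_inv_mult:
  assumes "pos_def_matrix A"
  shows "matrix_inv A *v (A *v x) = x" "A *v (matrix_inv A *v x) = x"
  using pos_def_matrix_invertible[OF assms]
  by (simp_all add: matrix_vector_mul_assoc invertible_matrix_inv)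

lemma pos_def_matrix_inv_commute:
  assumes "pos_def_matrix A"
  shows "x \<bullet> (matrix_inv A *v y) = (matrix_inv A *v x) \<bullet> y"
  using assms symmetric_matrix_inner[of A "matrix_inv A *v x" "matrix_inv A *v y"]
  by (simp add: pos_def_matrix_inv_mult pos_def_matrix_def)

lemma pos_def_matrix_inv_nonneg:
  assumes "pos_def_matrix A"
  shows "0 \<le> x \<bullet> (matrix_inv A *v x)"
proof -
  have "x \<bullet> (matrix_inv A *v x) = (matrix_inv A *v x) \<bullet> (A *v (matrix_inv A *v x))"
    using assms by (simp add: pos_def_matrix_inv_mult inner_commute)
  also have "\<dots> \<ge> 0"
    using assms unfolding pos_def_matrix_def by (cases "matrix_inv A *v x = 0") (auto intro: less_imp_le)
  finally show ?thesis .
qed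

lemma pos_def_matrix_entries:
  assumes "pos_def_matrix A"
  shows "A $ 1 $ 1 > 0" "A $ 2 $ 2 > 0" "A $ 1 $ 1 * A $ 2 $ 2 - A $ 1 $ 2 * A $ 2 $ 1 > 0"
    "A $ 2 $ 1 = A $ 1 $ 2"
proof -
  have form: "x \<noteq> 0 \<Longrightarrow> 0 < x \<bullet> (A *v x)" for x
    using assms by (simp add: pos_def_matrix_def)
  have ax: "axis i (1::real) \<noteq> (0 :: real^2)" for i by (simp add: axis_eq_0_iff)
  show 11: "A $ 1 $ 1 > 0"
    using form[OF ax[of 1]] by (simp add: inner_matrix_vector inner_matrix outer_nth axis_def sum_2)
  show "A $ 2 $ 2 > 0"
    using form[OF ax[of 2]] by (simp add: inner_matrix_vector inner_matrix outer_nth axis_def sum_2)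
  show sym: "A $ 2 $ 1 = A $ 1 $ 2"
    using assms unfolding pos_def_matrix_def transpose_eq_iff by blast
  \<comment> \<open>Up to sign, this vector is orthogonal to the first row; there the form equals
    the first diagonal entry times the determinant.\<close>
  let ?x = "vector [- A $ 1 $ 2, A $ 1 $ 1] :: real^2"
  have "?x \<noteq> 0" using 11 by (auto simp: vec_eq_iff forall_2)
  from form[OF this] have "0 < A $ 1 $ 1 * (A $ 1 $ 1 * A $ 2 $ 2 - A $ 1 $ 2 * A $ 2 $ 1)"
    by (simp add: inner_vec_def matrix_vector_mult_def sum_2 sym algebra_simps)
  then show "A $ 1 $ 1 * A $ 2 $ 2 - A $ 1 $ 2 * A $ 2 $ 1 > 0"
    using 11 by (simp add: zero_less_mult_iff)
qed

text \<open>The adjugate formula. Since \<open>matrix_inv\<close> is defined by choice, this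
  explicit quotient is what provides a measurable version of the inverse form.\<close>

lemma pos_def_matrix_inv_form:
  assumes "pos_def_matrix A"
  shows "x \<bullet> (matrix_inv A *v x) =
    (A $ 2 $ 2 * (x $ 1)\<^sup>2 - (A $ 1 $ 2 + A $ 2 $ 1) * x $ 1 * x $ 2 + A $ 1 $ 1 * (x $ 2)\<^sup>2) /
      (A $ 1 $ 1 * A $ 2 $ 2 - A $ 1 $ 2 * A $ 2 $ 1)"
proof -
  let ?d = "A $ 1 $ 1 * A $ 2 $ 2 - A $ 1 $ 2 * A $ 2 $ 1"
  let ?y = "vector [(A $ 2 $ 2 * x $ 1 - A $ 1 $ 2 * x $ 2) / ?d, (A $ 1 $ 1 * x $ 2 - A $ 2 $ 1 * x $ 1) / ?d] :: real^2"
  have d: "?d \<noteq> 0" using pos_def_matrix_entries(3)[OF assms] by simp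
  have "A *v ?y = x"
    unfolding vec_eq_iff forall_2
  proof
    have "(A *v ?y) $ 1 = (x $ 1 * ?d) / ?d"
      by (simp add: matrix_vector_mult_def sum_2 add_divide_distrib[symmetric] algebra_simps
          del: nonzero_mult_div_cancel_right)
    then show "(A *v ?y) $ 1 = x $ 1" using d by simp
    have "(A *v ?y) $ 2 = (x $ 2 * ?d) / ?d"
      by (simp add: matrix_vector_mult_def sum_2 add_divide_distrib[symmetric] algebra_simps
          del: nonzero_mult_div_cancel_right)
    then show "(A *v ?y) $ 2 = x $ 2" using d by simp
  qed
  then have "matrix_inv A *v x = ?y" using pos_def_matrix_inv_mult(1)[OF assms] by metis
  then show ?thesis
    by (simp add: inner_vec_def sum_2 add_divide_distrib[symmetric] power2_eq_square algebra_simps)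
qed

text \<open>Determinant over trace is at most the smaller eigenvalue.\<close>

definition eig_bound :: "real^2^2 \<Rightarrow> real" where
  "eig_bound A = (A $ 1 $ 1 * A $ 2 $ 2 - A $ 1 $ 2 * A $ 2 $ 1) / (A $ 1 $ 1 + A $ 2 $ 2)"

lemma eig_bound_pos: "pos_def_matrix A \<Longrightarrow> eig_bound A > 0"
  using pos_def_matrix_entries[of A] by (simp add: eig_bound_def)

text \<open>By Cayley-Hamilton, trace times the form minus determinant times the squared length
  equals the squared length of \<open>A *v x\<close>, hence is nonnegative.\<close>

lemma eig_bound_le:
  assumes "pos_def_matrix A"
  shows "eig_bound A * (norm x)\<^sup>2 \<le> x \<bullet> (A *v x)"
proof -
  note e = pos_def_matrix_entries[OF assms]
  have "(A $ 1 $ 1 + A $ 2 $ 2) * (x \<bullet> (A *v x)) -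
      (A $ 1 $ 1 * A $ 2 $ 2 - A $ 1 $ 2 * A $ 2 $ 1) * (norm x)\<^sup>2 =
      (A $ 1 $ 1 * x $ 1 + A $ 1 $ 2 * x $ 2)\<^sup>2 + (A $ 1 $ 2 * x $ 1 + A $ 2 $ 2 * x $ 2)\<^sup>2"
    unfolding power2_norm_eq_inner
    by (simp add: inner_vec_def matrix_vector_mult_def sum_2 e(4) power2_eq_square algebra_simps)
  then have "(A $ 1 $ 1 * A $ 2 $ 2 - A $ 1 $ 2 * A $ 2 $ 1) * (norm x)\<^sup>2 \<le>
      (A $ 1 $ 1 + A $ 2 $ 2) * (x \<bullet> (A *v x))"
    using sum_power2_ge_zero[of "A $ 1 $ 1 * x $ 1 + A $ 1 $ 2 * x $ 2" "A $ 1 $ 2 * x $ 1 + A $ 2 $ 2 * x $ 2"]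
    by linarith
  then show ?thesis using e(1,2) by (simp add: eig_bound_def field_simps)
qed

text \<open>Quantifies pointwise how far \<open>N\<close> may be varied without losing positive
  definiteness.\<close>

lemma pos_def_matrix_perturb:
  assumes "pos_def_matrix A" "transpose M = M" "norm M < eig_bound A"
  shows "pos_def_matrix (A - M)"
proof -
  have "0 < x \<bullet> ((A - M) *v x)" if "x \<noteq> 0" for x
  proof -
    have "x \<bullet> (M *v x) \<le> norm M * (norm x)\<^sup>2" using abs_quadratic_form_le[of x M] by linarith
    also have "\<dots> < eig_bound A * (norm x)\<^sup>2" using assms(3) that by simp
    also have "\<dots> \<le> x \<bullet> (A *v x)" by (rule eig_bound_le[OF assms(1)])
    finally show ?thesis by (simp add: matrix_vector_mult_diff_rdistrib inner_diff_right)
  qed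
  then show ?thesis using assms by (simp add: pos_def_matrix_def transpose_add_scale)
qed

lemma NK_diff: "NK K (N + T) = NK K N - T"
  by (simp add: NK_def)

lemma transpose_NK: "transpose (NK K N) = NK K N \<longleftrightarrow> transpose N = N"
  by (simp add: NK_def transpose_add_scale)

text \<open>In this form the quadratic expression in a gradient is seen to be integrable once the
  rank-one field is in \<open>L2\<close>.\<close>

lemma NK_form: "x \<bullet> (NK K N *v x) = K * (x \<bullet> x) - N \<bullet> outer x x"
  by (simp add: NK_def matrix_vector_mult_diff_rdistrib inner_diff_right inner_matrix_vector)
    (simp add: inner_vec_def outer_nth mat_def sum_2 algebra_simps)

section \<open>The bending energy and its conjugate\<close>

lemma l2_inner_vec:
  fixes f g :: "plane \<Rightarrow> 'a::euclidean_space^'n::finite"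
  assumes "f \<in> L2 \<Omega>" "g \<in> L2 \<Omega>"
  shows "l2_inner \<Omega> f g = (\<Sum>i\<in>UNIV. l2_inner \<Omega> (\<lambda>x. f x $ i) (\<lambda>x. g x $ i))"
  unfolding l2_inner_def inner_vec_def
  by (rule Bochner_Integration.integral_sum) (intro L2_inner_integrable L2_nth assms)

locale plate = plane_domain \<Omega> for \<Omega> +
  fixes H :: tensor4 and h K :: real and p :: "plane \<Rightarrow> real^2" and P :: "plane \<Rightarrow> real"
  assumes symmetric_H: "symmetric_tensor H" and pos_def_H: "pos_def_tensor H"
    and K_pos: "K > 0" and p_L2: "p \<in> L2 \<Omega>" and P_L2: "P \<in> L2 \<Omega>"
begin

abbreviation "V \<equiv> W20 \<Omega> 2"
abbreviation "grad \<equiv> wgrad \<Omega>"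
abbreviation "Hb \<equiv> tensor_app (bending_tensor h H)"

definition hess :: "(plane \<Rightarrow> real) \<Rightarrow> plane \<Rightarrow> real^2^2" where
  "hess w x = (\<chi> \<alpha> \<beta>. wderiv \<Omega> [\<alpha>, \<beta>] w x)"

lemma curvature_eq: "curvature \<Omega> u = (\<lambda>x. - hess (snd u) x)"
  by (auto simp: curvature_def hess_def fun_eq_iff vec_eq_iff split: prod.split)

lemma bending_app: "Hb T = (h\<^sup>2 / 12) *\<^sub>R tensor_app H T"
  by (simp add: tensor_app_def bending_tensor_def vec_eq_iff sum_distrib_left mult.assoc)

lemma bounded_linear_bending: "bounded_linear Hb"
  by (rule bounded_linear_tensor_app)

lemma bending_commute: "S \<bullet> Hb T = T \<bullet> Hb S"
  using tensor_H_inner_commute[OF symmetric_H pos_def_H, of S T] by (simp add: bending_app)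

lemma bending_nonneg: "0 \<le> T \<bullet> Hb T"
  using tensor_form_nonneg[OF minor_symmetric_H[OF symmetric_H pos_def_H] pos_def_H, of T] by (simp add: bending_app)

lemma V_imp_W2: "w \<in> V \<Longrightarrow> w \<in> W2 \<Omega> 2"
  by (rule W20_imp_W2)

lemma grad_L2: "w \<in> V \<Longrightarrow> grad w \<in> L2 \<Omega>"
  by (rule L2_vec) (auto simp: wgrad_def intro: wderiv_L2[OF V_imp_W2])

lemma hess_L2: "w \<in> V \<Longrightarrow> hess w \<in> L2 \<Omega>"
  by (intro L2_vec) (auto simp: hess_def intro: wderiv_L2[OF V_imp_W2])

lemma Hb_L2: "f \<in> L2 \<Omega> \<Longrightarrow> (\<lambda>x. Hb (f x)) \<in> L2 \<Omega>"
  by (rule L2_bounded_linear[OF _ bounded_linear_bending])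

lemma grad_lincomb:
  assumes "f \<in> V" "g \<in> V"
  shows "AE x in leb. grad (\<lambda>x. f x + c * g x) x = grad f x + c *\<^sub>R grad g x"
proof -
  have "AE x in leb. \<forall>\<alpha>\<in>UNIV. wderiv \<Omega> [\<alpha>] (\<lambda>x. f x + c * g x) x =
      wderiv \<Omega> [\<alpha>] f x + c * wderiv \<Omega> [\<alpha>] g x"
    using assms by (intro AE_finite_allI wderiv_lincomb[of _ 2] V_imp_W2) auto
  then show ?thesis by eventually_elim (simp add: wgrad_def vec_eq_iff)
qed

lemma hess_lincomb:
  assumes "f \<in> V" "g \<in> V"
  shows "AE x in leb. hess (\<lambda>x. f x + c * g x) x = hess f x + c *\<^sub>R hess g x"
proof -
  have "AE x in leb. \<forall>\<alpha>\<in>UNIV. \<forall>\<beta>\<in>UNIV. wderiv \<Omega> [\<alpha>, \<beta>] (\<lambda>x. f x + c * g x) x =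
      wderiv \<Omega> [\<alpha>, \<beta>] f x + c * wderiv \<Omega> [\<alpha>, \<beta>] g x"
    using assms by (intro AE_finite_allI wderiv_lincomb[of _ 2] V_imp_W2) auto
  then show ?thesis by eventually_elim (simp add: hess_def vec_eq_iff)
qed

text \<open>The symmetric bilinear form whose diagonal is \<open>2 F\<close>; it is nonnegative and
  controls the gradient with constant \<open>K\<close>.\<close>

definition energy :: "(plane \<Rightarrow> real) \<Rightarrow> (plane \<Rightarrow> real) \<Rightarrow> real" where
  "energy f g = inner2 (hess f) (\<lambda>x. Hb (hess g x)) + K * inner2 (grad f) (grad g)"

lemma F_eq: "F \<Omega> H h K u = 1/2 * energy (snd u) (snd u)"
  by (simp add: F_def G2_def energy_def curvature_eq l2_inner_def
      linear_neg[OF bounded_linear.linear[OF bounded_linear_bending]])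

lemma energy_ge: "K * inner2 (grad f) (grad f) \<le> energy f f"
  unfolding energy_def l2_inner_def[of _ "hess f"] using bending_nonneg by simp

lemma energy_nonneg: "0 \<le> energy f f"
  using energy_ge[of f] K_pos l2_inner_self_nonneg[of \<Omega> "grad f"]
  by (meson mult_nonneg_nonneg less_imp_le order_trans)

lemma energy_commute: "energy f g = energy g f"
  unfolding energy_def l2_inner_def by (simp add: bending_commute[of "hess f _"] inner_commute[of "grad f _"])

lemma energy_lincomb_left:
  assumes "f \<in> V" "g \<in> V" "k \<in> V"
  shows "energy (\<lambda>x. f x + c * g x) k = energy f k + c * energy g k"
proof -
  have "inner2 (hess (\<lambda>x. f x + c * g x)) (\<lambda>x. Hb (hess k x)) =
      inner2 (\<lambda>x. hess f x + c *\<^sub>R hess g x) (\<lambda>x. Hb (hess k x))"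
    using assms hess_lincomb[OF assms(1,2)]
    by (intro l2_inner_cong_AE hess_L2 Hb_L2 L2_add L2_scaleR W20_lincomb) auto
  moreover have "inner2 (grad (\<lambda>x. f x + c * g x)) (grad k) = inner2 (\<lambda>x. grad f x + c *\<^sub>R grad g x) (grad k)"
    using assms grad_lincomb[OF assms(1,2)]
    by (intro l2_inner_cong_AE grad_L2 L2_add L2_scaleR W20_lincomb) auto
  ultimately show ?thesis
    unfolding energy_def using assms
    by (simp add: l2_inner_add_left l2_inner_scaleR_left hess_L2 Hb_L2 grad_L2 L2_scaleR algebra_simps)
qed

lemma energy_lincomb:
  assumes "f \<in> V" "g \<in> V"
  shows "energy (\<lambda>x. f x + c * g x) (\<lambda>x. f x + c * g x) = energy f f + 2 * c * energy f g + c\<^sup>2 * energy g g"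
proof -
  let ?s = "\<lambda>x. f x + c * g x"
  have "energy ?s ?s = energy f ?s + c * energy g ?s"
    by (rule energy_lincomb_left[OF assms W20_lincomb[OF assms]])
  also have "energy f ?s = energy f f + c * energy f g"
    using energy_lincomb_left[OF assms assms(1)] energy_commute[of f ?s] energy_commute[of f g] by simp
  also have "energy g ?s = energy f g + c * energy g g"
    using energy_lincomb_left[OF assms assms(2)] energy_commute[of g ?s] by simp
  finally show ?thesis by (simp add: power2_eq_square algebra_simps)
qed

lemma inner_grad_lincomb:
  assumes "y \<in> L2 \<Omega>" "f \<in> V" "g \<in> V"
  shows "inner2 y (grad (\<lambda>x. f x + c * g x)) = inner2 y (grad f) + c * inner2 y (grad g)"
proof -
  have "inner2 y (grad (\<lambda>x. f x + c * g x)) = inner2 y (\<lambda>x. grad f x + c *\<^sub>R grad g x)"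
    using assms grad_lincomb[OF assms(2,3)]
    by (intro l2_inner_cong_AE grad_L2 L2_add L2_scaleR W20_lincomb) auto
  then show ?thesis
    using assms by (simp add: l2_inner_add_right l2_inner_scaleR_right grad_L2 L2_scaleR)
qed

text \<open>The energy is bounded by a multiple of the squared \<open>L2\<close> norms of the first
  and second derivatives, so Sobolev approximation by test functions is also approximation in
  energy.\<close>

lemma energy_approx:
  assumes w: "w \<in> V"
  obtains \<phi> where "\<And>n. \<phi> n \<in> tests"
    "(\<lambda>n. energy (\<lambda>x. w x - \<phi> n x) (\<lambda>x. w x - \<phi> n x)) \<longlonglongrightarrow> 0"
proof -
  obtain \<phi> where \<phi>: "\<And>n. \<phi> n \<in> tests"
    and lim: "\<And>is. length is \<le> 2 \<Longrightarrow>
      (\<lambda>n. inner2 (wderiv \<Omega> is (\<lambda>x. w x - \<phi> n x)) (wderiv \<Omega> is (\<lambda>x. w x - \<phi> n x))) \<longlonglongrightarrow> 0"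
    using w unfolding W20_def sobolev_norm_tendsto_0_iff by blast
  let ?d = "\<lambda>n x. w x - \<phi> n x"
  have d: "?d n \<in> V" for n by (rule W20_diff[OF w test_W20[OF \<phi>]])
  obtain C where C: "\<And>T. norm (Hb T) \<le> norm T * C" "C \<ge> 0"
    using bounded_linear.nonneg_bounded[OF bounded_linear_bending] by metis
  have le: "inner2 (hess (?d n)) (\<lambda>x. Hb (hess (?d n) x)) \<le> C * inner2 (hess (?d n)) (hess (?d n))" for n
  proof -
    have "T \<bullet> Hb T \<le> C * (T \<bullet> T)" for T
    proof -
      have "T \<bullet> Hb T \<le> norm T * norm (Hb T)" by (rule norm_cauchy_schwarz)
      also have "\<dots> \<le> norm T * (norm T * C)" by (intro mult_left_mono C) auto
      finally show ?thesis by (simp add: power2_norm_eq_inner[symmetric] power2_eq_square mult_ac)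
    qed
    then have "inner2 (hess (?d n)) (\<lambda>x. Hb (hess (?d n) x)) \<le>
        (LINT x|leb. C * (hess (?d n) x \<bullet> hess (?d n) x))"
      unfolding l2_inner_def
      by (intro integral_mono integrable_mult_right L2_inner_integrable Hb_L2 hess_L2 d)
    then show ?thesis by (simp add: l2_inner_def)
  qed
  have hess0: "(\<lambda>n. inner2 (hess (?d n)) (hess (?d n))) \<longlonglongrightarrow> (\<Sum>\<alpha>\<in>(UNIV::2 set). \<Sum>\<beta>\<in>(UNIV::2 set). 0)"
  proof -
    have "inner2 (hess (?d n)) (hess (?d n)) =
        (\<Sum>\<alpha>\<in>UNIV. \<Sum>\<beta>\<in>UNIV. inner2 (wderiv \<Omega> [\<alpha>, \<beta>] (?d n)) (wderiv \<Omega> [\<alpha>, \<beta>] (?d n)))" for n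
      by (subst l2_inner_vec, (rule hess_L2 d)+, subst l2_inner_vec)
        (auto simp: hess_def intro!: L2_vec wderiv_L2[OF V_imp_W2[OF d]])
    then show ?thesis by (simp only:) (intro tendsto_sum lim, simp)
  qed
  have grad0: "(\<lambda>n. inner2 (grad (?d n)) (grad (?d n))) \<longlonglongrightarrow> (\<Sum>\<alpha>\<in>(UNIV::2 set). 0)"
  proof -
    have "inner2 (grad (?d n)) (grad (?d n)) =
        (\<Sum>\<alpha>\<in>UNIV. inner2 (wderiv \<Omega> [\<alpha>] (?d n)) (wderiv \<Omega> [\<alpha>] (?d n)))" for n
      by (subst l2_inner_vec, (rule grad_L2 d)+) (simp add: wgrad_def)
    then show ?thesis by (simp only:) (intro tendsto_sum lim, simp)
  qed
  have "(\<lambda>n. C * inner2 (hess (?d n)) (hess (?d n)) + K * inner2 (grad (?d n)) (grad (?d n))) \<longlonglongrightarrow>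
      C * (\<Sum>\<alpha>\<in>(UNIV::2 set). \<Sum>\<beta>\<in>(UNIV::2 set). 0) + K * (\<Sum>\<alpha>\<in>(UNIV::2 set). 0)"
    by (intro tendsto_intros hess0 grad0)
  then have lim0: "(\<lambda>n. C * inner2 (hess (?d n)) (hess (?d n)) + K * inner2 (grad (?d n)) (grad (?d n))) \<longlonglongrightarrow> 0"
    by simp
  have "(\<lambda>n. energy (?d n) (?d n)) \<longlonglongrightarrow> 0"
  proof (rule tendsto_sandwich[OF always_eventually always_eventually tendsto_const lim0])
    show "\<forall>n. 0 \<le> energy (?d n) (?d n)" using energy_nonneg by blast
    show "\<forall>n. energy (?d n) (?d n) \<le> C * inner2 (hess (?d n)) (hess (?d n)) + K * inner2 (grad (?d n)) (grad (?d n))"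
      using le by (simp add: energy_def)
  qed
  with \<phi> that show ?thesis by blast
qed

text \<open>For a test function \<open>\<psi>\<close> the functional \<open>energy \<psi>\<close> is represented by an \<open>L\<^sup>2\<close> field paired with
  the gradient: integrate the bending term by parts once.\<close>

lemma energy_test_representation:
  assumes \<psi>: "\<psi> \<in> tests"
  obtains y where "y \<in> L2 \<Omega>" "\<And>w. w \<in> V \<Longrightarrow> inner2 y (grad w) = energy \<psi> w"
proof -
  \<comment> \<open>The classical Hessian; the indices are swapped because \<open>wderiv\<close>
    along a list corresponds to the classical derivative along the reversed list.\<close>
  define D where "D x = (\<chi> \<alpha> \<beta>. partial_derivs [\<beta>, \<alpha>] \<psi> x)" for x :: plane
  define M where "M \<alpha> \<beta> x = Hb (D x) $ \<alpha> $ \<beta>" for \<alpha> \<beta> x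
  have M_test: "M \<alpha> \<beta> \<in> tests" for \<alpha> \<beta>
  proof -
    have "(\<lambda>x. \<Sum>\<rho>\<in>UNIV. \<Sum>\<mu>\<in>UNIV. bending_tensor h H \<alpha> \<beta> \<rho> \<mu> * partial_derivs [\<mu>, \<rho>] \<psi> x) \<in> tests"
      by (intro test_function_sum test_function_scale test_function_partial_derivs \<psi>)
    then show ?thesis by (simp add: M_def[abs_def] tensor_app_nth D_def)
  qed
  have \<psi>V: "\<psi> \<in> V" by (rule test_W20[OF \<psi>])
  have grad_\<psi>: "AE x in leb. grad \<psi> x = (\<chi> \<alpha>. partial_deriv \<alpha> \<psi> x)"
  proof -
    have "AE x in leb. \<forall>\<alpha>\<in>UNIV. wderiv \<Omega> [\<alpha>] \<psi> x = partial_derivs (rev [\<alpha>]) \<psi> x"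
      by (intro AE_finite_allI wderiv_test \<psi>) auto
    then show ?thesis by eventually_elim (simp add: wgrad_def vec_eq_iff partial_derivs_Cons)
  qed
  have hess_\<psi>: "AE x in leb. hess \<psi> x = D x"
  proof -
    have "AE x in leb. \<forall>\<alpha>\<in>UNIV. \<forall>\<beta>\<in>UNIV. wderiv \<Omega> [\<alpha>, \<beta>] \<psi> x = partial_derivs (rev [\<alpha>, \<beta>]) \<psi> x"
      by (intro AE_finite_allI wderiv_test \<psi>) auto
    then show ?thesis by eventually_elim (simp add: hess_def D_def vec_eq_iff)
  qed
  \<comment> \<open>\<open>K\<close> times the gradient of \<psi> minus the row divergence of the
    moment field \<open>M\<close>.\<close>
  define y where "y x = (\<chi> \<alpha>. K * partial_deriv \<alpha> \<psi> x + (-1) * (\<Sum>\<beta>\<in>UNIV. partial_deriv \<beta> (M \<alpha> \<beta>) x))" for x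
  have y_test: "(\<lambda>x. y x $ \<alpha>) \<in> tests" for \<alpha>
    unfolding y_def vec_lambda_beta
    by (intro test_function_lincomb test_function_scale test_function_sum test_function_partial_deriv \<psi> M_test)
  have y_L2: "y \<in> L2 \<Omega>" by (intro L2_vec test_L2 y_test)
  have "inner2 y (grad w) = energy \<psi> w" if w: "w \<in> V" for w
  proof -
    have wd: "wderiv \<Omega> [\<alpha>] w \<in> L2 \<Omega>" "wderiv \<Omega> [\<alpha>, \<beta>] w \<in> L2 \<Omega>" for \<alpha> \<beta>
      by (auto intro: wderiv_L2[OF V_imp_W2[OF w]])
    \<comment> \<open>Both sides are unfolded to the integral of \<open>w\<close> against the second
      derivative of \<open>M \<alpha> \<beta>\<close>, which avoids differentiating a weak
      derivative.\<close>
    have parts: "inner2 (M \<alpha> \<beta>) (wderiv \<Omega> [\<alpha>, \<beta>] w) = - inner2 (partial_deriv \<beta> (M \<alpha> \<beta>)) (wderiv \<Omega> [\<alpha>] w)" for \<alpha> \<beta>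
    proof -
      have "(LINT x|leb. w x * partial_derivs [\<alpha>, \<beta>] (M \<alpha> \<beta>) x) =
          (LINT x|leb. wderiv \<Omega> [\<alpha>, \<beta>] w x * M \<alpha> \<beta> x)"
        using wderiv_has_weak_deriv[OF V_imp_W2[OF w], of "[\<alpha>, \<beta>]"] M_test by (simp add: has_weak_deriv_def)
      moreover have "(LINT x|leb. w x * partial_derivs [\<alpha>] (partial_deriv \<beta> (M \<alpha> \<beta>)) x) =
          - (LINT x|leb. wderiv \<Omega> [\<alpha>] w x * partial_deriv \<beta> (M \<alpha> \<beta>) x)"
        using wderiv_has_weak_deriv[OF V_imp_W2[OF w], of "[\<alpha>]"] test_function_partial_deriv[OF M_test]
        by (simp add: has_weak_deriv_def)
      ultimately show ?thesis
        by (simp add: l2_inner_def partial_derivs_Cons mult.commute)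
    qed
    have bend: "inner2 (hess \<psi>) (\<lambda>x. Hb (hess w x)) =
        - (\<Sum>\<alpha>\<in>UNIV. \<Sum>\<beta>\<in>UNIV. inner2 (partial_deriv \<beta> (M \<alpha> \<beta>)) (wderiv \<Omega> [\<alpha>] w))"
    proof -
      have HbD: "(\<lambda>x. Hb (D x)) \<in> L2 \<Omega>"
        by (intro L2_vec) (use test_L2[OF M_test] in \<open>simp add: M_def[abs_def]\<close>)
      have "inner2 (hess \<psi>) (\<lambda>x. Hb (hess w x)) = inner2 (\<lambda>x. Hb (hess \<psi> x)) (hess w)"
        unfolding l2_inner_def by (simp add: bending_commute[of "hess \<psi> _"] inner_commute)
      also have "\<dots> = inner2 (\<lambda>x. Hb (D x)) (hess w)"
        by (rule l2_inner_cong_AE) (use hess_\<psi> HbD hess_L2 Hb_L2 w \<psi>V in auto)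
      also have "\<dots> = (\<Sum>\<alpha>\<in>UNIV. \<Sum>\<beta>\<in>UNIV. inner2 (M \<alpha> \<beta>) (wderiv \<Omega> [\<alpha>, \<beta>] w))"
        by (simp add: l2_inner_vec[OF HbD hess_L2[OF w]] l2_inner_vec[OF L2_nth[OF HbD] L2_nth[OF hess_L2[OF w]]])
          (simp add: M_def[abs_def] hess_def)
      finally show ?thesis by (simp add: parts sum_negf)
    qed
    have "inner2 y (grad w) = (\<Sum>\<alpha>\<in>UNIV. inner2 (\<lambda>x. y x $ \<alpha>) (wderiv \<Omega> [\<alpha>] w))"
      by (simp add: l2_inner_vec[OF y_L2 grad_L2[OF w]] wgrad_def)
    also have "\<dots> = (\<Sum>\<alpha>\<in>UNIV. K * inner2 (partial_deriv \<alpha> \<psi>) (wderiv \<Omega> [\<alpha>] w) -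
        (\<Sum>\<beta>\<in>UNIV. inner2 (partial_deriv \<beta> (M \<alpha> \<beta>)) (wderiv \<Omega> [\<alpha>] w)))"
    proof (rule sum.cong[OF refl])
      fix \<alpha>
      have L: "partial_deriv \<alpha> \<psi> \<in> L2 \<Omega>" "partial_deriv \<beta> (M \<alpha> \<beta>) \<in> L2 \<Omega>" for \<beta>
        by (auto intro: test_L2 test_function_partial_deriv \<psi> M_test)
      have "inner2 (\<lambda>x. y x $ \<alpha>) (wderiv \<Omega> [\<alpha>] w) =
          inner2 (\<lambda>x. K *\<^sub>R partial_deriv \<alpha> \<psi> x + (-1) *\<^sub>R (partial_deriv 1 (M \<alpha> 1) x + partial_deriv 2 (M \<alpha> 2) x)) (wderiv \<Omega> [\<alpha>] w)"
        by (simp add: y_def sum_2)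
      also have "\<dots> = K * inner2 (partial_deriv \<alpha> \<psi>) (wderiv \<Omega> [\<alpha>] w) -
        (inner2 (partial_deriv 1 (M \<alpha> 1)) (wderiv \<Omega> [\<alpha>] w) + inner2 (partial_deriv 2 (M \<alpha> 2)) (wderiv \<Omega> [\<alpha>] w))"
        by (subst l2_inner_add_left, (intro L2_scaleR L2_add L wd)+)
          (simp only: l2_inner_scaleR_left l2_inner_add_left[OF L(2) L(2) wd(1)], simp)
      finally show "inner2 (\<lambda>x. y x $ \<alpha>) (wderiv \<Omega> [\<alpha>] w) = K * inner2 (partial_deriv \<alpha> \<psi>) (wderiv \<Omega> [\<alpha>] w) -
        (\<Sum>\<beta>\<in>UNIV. inner2 (partial_deriv \<beta> (M \<alpha> \<beta>)) (wderiv \<Omega> [\<alpha>] w))"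
        by (simp add: sum_2)
    qed
    also have "\<dots> = K * (\<Sum>\<alpha>\<in>UNIV. inner2 (partial_deriv \<alpha> \<psi>) (wderiv \<Omega> [\<alpha>] w)) +
        inner2 (hess \<psi>) (\<lambda>x. Hb (hess w x))"
      by (simp add: bend sum_subtractf sum_distrib_left)
    also have "(\<Sum>\<alpha>\<in>UNIV. inner2 (partial_deriv \<alpha> \<psi>) (wderiv \<Omega> [\<alpha>] w)) = inner2 (grad \<psi>) (grad w)"
    proof -
      have g: "(\<lambda>x. \<chi> \<alpha>. partial_deriv \<alpha> \<psi> x) \<in> L2 \<Omega>"
        by (intro L2_vec) (auto intro: test_L2 test_function_partial_deriv \<psi>)
      have "inner2 (grad \<psi>) (grad w) = inner2 (\<lambda>x. \<chi> \<alpha>. partial_deriv \<alpha> \<psi> x) (grad w)"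
        by (rule l2_inner_cong_AE) (use grad_\<psi> g grad_L2 w \<psi>V in auto)
      then show ?thesis by (simp add: l2_inner_vec[OF g grad_L2[OF w]] wgrad_def)
    qed
    finally show ?thesis by (simp add: energy_def)
  qed
  with y_L2 that show ?thesis by blast
qed

section \<open>The conjugate as a finite convex function of \<open>z + Q\<close>\<close>

definition conj_energy :: "(plane \<Rightarrow> real^2) \<Rightarrow> real" where
  "conj_energy y = (SUP w\<in>V. inner2 y (grad w) - 1/2 * energy w w)"

lemma V_nonempty: "V \<noteq> {}"
  using test_W20[OF zero_test_function] by blast

text \<open>Completing the square against the part of the energy that controls the gradient; this is
  where \<open>K > 0\<close> makes the conjugate finite on all of \<open>L2\<close>.\<close>

lemma conj_energy_bdd:
  assumes y: "y \<in> L2 \<Omega>" and w: "w \<in> V"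
  shows "inner2 y (grad w) - 1/2 * energy w w \<le> inner2 y y / (2 * K)"
proof -
  let ?g = "grad w"
  have "0 \<le> inner2 (\<lambda>x. y x - K *\<^sub>R ?g x) (\<lambda>x. y x - K *\<^sub>R ?g x)"
    by (rule l2_inner_self_nonneg)
  also have "\<dots> = inner2 y y - 2 * K * inner2 y ?g + K * K * inner2 ?g ?g"
    using y grad_L2[OF w]
    by (simp add: l2_inner_diff_left l2_inner_diff_right L2_diff L2_scaleR l2_inner_scaleR_left
        l2_inner_scaleR_right l2_inner_commute[of \<Omega> ?g y] algebra_simps)
  finally have "2 * K * inner2 y ?g - K * (K * inner2 ?g ?g) \<le> inner2 y y" by (simp add: mult.assoc)
  moreover have "K * (K * inner2 ?g ?g) \<le> K * energy w w"
    using energy_ge[of w] K_pos by (intro mult_left_mono) auto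
  ultimately have "2 * K * inner2 y ?g - K * energy w w \<le> inner2 y y"
    using K_pos energy_nonneg[of w]
    by linarith
  then show ?thesis using K_pos by (simp add: field_simps)
qed

lemma conj_energy_upper:
  assumes "y \<in> L2 \<Omega>" "w \<in> V"
  shows "inner2 y (grad w) - 1/2 * energy w w \<le> conj_energy y"
  unfolding conj_energy_def
  by (rule cSUP_upper) (use assms conj_energy_bdd in \<open>auto intro!: bdd_aboveI\<close>)

lemma conj_energy_least:
  assumes "\<And>w. w \<in> V \<Longrightarrow> inner2 y (grad w) - 1/2 * energy w w \<le> c"
  shows "conj_energy y \<le> c"
  unfolding conj_energy_def by (rule cSUP_least) (use assms V_nonempty in auto)

text \<open>\<open>F\<close> ignores the in-plane displacement, so pairing each \<open>w\<close>
  with a zero in-plane part identifies the two suprema; boundedness removes the extended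
  values.\<close>

lemma F_star_eq:
  assumes "z \<in> L2 \<Omega>" "Q \<in> L2 \<Omega>"
  shows "F_star \<Omega> H h K z Q = ereal (conj_energy (\<lambda>x. z x + Q x))"
proof -
  let ?y = "\<lambda>x. z x + Q x"
  have y: "?y \<in> L2 \<Omega>" using assms by (rule L2_add)
  have in_U: "((\<lambda>x. 0), w) \<in> U \<Omega>" if "w \<in> V" for w
    using that test_W20[OF zero_test_function, of 1] by (simp add: U_def)
  show ?thesis unfolding F_star_def F_eq
  proof (rule antisym)
    show "(SUP u\<in>U \<Omega>. ereal (inner2 ?y (grad (snd u)) - 1/2 * energy (snd u) (snd u))) \<le> ereal (conj_energy ?y)"
      by (rule SUP_least) (use conj_energy_upper[OF y] in \<open>auto simp: U_def\<close>)
    let ?S = "SUP u\<in>U \<Omega>. ereal (inner2 ?y (grad (snd u)) - 1/2 * energy (snd u) (snd u))"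
    have ge: "ereal (inner2 ?y (grad w) - 1/2 * energy w w) \<le> ?S" if "w \<in> V" for w
      by (rule SUP_upper2[OF in_U[OF that]]) simp
    show "ereal (conj_energy ?y) \<le> ?S"
    proof (cases ?S)
      case (real s)
      then show ?thesis using conj_energy_least[of ?y s] ge by (simp only: ereal_less_eq)
    next
      case MInf
      then show ?thesis using ge V_nonempty by auto
    qed auto
  qed
qed

text \<open>A supremum of affine functions of \<open>y\<close> is convex.\<close>

lemma conj_energy_convex:
  assumes "y \<in> L2 \<Omega>" "q \<in> L2 \<Omega>" "0 \<le> t" "t \<le> 1"
  shows "conj_energy (\<lambda>x. y x + t *\<^sub>R q x) \<le> (1 - t) * conj_energy y + t * conj_energy (\<lambda>x. y x + q x)"
proof (rule conj_energy_least)
  fix w assume w: "w \<in> V"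
  let ?e = "1/2 * energy w w"
  have "inner2 (\<lambda>x. y x + t *\<^sub>R q x) (grad w) - ?e =
      (1 - t) * (inner2 y (grad w) - ?e) + t * (inner2 (\<lambda>x. y x + q x) (grad w) - ?e)"
    using assms grad_L2[OF w]
    by (simp add: l2_inner_add_left l2_inner_scaleR_left L2_scaleR) (simp add: field_simps)
  also have "\<dots> \<le> (1 - t) * conj_energy y + t * conj_energy (\<lambda>x. y x + q x)"
    using assms w by (intro add_mono mult_left_mono conj_energy_upper L2_add) auto
  finally show "inner2 (\<lambda>x. y x + t *\<^sub>R q x) (grad w) - ?e \<le>
    (1 - t) * conj_energy y + t * conj_energy (\<lambda>x. y x + q x)" .
qed

text \<open>Along a ray the difference quotient at \<open>t\<close> in (0,1) is at most the one at
  1, by convexity, and the derivative is its limit from the right.\<close>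

lemma conj_energy_subgradient:
  assumes y: "y \<in> L2 \<Omega>" and q: "q \<in> L2 \<Omega>"
    and deriv: "((\<lambda>t. conj_energy (\<lambda>x. y x + t *\<^sub>R q x)) has_real_derivative d) (at 0)"
  shows "conj_energy y + d \<le> conj_energy (\<lambda>x. y x + q x)"
proof -
  let ?f = "\<lambda>t. conj_energy (\<lambda>x. y x + t *\<^sub>R q x)"
  have "((\<lambda>t. (?f (0 + t) - ?f 0) / t) \<longlongrightarrow> d) (at 0)"
    using deriv by (simp add: DERIV_def)
  then have "((\<lambda>t. (?f t - ?f 0) / t) \<longlongrightarrow> d) (at_right 0)"
    by (simp add: filterlim_at_split)
  then have "d \<le> ?f 1 - ?f 0"
  proof (rule tendsto_upperbound)
    show "\<forall>\<^sub>F t in at_right 0. (?f t - ?f 0) / t \<le> ?f 1 - ?f 0"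
    proof (rule eventually_mono[OF eventually_at_right_real[of 0 1]])
      fix t :: real assume t: "t \<in> {0<..<1}"
      then have "?f t \<le> (1 - t) * ?f 0 + t * ?f 1"
        using conj_energy_convex[OF y q, of t] by simp
      then show "(?f t - ?f 0) / t \<le> ?f 1 - ?f 0" using t by (simp add: field_simps)
    qed simp
  qed simp
  then show ?thesis by simp
qed

text \<open>A subgradient of the conjugate at \<open>y\<close> of the form \<open>grad w\<close> attains the supremum. Biconjugation is
  replaced by testing the subgradient inequality with the fields representing test functions
  that approximate \<open>w\<close>.\<close>

lemma conj_energy_attained:
  assumes y: "y \<in> L2 \<Omega>" and w: "w \<in> V"
    and sub: "\<And>q. q \<in> L2 \<Omega> \<Longrightarrow> conj_energy y + inner2 q (grad w) \<le> conj_energy (\<lambda>x. y x + q x)"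
  shows "conj_energy y = inner2 y (grad w) - 1/2 * energy w w"
proof (rule antisym)
  obtain \<phi> where \<phi>: "\<And>n. \<phi> n \<in> tests"
    "(\<lambda>n. energy (\<lambda>x. w x - \<phi> n x) (\<lambda>x. w x - \<phi> n x)) \<longlonglongrightarrow> 0"
    using energy_approx[OF w] by blast
  have le: "conj_energy y \<le> inner2 y (grad w) - 1/2 * energy w w +
      1/2 * energy (\<lambda>x. w x - \<phi> n x) (\<lambda>x. w x - \<phi> n x)" for n
  proof -
    have \<phi>V: "\<phi> n \<in> V" by (rule test_W20[OF \<phi>(1)])
    obtain r where r: "r \<in> L2 \<Omega>" "\<And>w. w \<in> V \<Longrightarrow> inner2 r (grad w) = energy (\<phi> n) w"
      using energy_test_representation[OF \<phi>(1)] by metis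
    \<comment> \<open>The field \<open>r\<close> represents \<open>energy (\<phi> n)\<close>, so the
      supremum is bounded by completing the square around \<phi> n.\<close>
    have "conj_energy r \<le> 1/2 * energy (\<phi> n) (\<phi> n)"
    proof (rule conj_energy_least)
      fix v assume v: "v \<in> V"
      have "0 \<le> energy (\<lambda>x. \<phi> n x + (-1) * v x) (\<lambda>x. \<phi> n x + (-1) * v x)"
        by (rule energy_nonneg)
      then show "inner2 r (grad v) - 1/2 * energy v v \<le> 1/2 * energy (\<phi> n) (\<phi> n)"
        using energy_lincomb[OF \<phi>V v, of "-1"] by (simp add: r(2)[OF v])
    qed
    \<comment> \<open>The direction \<open>r - y\<close> moves the base point to \<open>r\<close>,
      whose conjugate was just bounded. What remains is half the energy of
      \<open>w - \<phi> n\<close>.\<close>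
    moreover have "conj_energy y + inner2 (\<lambda>x. r x - y x) (grad w) \<le> conj_energy r"
      using sub[OF L2_diff[OF r(1) y]] by simp
    moreover have "inner2 (\<lambda>x. r x - y x) (grad w) = energy (\<phi> n) w - inner2 y (grad w)"
      using r w y grad_L2 by (simp add: l2_inner_diff_left)
    moreover have "energy (\<lambda>x. w x - \<phi> n x) (\<lambda>x. w x - \<phi> n x) =
        energy w w - 2 * energy (\<phi> n) w + energy (\<phi> n) (\<phi> n)"
      using energy_lincomb[OF w \<phi>V, of "-1"] by (simp add: energy_commute)
    ultimately show ?thesis by argo
  qed
  have "(\<lambda>n. inner2 y (grad w) - 1/2 * energy w w + 1/2 * energy (\<lambda>x. w x - \<phi> n x) (\<lambda>x. w x - \<phi> n x))
      \<longlonglongrightarrow> inner2 y (grad w) - 1/2 * energy w w + 1/2 * 0"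
    by (intro tendsto_intros \<phi>(2))
  from LIMSEQ_le_const[OF this] le show "conj_energy y \<le> inner2 y (grad w) - 1/2 * energy w w" by auto
qed (rule conj_energy_upper[OF y w])

lemma conj_energy_add_le:
  assumes y: "y \<in> L2 \<Omega>" and w: "w \<in> V" and \<zeta>: "\<zeta> \<in> L2 \<Omega>"
    and attained: "conj_energy y = inner2 y (grad w) - 1/2 * energy w w"
  shows "conj_energy (\<lambda>x. y x + \<zeta> x) \<le> conj_energy y + inner2 \<zeta> (grad w) + conj_energy \<zeta>"
proof (rule conj_energy_least)
  \<comment> \<open>Perturbing the maximizer \<open>w\<close> by multiples of \<open>v\<close> gives
    a quadratic inequality in \<open>t\<close> whose linear coefficient must vanish.\<close>
  have euler_lagrange: "inner2 y (grad v) = energy w v" if v: "v \<in> V" for v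
  proof -
    define a where "a = inner2 y (grad v) - energy w v"
    define b where "b = energy v v"
    have quad: "t * a \<le> t\<^sup>2 * b / 2" for t
    proof -
      have "inner2 y (grad (\<lambda>x. w x + t * v x)) - 1/2 * energy (\<lambda>x. w x + t * v x) (\<lambda>x. w x + t * v x)
          \<le> inner2 y (grad w) - 1/2 * energy w w"
        using conj_energy_upper[OF y W20_lincomb[OF w v]] attained by simp
      then show ?thesis
        unfolding inner_grad_lincomb[OF y w v] energy_lincomb[OF w v] a_def b_def
        by (simp add: algebra_simps)
    qed
    have b: "b \<ge> 0" unfolding b_def by (rule energy_nonneg)
    \<comment> \<open>A value of \<open>t\<close> that makes the inequality contradictory unless
      \<open>a = 0\<close>; the added 1 covers \<open>b = 0\<close>.\<close>
    define q where "q = a / (b + 1)"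
    have aq: "a = q * (b + 1)" using b by (simp add: q_def)
    have "q * (q * (b + 1)) \<le> q\<^sup>2 * b / 2" using quad[of q] by (simp only: aq)
    then have "q\<^sup>2 * (b / 2 + 1) \<le> 0" by (simp add: power2_eq_square algebra_simps)
    then have "q = 0" using b by (simp add: mult_le_0_iff)
    then have "a = 0" by (simp add: aq)
    then show ?thesis by (simp add: a_def)
  qed
  fix w' assume w': "w' \<in> V"
  \<comment> \<open>Recentred at the maximizer, the pairing of \<open>y\<close> with the gradient of
    \<open>v\<close> cancels the mixed energy term, and the expression maximized in the conjugate of
    \<zeta> remains.\<close>
  define v where "v x = w' x - w x" for x
  have v: "v \<in> V" unfolding v_def using w' w by (rule W20_diff)
  have w'_eq: "w' = (\<lambda>x. w x + 1 * v x)" by (simp add: v_def)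
  have "inner2 (\<lambda>x. y x + \<zeta> x) (grad w') - 1/2 * energy w' w' =
      (inner2 y (grad w) - 1/2 * energy w w) + inner2 \<zeta> (grad w) + (inner2 \<zeta> (grad v) - 1/2 * energy v v)"
    unfolding w'_eq inner_grad_lincomb[OF L2_add[OF y \<zeta>] w v] energy_lincomb[OF w v]
    using y \<zeta> grad_L2[OF w] grad_L2[OF v] euler_lagrange[OF v]
    by (simp add: l2_inner_add_left) (simp add: field_simps)
  also have "\<dots> \<le> conj_energy y + inner2 \<zeta> (grad w) + conj_energy \<zeta>"
    using conj_energy_upper[OF \<zeta> v] attained by simp
  finally show "inner2 (\<lambda>x. y x + \<zeta> x) (grad w') - 1/2 * energy w' w' \<le>
    conj_energy y + inner2 \<zeta> (grad w) + conj_energy \<zeta>" .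
qed

end

section \<open>Weak duality\<close>

lemma borel_measurable_matrix_vector_mult:
  fixes f :: "'a \<Rightarrow> real^'n^'m" and g :: "'a \<Rightarrow> real^'n"
  assumes "f \<in> borel_measurable M" "g \<in> borel_measurable M"
  shows "(\<lambda>x. f x *v g x) \<in> borel_measurable M"
proof (rule borel_measurable_continuous_Pair[OF assms])
  show "continuous_on UNIV (\<lambda>x. fst x *v snd x :: real^'m)"
    unfolding matrix_vector_mult_def by (intro continuous_on_vec_lambda continuous_intros)
qed

context plate
begin

abbreviation "Hinv \<equiv> tensor_app (tensor_inv H)"
abbreviation "NKf N x \<equiv> NK K (N x)"

lemmas minor_H = minor_symmetric_H[OF symmetric_H pos_def_H]
lemmas minor_Hinv = minor_symmetric_tensor_inv[OF minor_H pos_def_H]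

lemma Hinv_L2: "N \<in> L2 \<Omega> \<Longrightarrow> (\<lambda>x. Hinv (N x)) \<in> L2 \<Omega>"
  by (rule L2_bounded_linear[OF _ bounded_linear_tensor_app])

text \<open>A first derivative of \<open>w\<close> is a limit of first derivatives of test
  functions, whose own derivatives are second derivatives converging, hence bounded, in
  \<open>L2\<close>.\<close>

lemma grad_square_L2:
  assumes w: "w \<in> V"
  shows "(\<lambda>x. (grad w x $ \<alpha>)\<^sup>2) \<in> L2 \<Omega>"
proof -
  obtain \<phi> where \<phi>: "\<And>n. \<phi> n \<in> tests" "\<And>is. length is \<le> 2 \<Longrightarrow>
      (\<lambda>n. sqdist (wderiv \<Omega> is w) (partial_derivs (rev is) (\<phi> n))) \<longlonglongrightarrow> 0"
    using W20_approx[OF w] by blast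
  have "\<exists>C. \<forall>n. inner2 (partial_derivs (rev [\<alpha>, i]) (\<phi> n)) (partial_derivs (rev [\<alpha>, i]) (\<phi> n)) \<le> C" for i
  proof -
    have "wderiv \<Omega> [\<alpha>, i] w \<in> L2 \<Omega>" by (rule wderiv_L2[OF V_imp_W2[OF w]]) simp
    from l2_inner_bounded_of_tendsto[OF this test_L2[OF test_function_partial_derivs[OF \<phi>(1)]] \<phi>(2)[of "[\<alpha>, i]"]]
    show ?thesis by auto
  qed
  then obtain C where C: "\<And>i n. inner2 (partial_derivs (rev [\<alpha>, i]) (\<phi> n)) (partial_derivs (rev [\<alpha>, i]) (\<phi> n)) \<le> C i"
    by metis
  have "(\<lambda>x. (wderiv \<Omega> [\<alpha>] w x)\<^sup>2) \<in> L2 \<Omega>"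
  proof (rule square_in_L2_of_test_limit[where \<phi>="\<lambda>n. partial_deriv \<alpha> (\<phi> n)" and C="max (C 1) (C 2)"])
    show "wderiv \<Omega> [\<alpha>] w \<in> L2 \<Omega>" by (rule wderiv_L2[OF V_imp_W2[OF w]]) simp
    show "partial_deriv \<alpha> (\<phi> n) \<in> tests" for n
      by (rule test_function_partial_deriv[OF \<phi>(1)])
    show "(\<lambda>n. sqdist (wderiv \<Omega> [\<alpha>] w) (partial_deriv \<alpha> (\<phi> n))) \<longlonglongrightarrow> 0"
      using \<phi>(2)[of "[\<alpha>]"] by (simp add: partial_derivs_Cons)
    show "inner2 (partial_deriv i (partial_deriv \<alpha> (\<phi> n))) (partial_deriv i (partial_deriv \<alpha> (\<phi> n))) \<le> max (C 1) (C 2)"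
      for n i
      using C[of i n] exhaust_2[of i] by (auto simp: partial_derivs_Cons le_max_iff_disj)
  qed
  then show ?thesis by (simp add: wgrad_def)
qed

text \<open>Puts the membrane coupling, \<open>N\<close> paired with the rank-one field of the
  gradient, within reach of Cauchy-Schwarz for \<open>N\<close> in \<open>L2\<close>.\<close>

lemma outer_grad_L2:
  assumes w: "w \<in> V"
  shows "(\<lambda>x. outer (grad w x) (grad w x)) \<in> L2 \<Omega>"
proof (intro L2_vec)
  fix \<alpha> \<beta>
  let ?a = "\<lambda>x. (grad w x $ \<alpha>)\<^sup>2" and ?b = "\<lambda>x. (grad w x $ \<beta>)\<^sup>2"
  have "(\<lambda>x. grad w x $ \<alpha> * grad w x $ \<beta>) \<in> L2 \<Omega>"
  proof (rule L2_I)
    show "(\<lambda>x. grad w x $ \<alpha> * grad w x $ \<beta>) \<in> borel_measurable leb"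
      using L2_nth[OF grad_L2[OF w]] by (intro borel_measurable_times L2_measurable)
    show "integrable leb (\<lambda>x. ?a x * ?a x + ?b x * ?b x)"
      by (intro Bochner_Integration.integrable_add L2_mult_integrable grad_square_L2 w)
    have "(norm (a * b))\<^sup>2 \<le> a\<^sup>2 * a\<^sup>2 + b\<^sup>2 * b\<^sup>2" for a b :: real
      using sum_squares_bound[of "a\<^sup>2" "b\<^sup>2"] zero_le_power2[of "a * b"]
      by (simp add: power_mult_distrib power2_eq_square mult_ac)
    then show "AE x in leb. (norm (grad w x $ \<alpha> * grad w x $ \<beta>))\<^sup>2 \<le> ?a x * ?a x + ?b x * ?b x"
      by (intro always_eventually allI)
  qed
  then show "(\<lambda>x. outer (grad w x) (grad w x) $ \<alpha> $ \<beta>) \<in> L2 \<Omega>" by (simp add: outer_nth)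
qed

section \<open>Strain, equilibrium and the decomposition of the energy\<close>

lemma UD:
  assumes "(v, w) \<in> U \<Omega>"
  shows "w \<in> V" "(\<lambda>x. v x $ \<alpha>) \<in> W20 \<Omega> 1"
  using assms by (auto simp: U_def)

lemma wjac_L2: "(v, w) \<in> U \<Omega> \<Longrightarrow> wjac \<Omega> v \<in> L2 \<Omega>"
  by (intro L2_vec) (auto simp: wjac_def intro: wderiv_L2[OF W20_imp_W2[OF UD(2)]])

lemma displacement_L2: "(v, w) \<in> U \<Omega> \<Longrightarrow> v \<in> L2 \<Omega>"
  by (intro L2_vec W2_imp_L2[OF W20_imp_W2[OF UD(2)]])

lemma strain_eq: "strain \<Omega> (v, w) x = sym_part (wjac \<Omega> v x) + (1/2) *\<^sub>R outer (grad w x) (grad w x)"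
  by (simp add: strain_def vec_eq_iff sym_part_nth outer_nth)

lemma transpose_strain: "transpose (strain \<Omega> (v, w) x) = strain \<Omega> (v, w) x"
  by (simp add: strain_eq transpose_add_scale transpose_sym_part transpose_outer_self)

lemma sym_part_L2: "f \<in> L2 \<Omega> \<Longrightarrow> (\<lambda>x. sym_part (f x)) \<in> L2 \<Omega>"
  by (rule L2_bounded_linear) (auto simp: linear_sym_part linear_conv_bounded_linear[symmetric])

lemma strain_L2:
  assumes "(v, w) \<in> U \<Omega>"
  shows "strain \<Omega> (v, w) \<in> L2 \<Omega>"
proof -
  have "(\<lambda>x. sym_part (wjac \<Omega> v x) + (1/2) *\<^sub>R outer (grad w x) (grad w x)) \<in> L2 \<Omega>"
    using assms by (intro L2_add sym_part_L2 wjac_L2 L2_scaleR outer_grad_L2 UD(1))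
  then show ?thesis by (simp add: strain_eq[abs_def])
qed

lemma strain_inner:
  assumes u: "(v, w) \<in> U \<Omega>" and N: "N \<in> L2 \<Omega>" and sym: "AE x in leb. transpose (N x) = N x"
  shows "inner2 (strain \<Omega> (v, w)) N = inner2 (wjac \<Omega> v) N + 1/2 * inner2 (\<lambda>x. outer (grad w x) (grad w x)) N"
proof -
  have "inner2 (strain \<Omega> (v, w)) N =
      inner2 (\<lambda>x. sym_part (wjac \<Omega> v x)) N + inner2 (\<lambda>x. (1/2) *\<^sub>R outer (grad w x) (grad w x)) N"
    unfolding strain_eq[abs_def]
    using u N by (intro l2_inner_add_left sym_part_L2 wjac_L2 L2_scaleR outer_grad_L2 UD(1))
  also have "inner2 (\<lambda>x. sym_part (wjac \<Omega> v x)) N = inner2 (wjac \<Omega> v) N"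
    unfolding l2_inner_def
  proof (rule integral_cong_AE)
    show "AE x in leb. sym_part (wjac \<Omega> v x) \<bullet> N x = wjac \<Omega> v x \<bullet> N x"
      using sym by eventually_elim (rule sym_part_inner)
    show "(\<lambda>x. sym_part (wjac \<Omega> v x) \<bullet> N x) \<in> borel_measurable leb"
      using L2_inner_integrable[OF sym_part_L2[OF wjac_L2[OF u]] N] by (rule borel_measurable_integrable)
    show "(\<lambda>x. wjac \<Omega> v x \<bullet> N x) \<in> borel_measurable leb"
      using L2_inner_integrable[OF wjac_L2[OF u] N] by (rule borel_measurable_integrable)
  qed
  finally show ?thesis by (simp only: l2_inner_scaleR_left)
qed

lemma A1_pairing:
  assumes A: "(Q, N) \<in> A1 \<Omega> p" and u: "(v, w) \<in> U \<Omega>"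
  shows "inner2 (wjac \<Omega> v) N = inner2 v p"
proof -
  have N: "N \<in> L2 \<Omega>" using A by (auto simp: A1_def Y_star_def)
  have "inner2 (wjac \<Omega> v) N =
      (\<Sum>\<alpha>\<in>UNIV. \<Sum>\<beta>\<in>UNIV. inner2 (wderiv \<Omega> [\<beta>] (\<lambda>x. v x $ \<alpha>)) (\<lambda>x. N x $ \<alpha> $ \<beta>))"
    by (simp add: l2_inner_vec[OF wjac_L2[OF u] N] l2_inner_vec[OF L2_nth[OF wjac_L2[OF u]] L2_nth[OF N]])
      (simp add: wjac_def)
  also have "\<dots> = (\<Sum>\<alpha>\<in>UNIV. inner2 (\<lambda>x. v x $ \<alpha>) (\<lambda>x. p x $ \<alpha>))"
  proof (rule sum.cong[OF refl])
    fix \<alpha>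
    show "(\<Sum>\<beta>\<in>UNIV. inner2 (wderiv \<Omega> [\<beta>] (\<lambda>x. v x $ \<alpha>)) (\<lambda>x. N x $ \<alpha> $ \<beta>)) =
        inner2 (\<lambda>x. v x $ \<alpha>) (\<lambda>x. p x $ \<alpha>)"
      by (rule pairing_extends_to_W20[OF L2_nth[OF N] L2_nth[OF p_L2] _ UD(2)[OF u]])
        (use A in \<open>auto simp: A1_def\<close>)
  qed
  also have "\<dots> = inner2 v p" by (simp add: l2_inner_vec[OF displacement_L2[OF u] p_L2])
  finally show ?thesis .
qed

lemma A2_pairing:
  assumes A: "(Q, N) \<in> A2 \<Omega> P" and w: "w \<in> V"
  shows "inner2 (grad w) Q = inner2 w P"
proof -
  have Q: "Q \<in> L2 \<Omega>" using A by (auto simp: A2_def Y_star_def)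
  have "inner2 (grad w) Q = (\<Sum>\<beta>\<in>UNIV. inner2 (wderiv \<Omega> [\<beta>] w) (\<lambda>x. Q x $ \<beta>))"
    by (simp add: l2_inner_vec[OF grad_L2[OF w] Q] wgrad_def)
  also have "\<dots> = inner2 w P"
    by (rule pairing_extends_to_W20[OF Q P_L2 _ w]) (use A in \<open>auto simp: A2_def\<close>)
  finally show ?thesis .
qed

lemma A3D:
  assumes "(Q, N) \<in> A3 \<Omega> K"
  shows "Q \<in> L2 \<Omega>" "N \<in> L2 \<Omega>" "AE x in leb. pos_def_matrix (NKf N x)"
    "AE x in leb. transpose (N x) = N x"
proof -
  show "Q \<in> L2 \<Omega>" "N \<in> L2 \<Omega>" and pos: "AE x in leb. pos_def_matrix (NKf N x)"
    using assms by (auto simp: A3_def Y_star_def)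
  show "AE x in leb. transpose (N x) = N x"
    using pos by eventually_elim (simp add: pos_def_matrix_def transpose_NK)
qed

definition NK_energy :: "(plane \<Rightarrow> real^2^2) \<Rightarrow> (plane \<Rightarrow> real) \<Rightarrow> real" where
  "NK_energy N w = (LINT x|leb. grad w x \<bullet> (NKf N x *v grad w x))"

lemma NK_form_integrable:
  assumes "N \<in> L2 \<Omega>" "w \<in> V"
  shows "integrable leb (\<lambda>x. grad w x \<bullet> (NKf N x *v grad w x))"
  unfolding NK_form
  using assms by (intro Bochner_Integration.integrable_diff integrable_mult_right L2_inner_integrable
      grad_L2 outer_grad_L2)

lemma NK_energy_eq:
  assumes "N \<in> L2 \<Omega>" "w \<in> V"
  shows "NK_energy N w = K * inner2 (grad w) (grad w) - inner2 (\<lambda>x. outer (grad w x) (grad w x)) N"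
  unfolding NK_energy_def NK_form l2_inner_def
  using L2_inner_integrable[OF grad_L2[OF assms(2)] grad_L2[OF assms(2)]]
    L2_inner_integrable[OF assms(1) outer_grad_L2[OF assms(2)]]
  by (simp add: inner_commute)

text \<open>The Fenchel-Young defect of the membrane energy: \<open>G1\<close>, plus its conjugate
  at \<open>N\<close>, minus the pairing.\<close>

definition strain_gap :: "(plane \<Rightarrow> real^2^2) \<Rightarrow> displacement \<Rightarrow> real" where
  "strain_gap N u = G1 \<Omega> H (strain \<Omega> u) - inner2 (strain \<Omega> u) N + 1/2 * inner2 N (\<lambda>x. Hinv (N x))"

text \<open>Equilibrium replaces the load terms by pairings with \<open>N\<close> and
  \<open>Q\<close>. Adding and subtracting \<open>K/2\<close> times the squared gradient norm
  completes the bending energy to half of \<open>energy w w\<close> and the membrane coupling to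
  half of \<open>NK_energy\<close>.\<close>

lemma J_decomposition:
  assumes A: "(Q, N) \<in> A1 \<Omega> p \<inter> A2 \<Omega> P \<inter> A3 \<Omega> K" and u: "(v, w) \<in> U \<Omega>"
  shows "J \<Omega> H h p P (v, w) = strain_gap N (v, w) + 1/2 * energy w w - inner2 Q (grad w)
    - 1/2 * NK_energy N w - 1/2 * inner2 N (\<lambda>x. Hinv (N x))"
proof -
  have A': "(Q, N) \<in> A1 \<Omega> p" "(Q, N) \<in> A2 \<Omega> P" "(Q, N) \<in> A3 \<Omega> K" using A by auto
  note N = A3D[OF A'(3)]
  have G2: "G2 \<Omega> H h (curvature \<Omega> (v, w)) = 1/2 * energy w w - K/2 * inner2 (grad w) (grad w)"
    using F_eq[of "(v, w)"] by (simp add: F_def)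
  show ?thesis
    unfolding J_def strain_gap_def G2 NK_energy_eq[OF N(2) UD(1)[OF u]]
      strain_inner[OF u N(2) N(4)] A1_pairing[OF A'(1) u]
    using A2_pairing[OF A'(2) UD(1)[OF u]] l2_inner_commute[of \<Omega> Q "grad w"] l2_inner_commute[of \<Omega> v p]
    by (simp add: algebra_simps)
qed

lemma
  assumes u: "(v, w) \<in> U \<Omega>" and N: "N \<in> L2 \<Omega>" and sym: "AE x in leb. transpose (N x) = N x"
  shows strain_gap_nonneg: "0 \<le> strain_gap N (v, w)"
    and strain_gap_eq_0: "(AE x in leb. strain \<Omega> (v, w) x = Hinv (N x)) \<Longrightarrow> strain_gap N (v, w) = 0"
proof -
  let ?s = "strain \<Omega> (v, w)"
  let ?g = "\<lambda>x. 1/2 * (?s x \<bullet> tensor_app H (?s x)) - ?s x \<bullet> N x + 1/2 * (N x \<bullet> Hinv (N x))"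
  have s: "?s \<in> L2 \<Omega>" by (rule strain_L2[OF u])
  have Hs: "(\<lambda>x. tensor_app H (?s x)) \<in> L2 \<Omega>" by (rule L2_bounded_linear[OF s bounded_linear_tensor_app])
  note int = L2_inner_integrable[OF s Hs] L2_inner_integrable[OF s N] L2_inner_integrable[OF N Hinv_L2[OF N]]
  have eq: "strain_gap N (v, w) = (LINT x|leb. ?g x)"
    unfolding strain_gap_def G1_def l2_inner_def using int by simp
  show "0 \<le> strain_gap N (v, w)"
    unfolding eq
  proof (rule integral_nonneg_AE)
    show "AE x in leb. 0 \<le> ?g x"
      using sym
    proof eventually_elim
      case (elim x)
      then show ?case using tensor_fenchel_young[OF symmetric_H pos_def_H, of "N x" "?s x"] by simp
    qed
  qed
  assume "AE x in leb. ?s x = Hinv (N x)"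
  with sym have "AE x in leb. ?g x = 0"
  proof eventually_elim
    case (elim x)
    then show ?case using tensor_fenchel_young_eq[OF symmetric_H pos_def_H, of "N x" "?s x"] by simp
  qed
  then show "strain_gap N (v, w) = 0"
    unfolding eq by (rule integral_eq_zero_AE)
qed

text \<open>Evaluates the extended-valued form through any integrable function agreeing with the
  integrand almost everywhere; measurability is carried by that function.\<close>

lemma inv_NK_form_eq:
  assumes "AE x in leb. pos_def_matrix (NKf N x)" "integrable leb f"
    "AE x in leb. z x \<bullet> (matrix_inv (NKf N x) *v z x) = f x"
  shows "inv_NK_form \<Omega> K N z = ereal (LINT x|leb. f x)"
proof -
  have nonneg: "AE x in leb. 0 \<le> f x"
    using assms(1,3) by eventually_elim (metis pos_def_matrix_inv_nonneg)
  have "(\<integral>\<^sup>+x. ennreal (z x \<bullet> (matrix_inv (NKf N x) *v z x)) \<partial>leb) =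
      (\<integral>\<^sup>+x. ennreal (f x) \<partial>leb)"
    using assms(3) by (intro nn_integral_cong_AE) (auto elim: eventually_mono)
  also have "\<dots> = ennreal (LINT x|leb. f x)"
    by (rule nn_integral_eq_integral[OF assms(2) nonneg])
  finally show ?thesis
    using integral_nonneg_AE[OF nonneg] by (simp add: inv_NK_form_def enn2ereal_ennreal)
qed

text \<open>The converse direction: the adjugate formula gives a measurable version of the
  integrand, and finiteness of the form makes it integrable.\<close>

lemma inv_NK_form_finite:
  assumes pos: "AE x in leb. pos_def_matrix (NKf N x)" and N: "N \<in> L2 \<Omega>" and z: "z \<in> L2 \<Omega>"
    and fin: "inv_NK_form \<Omega> K N z \<noteq> \<infinity>"
  obtains f where "integrable leb f"
    "AE x in leb. z x \<bullet> (matrix_inv (NKf N x) *v z x) = f x"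
proof -
  have [measurable]: "(\<lambda>x. N x $ i $ j) \<in> borel_measurable leb"
    "(\<lambda>x. z x $ i) \<in> borel_measurable leb" for i j
    using L2_measurable[OF L2_nth[OF L2_nth[OF N]]] L2_measurable[OF L2_nth[OF z]] by auto
  define f where "f x = (let A = NKf N x in
    (A $ 2 $ 2 * (z x $ 1)\<^sup>2 - (A $ 1 $ 2 + A $ 2 $ 1) * z x $ 1 * z x $ 2 + A $ 1 $ 1 * (z x $ 2)\<^sup>2) /
      (A $ 1 $ 1 * A $ 2 $ 2 - A $ 1 $ 2 * A $ 2 $ 1))" for x
  have eq: "AE x in leb. z x \<bullet> (matrix_inv (NKf N x) *v z x) = f x"
    using pos by eventually_elim (simp add: f_def Let_def pos_def_matrix_inv_form)
  have nonneg: "AE x in leb. 0 \<le> f x"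
    using pos eq by eventually_elim (metis pos_def_matrix_inv_nonneg)
  have [measurable]: "f \<in> borel_measurable leb"
    unfolding f_def Let_def NK_def by (simp add: mat_def)
  have "(\<integral>\<^sup>+x. ennreal (norm (f x)) \<partial>leb) =
      (\<integral>\<^sup>+x. ennreal (z x \<bullet> (matrix_inv (NKf N x) *v z x)) \<partial>leb)"
    by (rule nn_integral_cong_AE, use nonneg eq in eventually_elim) simp
  also have "\<dots> < \<infinity>"
    using fin by (auto simp: inv_NK_form_def less_top[symmetric])
  finally have "integrable leb f" by (intro integrableI_bounded) auto
  with eq that show ?thesis by blast
qed

lemma G_star_eq:
  assumes "inv_NK_form \<Omega> K N z = ereal s"
  shows "G_star \<Omega> H K z N = ereal (1/2 * s - 1/2 * inner2 N (\<lambda>x. Hinv (N x)))"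
  by (simp add: G_star_def assms)

lemma J_star_eq:
  assumes "Q \<in> L2 \<Omega>" "z \<in> L2 \<Omega>" "inv_NK_form \<Omega> K N z = ereal s"
  shows "J_star \<Omega> H h K (Q, N) z =
    ereal (- conj_energy (\<lambda>x. z x + Q x) + 1/2 * s - 1/2 * inner2 N (\<lambda>x. Hinv (N x)))"
  using assms by (simp add: J_star_def F_star_eq G_star_eq)

lemma NK_borel_measurable: "N \<in> L2 \<Omega> \<Longrightarrow> (\<lambda>x. NKf N x) \<in> borel_measurable leb"
  unfolding NK_def using L2_measurable by (intro borel_measurable_diff) auto

lemma weak_duality:
  assumes A: "(Q, N) \<in> A1 \<Omega> p \<inter> A2 \<Omega> P \<inter> A3 \<Omega> K" and u: "(v, w) \<in> U \<Omega>"
  shows "J_tilde \<Omega> H h K (Q, N) \<le> ereal (J \<Omega> H h p P (v, w))"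
proof -
  have w: "w \<in> V" by (rule UD(1)[OF u])
  have "(Q, N) \<in> A3 \<Omega> K" using A by auto
  note N = A3D[OF this]
  define g where "g = grad w"
  define q where "q x = g x \<bullet> (NKf N x *v g x)" for x
  define e where "e n x = (indicator {x. norm (NKf N x) \<le> real n} x :: real)" for n x
  have g: "g \<in> L2 \<Omega>" unfolding g_def by (rule grad_L2[OF w])
  have q: "integrable leb q"
    unfolding q_def g_def by (rule NK_form_integrable[OF N(2) w])
  have NKm: "(\<lambda>x. NKf N x) \<in> borel_measurable leb"
    by (rule NK_borel_measurable[OF N(2)])
  have em: "e n \<in> borel_measurable leb" for n
  proof -
    have "{x \<in> space leb. norm (NKf N x) \<le> real n} \<in> sets leb"
      using NKm by measurable
    then have "indicat_real {x \<in> space leb. norm (NKf N x) \<le> real n} \<in> borel_measurable leb"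
      by simp
    then show ?thesis
      by (rule measurable_cong[THEN iffD1, rotated]) (simp add: e_def indicator_def)
  qed
  define z where "z n x = e n x *\<^sub>R (NKf N x *v g x)" for n x
  have mv: "(\<lambda>x. NKf N x *v g x) \<in> borel_measurable leb"
    by (rule borel_measurable_matrix_vector_mult[OF NKm L2_measurable[OF g]])
  have z: "z n \<in> L2 \<Omega>" for n
  proof (rule L2_I)
    show "z n \<in> borel_measurable leb"
      unfolding z_def[abs_def] by (intro borel_measurable_scaleR em mv)
    show "integrable leb (\<lambda>x. (real n)\<^sup>2 * (norm (g x))\<^sup>2)"
      using L2_integrable[OF g] by (rule integrable_mult_right)
    have "norm (z n x) \<le> real n * norm (g x)" for x
      using norm_matrix_vector_mult_le[of "NKf N x" "g x"] mult_right_mono[of "norm (NKf N x)" "real n" "norm (g x)"]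
      by (auto simp: z_def e_def indicator_def)
    then show "AE x in leb. (norm (z n x))\<^sup>2 \<le> (real n)\<^sup>2 * (norm (g x))\<^sup>2"
      by (intro always_eventually allI) (simp add: power_mono flip: power_mult_distrib)
  qed
  define s where "s n = (LINT x|leb. e n x * q x)" for n
  have eq: "integrable leb (\<lambda>x. e n x * q x)" for n
  proof (rule Bochner_Integration.integrable_bound[OF q])
    show "(\<lambda>x. e n x * q x) \<in> borel_measurable leb"
      by (intro borel_measurable_times em borel_measurable_integrable[OF q])
  qed (auto simp: e_def indicator_def)
  have form: "inv_NK_form \<Omega> K N (z n) = ereal (s n)" for n
    unfolding s_def
  proof (rule inv_NK_form_eq[OF N(3) eq])
    \<comment> \<open>The inverse matrix undoes \<open>A\<close>, and the cut-off equals its own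
      square; so the form at \<open>z n\<close> and the pairing of \<open>z n\<close> with
      \<open>g\<close> have the same value \<open>s n\<close>.\<close>
    show "AE x in leb. z n x \<bullet> (matrix_inv (NKf N x) *v z n x) = e n x * q x"
      using N(3)
      by eventually_elim
        (auto simp: z_def e_def q_def indicator_def pos_def_matrix_inv_mult inner_commute)
  qed
  define a where "a = 1/2 * energy w w - inner2 Q g - 1/2 * inner2 N (\<lambda>x. Hinv (N x))"
  \<comment> \<open>The form contributes \<open>s n / 2\<close>, the pairing inside the conjugate
    \<open>- s n\<close>.\<close>
  have le: "J_tilde \<Omega> H h K (Q, N) \<le> ereal (a - 1/2 * s n)" for n
  proof -
    have "inner2 (z n) g = s n"
      unfolding l2_inner_def s_def by (simp add: z_def q_def inner_commute)
    then have "inner2 (\<lambda>x. z n x + Q x) g = s n + inner2 Q g"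
      using z N(1) g by (simp add: l2_inner_add_left)
    then have "s n + inner2 Q g - 1/2 * energy w w \<le> conj_energy (\<lambda>x. z n x + Q x)"
      using conj_energy_upper[OF L2_add[OF z[of n] N(1)] w] by (simp add: g_def)
    then have "J_star \<Omega> H h K (Q, N) (z n) \<le> ereal (a - 1/2 * s n)"
      unfolding J_star_eq[OF N(1) z form] a_def by simp
    then show ?thesis
      unfolding J_tilde_def using INF_lower2[OF z] by blast
  qed
  \<comment> \<open>At each point the cut-off is eventually 1, and \<bar>q\<bar> is an integrable
    majorant.\<close>
  have "s \<longlonglongrightarrow> (LINT x|leb. q x)"
    unfolding s_def
  proof (rule integral_dominated_convergence[where w="\<lambda>x. \<bar>q x\<bar>"])
    show "AE x in leb. (\<lambda>n. e n x * q x) \<longlonglongrightarrow> q x"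
    proof (intro always_eventually allI)
      fix x
      obtain m where m: "norm (NKf N x) \<le> real m" using real_arch_simple by blast
      have "\<forall>\<^sub>F n in sequentially. e n x * q x = q x"
        by (rule eventually_sequentiallyI[of m]) (use m in \<open>auto simp: e_def indicator_def\<close>)
      then show "(\<lambda>n. e n x * q x) \<longlonglongrightarrow> q x" by (rule tendsto_eventually)
    qed
    show "AE x in leb. norm (e n x * q x) \<le> \<bar>q x\<bar>" for n
      by (auto simp: e_def indicator_def)
  qed (use q eq in auto)
  then have "(\<lambda>n. ereal (a - 1/2 * s n)) \<longlonglongrightarrow> ereal (a - 1/2 * (LINT x|leb. q x))"
    by (intro tendsto_intros)
  then have "J_tilde \<Omega> H h K (Q, N) \<le> ereal (a - 1/2 * (LINT x|leb. q x))"
    by (rule LIMSEQ_le_const) (use le in blast)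
  also have "\<dots> \<le> ereal (J \<Omega> H h p P (v, w))"
    using J_decomposition[OF A u] strain_gap_nonneg[OF u N(2) N(4)]
    by (simp add: a_def NK_energy_def q_def g_def)
  finally show ?thesis .
qed

end

section \<open>Stationary points\<close>

text \<open>The damping by which an unbounded residual becomes a bounded direction with the same
  pointwise orientation.\<close>

lemma norm_scaled_le_1: "norm ((1 / (1 + norm a)) *\<^sub>R a) < 1"
  by (simp add: add_pos_nonneg field_simps)

context plate
begin

lemma transpose_Hinv: "transpose (Hinv N) = Hinv N"
  by (rule transpose_tensor_app[OF minor_Hinv])

lemma Hinv_inner_commute:
  assumes "N \<in> L2 \<Omega>" "M \<in> L2 \<Omega>"
    "AE x in leb. transpose (N x) = N x" "AE x in leb. transpose (M x) = M x"
  shows "inner2 N (\<lambda>x. Hinv (M x)) = inner2 M (\<lambda>x. Hinv (N x))"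
  unfolding l2_inner_def
proof (rule integral_cong_AE)
  show "AE x in leb. N x \<bullet> Hinv (M x) = M x \<bullet> Hinv (N x)"
    using assms(3,4) by eventually_elim (rule tensor_inv_inner_commute[OF symmetric_H pos_def_H])
qed (use assms Hinv_L2 L2_inner_integrable borel_measurable_integrable in blast)+

lemma zero_in_U: "((\<lambda>x. 0), (\<lambda>x. 0)) \<in> U \<Omega>"
  using test_W20[OF zero_test_function] by (simp add: U_def)

context
  fixes Q0 N0 z0 v0 w0
  assumes A0: "(Q0, N0) \<in> A_star \<Omega> H h K p P" and z0: "z0 \<in> L2 \<Omega>" and u0: "(v0, w0) \<in> U \<Omega>"
    and stationary: "first_variation_vanishes \<Omega> H h K p P (Q0, N0) z0 (v0, w0)"
begin

lemma A123: "(Q0, N0) \<in> A1 \<Omega> p \<inter> A2 \<Omega> P \<inter> A3 \<Omega> K"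
  using A0 by (auto simp: A_star_def)

lemma A3_0: "(Q0, N0) \<in> A3 \<Omega> K"
  using A123 by auto

lemmas Q0 = A3D(1)[OF A3_0] and N0 = A3D(2)[OF A3_0]
  and pos_N0 = A3D(3)[OF A3_0] and sym_N0 = A3D(4)[OF A3_0]

lemmas w0 = UD(1)[OF u0]

lemmas grad_w0 = grad_L2[OF w0]

text \<open>Stationarity includes finiteness of the Lagrangian, and the conjugate is always
  finite.\<close>

lemma form_z0_finite: "inv_NK_form \<Omega> K N0 z0 \<noteq> \<infinity>"
proof
  assume "inv_NK_form \<Omega> K N0 z0 = \<infinity>"
  then have "lagrangian \<Omega> H h K p P (Q0, N0) z0 (v0, w0) = \<infinity>"
    by (simp add: lagrangian_def J_star_def G_star_def F_star_eq[OF z0 Q0])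
  then show False using stationary by (simp add: first_variation_vanishes_def)
qed

text \<open>Stationarity for fixed displacement, stated for the real-valued expression. The two
  assumptions on \<open>t\<close> certify that the direction is admissible, and the load terms form
  a constant that disappears on differentiation.\<close>

lemma variation:
  assumes q: "q \<in> L2 \<Omega>" and M: "M \<in> L2 \<Omega>" and \<zeta>: "\<zeta> \<in> L2 \<Omega>"
    and pos: "\<And>t. \<bar>t\<bar> < 1 \<Longrightarrow> AE x in leb. pos_def_matrix (NK K (N0 x + t *\<^sub>R M x))"
    and form: "\<And>t. \<bar>t\<bar> < 1 \<Longrightarrow> inv_NK_form \<Omega> K (\<lambda>x. N0 x + t *\<^sub>R M x) (\<lambda>x. z0 x + t *\<^sub>R \<zeta> x) = ereal (s t)"
  shows "((\<lambda>t. - conj_energy (\<lambda>x. z0 x + t *\<^sub>R \<zeta> x + (Q0 x + t *\<^sub>R q x)) + 1/2 * s t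
      - 1/2 * inner2 (\<lambda>x. N0 x + t *\<^sub>R M x) (\<lambda>x. Hinv (N0 x + t *\<^sub>R M x))
      + inner2 (wjac \<Omega> v0) (\<lambda>x. N0 x + t *\<^sub>R M x) + inner2 (grad w0) (\<lambda>x. Q0 x + t *\<^sub>R q x))
    has_real_derivative 0) (at 0)" (is "(?L has_real_derivative 0) (at 0)")
proof -
  define v' where "v' t = (shift Q0 t q, shift N0 t M)" for t
  define \<Phi> where "\<Phi> t = lagrangian \<Omega> H h K p P (v' t) (shift z0 t \<zeta>) (shift v0 t (\<lambda>x. 0), shift w0 t (\<lambda>x. 0))" for t
  define c where "c = inner2 v0 p + inner2 w0 P"
  have \<Phi>: "\<Phi> t = ereal (?L t - c)" if "\<bar>t\<bar> < 1" for t
  proof -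
    have "J_star \<Omega> H h K (shift Q0 t q, shift N0 t M) (shift z0 t \<zeta>) =
      ereal (- conj_energy (\<lambda>x. shift z0 t \<zeta> x + shift Q0 t q x) + 1/2 * s t
        - 1/2 * inner2 (shift N0 t M) (\<lambda>x. Hinv (shift N0 t M x)))"
      using form[OF that] by (intro J_star_eq) (auto simp: shift_def intro!: L2_add L2_scaleR Q0 q z0 \<zeta>)
    then show ?thesis
      unfolding \<Phi>_def lagrangian_def v'_def by (simp add: shift_def c_def)
  qed
  have adm: "\<forall>\<^sub>F t in at 0. v' t \<in> A3 \<Omega> K \<and> \<bar>\<Phi> t\<bar> \<noteq> \<infinity>"
    unfolding eventually_at
  proof (intro exI[of _ 1] conjI ballI impI)
    fix t :: real assume "t \<noteq> 0 \<and> dist t 0 < 1"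
    then have t: "\<bar>t\<bar> < 1" by simp
    have "shift Q0 t q \<in> L2 \<Omega>" "shift N0 t M \<in> L2 \<Omega>"
      unfolding shift_def by (intro L2_add L2_scaleR Q0 q N0 M)+
    then show "v' t \<in> A3 \<Omega> K" using pos[OF t] by (simp add: v'_def A3_def Y_star_def shift_def)
    show "\<bar>\<Phi> t\<bar> \<noteq> \<infinity>" by (simp add: \<Phi>[OF t])
  qed simp
  have "(q, M) \<in> Y_star \<Omega>" using q M by (simp add: Y_star_def)
  then have "(\<forall>\<^sub>F t in at 0. v' t \<in> A3 \<Omega> K \<and> \<bar>\<Phi> t\<bar> \<noteq> \<infinity>) \<longrightarrow>
      ((\<lambda>t. real_of_ereal (\<Phi> t)) has_real_derivative 0) (at 0)"
    using stationary \<zeta> zero_in_U unfolding first_variation_vanishes_def Let_def \<Phi>_def v'_def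
    by fastforce
  with adm have "((\<lambda>t. real_of_ereal (\<Phi> t)) has_real_derivative 0) (at 0)" by blast
  then have "((\<lambda>t. ?L t - c) has_real_derivative 0) (at 0)"
  proof (rule has_field_derivative_transform_within_open)
    show "open (ball 0 1 :: real set)" by simp
    show "real_of_ereal (\<Phi> t) = ?L t - c" if "t \<in> ball 0 1" for t
      using that \<Phi>[of t] by (simp add: dist_real_def)
  qed simp
  then have "((\<lambda>t. (?L t - c) + c) has_real_derivative 0 + 0) (at 0)"
    by (intro DERIV_add DERIV_const)
  then show ?thesis by simp
qed

lemma conj_energy_z0_Q0:
  "conj_energy (\<lambda>x. z0 x + Q0 x) = inner2 (\<lambda>x. z0 x + Q0 x) (grad w0) - 1/2 * energy w0 w0"
proof (rule conj_energy_attained[OF L2_add[OF z0 Q0] w0])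
  fix q :: "plane \<Rightarrow> real^2" assume q: "q \<in> L2 \<Omega>"
  let ?y = "\<lambda>x. z0 x + Q0 x"
  obtain s where s: "inv_NK_form \<Omega> K N0 z0 = ereal s"
    using form_z0_finite by (cases "inv_NK_form \<Omega> K N0 z0") (auto simp: inv_NK_form_def)
  define c where "c = 1/2 * s - 1/2 * inner2 N0 (\<lambda>x. Hinv (N0 x)) + inner2 (wjac \<Omega> v0) N0 + inner2 (grad w0) Q0"
  have "((\<lambda>t. - conj_energy (\<lambda>x. ?y x + t *\<^sub>R q x) + t * inner2 q (grad w0) + c) has_real_derivative 0) (at 0)"
  proof -
    have eq: "(\<lambda>t. - conj_energy (\<lambda>x. z0 x + t *\<^sub>R 0 + (Q0 x + t *\<^sub>R q x)) + 1/2 * s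
      - 1/2 * inner2 (\<lambda>x. N0 x + t *\<^sub>R 0) (\<lambda>x. Hinv (N0 x + t *\<^sub>R 0))
      + inner2 (wjac \<Omega> v0) (\<lambda>x. N0 x + t *\<^sub>R 0) + inner2 (grad w0) (\<lambda>x. Q0 x + t *\<^sub>R q x)) =
      (\<lambda>t. - conj_energy (\<lambda>x. ?y x + t *\<^sub>R q x) + t * inner2 q (grad w0) + c)"
      using Q0 q grad_w0
      by (simp add: l2_inner_add_right L2_scaleR l2_inner_scaleR_right c_def add.assoc
          l2_inner_commute[of \<Omega> q]) (simp add: fun_eq_iff)
    show ?thesis
      unfolding eq[symmetric]
      by (rule variation[OF q L2_zero L2_zero]) (use pos_N0 s in simp_all)
  qed
  \<comment> \<open>Subtracting the Lagrangian from its explicit affine part isolates the conjugate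
    and shows at the same time that it is differentiable in this direction.\<close>
  then have "((\<lambda>t. t * inner2 q (grad w0) + c -
      (- conj_energy (\<lambda>x. ?y x + t *\<^sub>R q x) + t * inner2 q (grad w0) + c)) has_real_derivative inner2 q (grad w0) - 0) (at 0)"
    by (intro DERIV_diff) (auto intro!: derivative_eq_intros)
  then have "((\<lambda>t. conj_energy (\<lambda>x. ?y x + t *\<^sub>R q x)) has_real_derivative inner2 q (grad w0)) (at 0)"
    by simp
  then show "conj_energy ?y + inner2 q (grad w0) \<le> conj_energy (\<lambda>x. ?y x + q x)"
    by (rule conj_energy_subgradient[OF L2_add[OF z0 Q0] q])
qed

text \<open>With \<zeta> equal to \<open>A\<close> applied to \<xi>, the inverse form at
  \<open>z0 + t \<zeta>\<close> is a quadratic polynomial in \<open>t\<close>, and the first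
  variation is the integral of \<omega> times the squared residual \<open>R\<close>.\<close>

lemma z0_eq: "AE x in leb. z0 x = NKf N0 x *v grad w0 x"
proof -
  let ?g = "grad w0"
  define R where "R x = z0 x - NKf N0 x *v ?g x" for x
  \<comment> \<open>The first factor keeps \<open>A\<close> applied to \<xi> bounded, the second
    keeps \<xi> bounded. Both fields have norm at most 1, hence lie in \<open>L2\<close> on the
    bounded domain.\<close>
  define \<omega> where "\<omega> x = 1 / ((1 + norm (NKf N0 x)) * (1 + norm (R x)))" for x
  define \<xi> where "\<xi> x = \<omega> x *\<^sub>R R x" for x
  define \<zeta> where "\<zeta> x = NKf N0 x *v \<xi> x" for x
  have NKm: "(\<lambda>x. NKf N0 x) \<in> borel_measurable leb" by (rule NK_borel_measurable[OF N0])
  have Rm: "R \<in> borel_measurable leb"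
    unfolding R_def by (intro borel_measurable_diff borel_measurable_matrix_vector_mult NKm L2_measurable z0 grad_w0)
  have \<xi>m: "\<xi> \<in> borel_measurable leb"
    unfolding \<xi>_def \<omega>_def using NKm Rm by measurable
  have \<zeta>m: "\<zeta> \<in> borel_measurable leb"
    unfolding \<zeta>_def by (intro borel_measurable_matrix_vector_mult NKm \<xi>m)
  have \<xi>_le: "(1 + norm (NKf N0 x)) * norm (\<xi> x) \<le> 1" for x
  proof -
    have "1 + norm (NKf N0 x) \<noteq> 0" using norm_ge_zero[of "NKf N0 x"] by linarith
    then have "(1 + norm (NKf N0 x)) * \<omega> x = 1 / (1 + norm (R x))" by (simp add: \<omega>_def)
    moreover have "norm (\<xi> x) = \<omega> x * norm (R x)" by (simp add: \<xi>_def \<omega>_def)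
    ultimately have "(1 + norm (NKf N0 x)) * norm (\<xi> x) = norm ((1 / (1 + norm (R x))) *\<^sub>R R x)"
      by (simp flip: mult.assoc)
    then show ?thesis using norm_scaled_le_1[of "R x"] by simp
  qed
  have "norm (\<xi> x) \<le> (1 + norm (NKf N0 x)) * norm (\<xi> x)" for x
    by (simp add: algebra_simps)
  then have \<xi>: "\<xi> \<in> L2 \<Omega>"
    using \<xi>_le order_trans by (intro L2_bounded[OF \<xi>m lmeasurable_domain, where C=1]) blast
  have "norm (\<zeta> x) \<le> (1 + norm (NKf N0 x)) * norm (\<xi> x)" for x
    using norm_matrix_vector_mult_le[of "NKf N0 x" "\<xi> x"] by (simp add: \<zeta>_def distrib_right add_increasing)
  then have \<zeta>: "\<zeta> \<in> L2 \<Omega>"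
    using \<xi>_le order_trans by (intro L2_bounded[OF \<zeta>m lmeasurable_domain, where C=1]) blast
  obtain f where f: "integrable leb f"
    "AE x in leb. z0 x \<bullet> (matrix_inv (NKf N0 x) *v z0 x) = f x"
    by (rule inv_NK_form_finite[OF pos_N0 N0 z0 form_z0_finite])
  define s where "s t = (LINT x|leb. f x) + 2 * t * inner2 z0 \<xi> + t\<^sup>2 * inner2 \<zeta> \<xi>" for t
  have form: "inv_NK_form \<Omega> K N0 (\<lambda>x. z0 x + t *\<^sub>R \<zeta> x) = ereal (s t)" for t
  proof -
    note int = f(1) L2_inner_integrable[OF z0 \<xi>] L2_inner_integrable[OF \<zeta> \<xi>]
    have "inv_NK_form \<Omega> K N0 (\<lambda>x. z0 x + t *\<^sub>R \<zeta> x) =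
        ereal (LINT x|leb. f x + 2 * t * (z0 x \<bullet> \<xi> x) + t\<^sup>2 * (\<zeta> x \<bullet> \<xi> x))"
    proof (rule inv_NK_form_eq[OF pos_N0])
      show "AE x in leb. (z0 x + t *\<^sub>R \<zeta> x) \<bullet> (matrix_inv (NKf N0 x) *v (z0 x + t *\<^sub>R \<zeta> x)) =
          f x + 2 * t * (z0 x \<bullet> \<xi> x) + t\<^sup>2 * (\<zeta> x \<bullet> \<xi> x)"
        using pos_N0 f(2)
      proof eventually_elim
        case (elim x)
        let ?B = "matrix_inv (NKf N0 x)"
        have B: "?B *v \<zeta> x = \<xi> x" unfolding \<zeta>_def by (rule pos_def_matrix_inv_mult(1)[OF elim(1)])
        have Bz: "\<zeta> x \<bullet> (?B *v z0 x) = z0 x \<bullet> \<xi> x"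
          using pos_def_matrix_inv_commute[OF elim(1), of "\<zeta> x" "z0 x"] B by (simp add: inner_commute)
        show ?case
          by (simp add: matrix_vector_right_distrib matrix_vector_mult_scaleR B Bz elim(2)
              inner_add_left inner_add_right power2_eq_square algebra_simps)
      qed
      show "integrable leb (\<lambda>x. f x + 2 * t * (z0 x \<bullet> \<xi> x) + t\<^sup>2 * (\<zeta> x \<bullet> \<xi> x))"
        using int by (intro Bochner_Integration.integrable_add integrable_mult_right)
    qed
    also have "(LINT x|leb. f x + 2 * t * (z0 x \<bullet> \<xi> x) + t\<^sup>2 * (\<zeta> x \<bullet> \<xi> x)) = s t"
      using int by (simp add: s_def l2_inner_def)
    finally show ?thesis .
  qed
  define c where "c = - conj_energy (\<lambda>x. z0 x + Q0 x)
    - 1/2 * inner2 N0 (\<lambda>x. Hinv (N0 x)) + inner2 (wjac \<Omega> v0) N0 + inner2 ?g Q0"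
  have "((\<lambda>t. c + 1/2 * s t - t * inner2 ?g \<zeta>) has_real_derivative 0) (at 0)"
  proof -
    have eq: "(\<lambda>t. - conj_energy (\<lambda>x. z0 x + t *\<^sub>R \<zeta> x + (Q0 x + t *\<^sub>R (- \<zeta> x))) + 1/2 * s t
      - 1/2 * inner2 (\<lambda>x. N0 x + t *\<^sub>R 0) (\<lambda>x. Hinv (N0 x + t *\<^sub>R 0))
      + inner2 (wjac \<Omega> v0) (\<lambda>x. N0 x + t *\<^sub>R 0) + inner2 ?g (\<lambda>x. Q0 x + t *\<^sub>R (- \<zeta> x))) =
      (\<lambda>t. c + 1/2 * s t - t * inner2 ?g \<zeta>)"
      using Q0 \<zeta> grad_w0
      by (simp add: l2_inner_diff_right L2_scaleR l2_inner_scaleR_right c_def algebra_simps)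
    show ?thesis
      unfolding eq[symmetric]
      by (rule variation[OF L2_minus[OF \<zeta>] L2_zero \<zeta>]) (use pos_N0 form in simp_all)
  qed
  moreover have "((\<lambda>t. c + 1/2 * s t - t * inner2 ?g \<zeta>) has_real_derivative
      inner2 z0 \<xi> - inner2 ?g \<zeta>) (at 0)"
    unfolding s_def by (auto intro!: derivative_eq_intros)
  ultimately have "inner2 z0 \<xi> - inner2 ?g \<zeta> = 0" by (rule DERIV_unique[symmetric])
  moreover have "inner2 z0 \<xi> - inner2 ?g \<zeta> = (LINT x|leb. z0 x \<bullet> \<xi> x - ?g x \<bullet> \<zeta> x)"
    unfolding l2_inner_def
    by (rule Bochner_Integration.integral_diff[symmetric]) (intro L2_inner_integrable z0 \<xi> grad_w0 \<zeta>)+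
  ultimately have int0: "(LINT x|leb. z0 x \<bullet> \<xi> x - ?g x \<bullet> \<zeta> x) = 0" by simp
  have eq: "AE x in leb. z0 x \<bullet> \<xi> x - ?g x \<bullet> \<zeta> x = \<omega> x * (R x \<bullet> R x)"
    using pos_N0
  proof eventually_elim
    case (elim x)
    \<comment> \<open>Symmetry of \<open>A\<close> moves it onto the gradient, so the difference of
      the two pairings becomes \<open>R\<close> paired with \<xi>.\<close>
    have "?g x \<bullet> \<zeta> x = (NKf N0 x *v ?g x) \<bullet> \<xi> x"
      unfolding \<zeta>_def using symmetric_matrix_inner[of "NKf N0 x" "?g x" "\<xi> x"] elim
      by (simp add: pos_def_matrix_def)
    then show ?case by (simp add: R_def \<xi>_def inner_diff_left flip: right_diff_distrib)
  qed
  have \<omega>_pos: "\<omega> x > 0" for x by (simp add: \<omega>_def add_pos_nonneg)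
  have "integrable leb (\<lambda>x. z0 x \<bullet> \<xi> x - ?g x \<bullet> \<zeta> x)"
    by (intro Bochner_Integration.integrable_diff L2_inner_integrable z0 \<xi> grad_w0 \<zeta>)
  moreover have "AE x in leb. 0 \<le> z0 x \<bullet> \<xi> x - ?g x \<bullet> \<zeta> x"
    using eq by eventually_elim (simp add: less_imp_le[OF \<omega>_pos])
  ultimately have "AE x in leb. z0 x \<bullet> \<xi> x - ?g x \<bullet> \<zeta> x = 0"
    using int0 integral_nonneg_eq_0_iff_AE by blast
  with eq show ?thesis
  proof eventually_elim
    case (elim x)
    then show ?case using \<omega>_pos[of x] by (simp add: R_def)
  qed
qed

text \<open>Varying \<open>N\<close> by \<open>M\<close>, \<open>z\<close> by \<open>- M *v grad w0\<close> and \<open>Q\<close> by the opposite keeps the conjugate fixed and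
  makes the inverse form affine along the variation.\<close>

lemma strain_eq_Hinv: "AE x in leb. strain \<Omega> (v0, w0) x = Hinv (N0 x)"
proof -
  let ?g = "grad w0" and ?s = "strain \<Omega> (v0, w0)"
  define R where "R x = ?s x - Hinv (N0 x)" for x
  \<comment> \<open>The eigenvalue bound keeps \<open>N0 + t M\<close> admissible for \<bar>t\<bar>
    < 1, the cap 1 keeps \<open>M\<close> bounded, and the maximum with 0 makes the weight
    nonnegative also on the null set where \<open>A\<close> is not positive definite.\<close>
  define \<omega> where "\<omega> x = min 1 (max 0 (eig_bound (NKf N0 x))) / (1 + norm (R x))" for x
  define M where "M x = \<omega> x *\<^sub>R R x" for x
  have R: "R \<in> L2 \<Omega>" unfolding R_def[abs_def] by (intro L2_diff strain_L2 Hinv_L2 u0 N0)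
  have R_sym: "transpose (R x) = R x" for x
    by (simp add: R_def transpose_add_scale transpose_strain transpose_Hinv)
  have M_sym: "transpose (M x) = M x" for x by (simp add: M_def transpose_add_scale R_sym)
  have NKm: "(\<lambda>x. NKf N0 x) \<in> borel_measurable leb" by (rule NK_borel_measurable[OF N0])
  have "(\<lambda>x. N0 x $ i $ j) \<in> borel_measurable leb" for i j
    by (rule L2_measurable[OF L2_nth[OF L2_nth[OF N0]]])
  then have "(\<lambda>x. eig_bound (NKf N0 x)) \<in> borel_measurable leb"
    unfolding eig_bound_def NK_def by (simp add: mat_def)
  then have Mm: "M \<in> borel_measurable leb"
    unfolding M_def \<omega>_def using L2_measurable[OF R] by measurable
  have \<omega>_nonneg: "\<omega> x \<ge> 0" for x by (simp add: \<omega>_def)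
  have M_le: "norm (M x) \<le> min 1 (max 0 (eig_bound (NKf N0 x)))" for x
  proof -
    let ?m = "min 1 (max 0 (eig_bound (NKf N0 x)))"
    have "norm (M x) = ?m * norm ((1 / (1 + norm (R x))) *\<^sub>R R x)"
      by (simp add: M_def \<omega>_def abs_mult)
    also have "\<dots> \<le> ?m * 1"
      using norm_scaled_le_1[of "R x"] by (intro mult_left_mono) auto
    finally show ?thesis by simp
  qed
  have M: "M \<in> L2 \<Omega>"
    using M_le by (intro L2_bounded[OF Mm lmeasurable_domain, where C=1]) auto
  define q where "q x = M x *v ?g x" for x
  have q: "q \<in> L2 \<Omega>"
  proof (rule L2_I[OF _ L2_integrable[OF grad_w0]])
    show "q \<in> borel_measurable leb"
      unfolding q_def by (intro borel_measurable_matrix_vector_mult Mm L2_measurable grad_w0)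
    have "norm (q x) \<le> norm (?g x)" for x
    proof -
      have "norm (q x) \<le> norm (M x) * norm (?g x)" unfolding q_def by (rule norm_matrix_vector_mult_le)
      also have "\<dots> \<le> 1 * norm (?g x)" using M_le[of x] by (intro mult_right_mono) auto
      finally show ?thesis by simp
    qed
    then show "AE x in leb. (norm (q x))\<^sup>2 \<le> (norm (?g x))\<^sup>2"
      by (intro always_eventually allI power_mono) auto
  qed
  have pos: "AE x in leb. pos_def_matrix (NK K (N0 x + t *\<^sub>R M x))" if t: "\<bar>t\<bar> < 1" for t
    using pos_N0
  proof eventually_elim
    case (elim x)
    have "norm (t *\<^sub>R M x) < eig_bound (NKf N0 x)"
    proof (cases "M x = 0")
      case True
      then show ?thesis using eig_bound_pos[OF elim] by simp
    next
      case False
      then have "norm (t *\<^sub>R M x) < 1 * norm (M x)"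
        using t unfolding norm_scaleR by (intro mult_strict_right_mono) auto
      also have "\<dots> \<le> eig_bound (NKf N0 x)" using M_le[of x] eig_bound_pos[OF elim] by simp
      finally show ?thesis .
    qed
    then show ?case
      unfolding NK_diff by (intro pos_def_matrix_perturb elim) (simp_all add: transpose_add_scale M_sym)
  qed
  define m where "m = inner2 ?g q"
  define s where "s t = NK_energy N0 w0 - t * m" for t
  have form: "inv_NK_form \<Omega> K (\<lambda>x. N0 x + t *\<^sub>R M x) (\<lambda>x. z0 x + t *\<^sub>R (- q x)) = ereal (s t)"
    if t: "\<bar>t\<bar> < 1" for t
  proof -
    note int = NK_form_integrable[OF N0 w0] L2_inner_integrable[OF grad_w0 q]
    have "inv_NK_form \<Omega> K (\<lambda>x. N0 x + t *\<^sub>R M x) (\<lambda>x. z0 x + t *\<^sub>R (- q x)) =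
        ereal (LINT x|leb. ?g x \<bullet> (NKf N0 x *v ?g x) - t * (?g x \<bullet> q x))"
    proof (rule inv_NK_form_eq[OF pos[OF t]])
      show "AE x in leb. (z0 x + t *\<^sub>R (- q x)) \<bullet>
          (matrix_inv (NK K (N0 x + t *\<^sub>R M x)) *v (z0 x + t *\<^sub>R (- q x))) =
          ?g x \<bullet> (NKf N0 x *v ?g x) - t * (?g x \<bullet> q x)"
        using pos[OF t] z0_eq
      proof eventually_elim
        case (elim x)
        \<comment> \<open>The varied \<open>z\<close> is the varied matrix applied to the gradient,
          so the inverse cancels at every \<open>t\<close>.\<close>
        have "z0 x + t *\<^sub>R (- q x) = NK K (N0 x + t *\<^sub>R M x) *v ?g x"
          by (simp add: elim(2) NK_diff q_def matrix_vector_mult_diff_rdistrib scaleR_matrix_vector_assoc)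
        then show ?case
          by (simp add: pos_def_matrix_inv_mult[OF elim(1)])
            (simp add: NK_diff q_def matrix_vector_mult_diff_rdistrib inner_diff_left inner_diff_right
              inner_commute[of "?g x"] flip: scaleR_matrix_vector_assoc)
      qed
      show "integrable leb (\<lambda>x. ?g x \<bullet> (NKf N0 x *v ?g x) - t * (?g x \<bullet> q x))"
        using int by (intro Bochner_Integration.integrable_diff integrable_mult_right)
    qed
    also have "(LINT x|leb. ?g x \<bullet> (NKf N0 x *v ?g x) - t * (?g x \<bullet> q x)) = s t"
      using int by (simp add: s_def m_def NK_energy_def l2_inner_def)
    finally show ?thesis .
  qed
  define a b where "a = inner2 M (\<lambda>x. Hinv (N0 x))" and "b = inner2 M (\<lambda>x. Hinv (M x))"
  have quad: "inner2 (\<lambda>x. N0 x + t *\<^sub>R M x) (\<lambda>x. Hinv (N0 x + t *\<^sub>R M x)) =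
      inner2 N0 (\<lambda>x. Hinv (N0 x)) + 2 * t * a + t\<^sup>2 * b" for t
  proof -
    have "inner2 N0 (\<lambda>x. Hinv (M x)) = a"
      unfolding a_def using M_sym sym_N0 by (intro Hinv_inner_commute N0 M) auto
    then show ?thesis
      using N0 M Hinv_L2[OF N0] Hinv_L2[OF M]
      by (simp add: tensor_app_add tensor_app_scaleR l2_inner_add_left l2_inner_add_right
          l2_inner_scaleR_left l2_inner_scaleR_right L2_add L2_scaleR a_def[symmetric] b_def[symmetric]
          power2_eq_square algebra_simps)
  qed
  define d where "d = inner2 (wjac \<Omega> v0) M"
  define c where "c = - conj_energy (\<lambda>x. z0 x + Q0 x) - 1/2 * inner2 N0 (\<lambda>x. Hinv (N0 x))
    + inner2 (wjac \<Omega> v0) N0 + inner2 ?g Q0"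
  have "((\<lambda>t. c + 1/2 * s t - t * a - t\<^sup>2 * b / 2 + t * d + t * m) has_real_derivative 0) (at 0)"
  proof -
    have eq: "(\<lambda>t. - conj_energy (\<lambda>x. z0 x + t *\<^sub>R (- q x) + (Q0 x + t *\<^sub>R q x)) + 1/2 * s t
      - 1/2 * inner2 (\<lambda>x. N0 x + t *\<^sub>R M x) (\<lambda>x. Hinv (N0 x + t *\<^sub>R M x))
      + inner2 (wjac \<Omega> v0) (\<lambda>x. N0 x + t *\<^sub>R M x) + inner2 ?g (\<lambda>x. Q0 x + t *\<^sub>R q x)) =
      (\<lambda>t. c + 1/2 * s t - t * a - t\<^sup>2 * b / 2 + t * d + t * m)"
      unfolding quad
      using Q0 q grad_w0 N0 M wjac_L2[OF u0]
      by (simp add: l2_inner_add_right L2_scaleR l2_inner_scaleR_right c_def d_def m_def)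
        (simp add: fun_eq_iff field_simps)
    show ?thesis
      unfolding eq[symmetric]
      by (rule variation[OF q M L2_minus[OF q]]) (use pos form in simp_all)
  qed
  moreover have "((\<lambda>t. c + 1/2 * s t - t * a - t\<^sup>2 * b / 2 + t * d + t * m) has_real_derivative
      - a + d + m / 2) (at 0)"
    unfolding s_def by (auto intro!: derivative_eq_intros)
  \<comment> \<open>Half of \<open>s\<close> contributes \<open>- m / 2\<close> and the variation of
    \<open>Q\<close> contributes \<open>m\<close>. The remaining \<open>m / 2\<close> is the
    quadratic part of the strain paired with \<open>M\<close>, so the sum is the pairing of
    \<open>R\<close> with \<open>M\<close>.\<close>
  ultimately have "- a + d + m / 2 = 0" by (rule DERIV_unique[symmetric])
  moreover have "m = inner2 (\<lambda>x. outer (?g x) (?g x)) M"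
    by (simp add: m_def l2_inner_def q_def inner_matrix_vector inner_commute)
  moreover have "inner2 ?s M = d + 1/2 * inner2 (\<lambda>x. outer (?g x) (?g x)) M"
    unfolding d_def using M_sym by (intro strain_inner u0 M) auto
  moreover have "inner2 R M = inner2 ?s M - a"
    unfolding R_def a_def l2_inner_commute[of \<Omega> M]
    by (intro l2_inner_diff_left strain_L2 u0 Hinv_L2 N0 M)
  ultimately have "inner2 R M = 0" by simp
  then have int0: "(LINT x|leb. R x \<bullet> M x) = 0" by (simp add: l2_inner_def)
  have "AE x in leb. R x \<bullet> M x = 0"
    using integral_nonneg_eq_0_iff_AE[OF L2_inner_integrable[OF R M]] int0 \<omega>_nonneg
    by (simp add: M_def)
  with pos_N0 show ?thesis
  proof eventually_elim
    case (elim x)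
    have "\<omega> x > 0"
      unfolding \<omega>_def using eig_bound_pos[OF elim(1)] by (simp add: add_pos_nonneg)
    then show ?case using elim(2) by (simp add: M_def R_def)
  qed
qed

section \<open>Equality of the values and minimality of \<open>z0\<close>\<close>

lemma form_z0_eq: "inv_NK_form \<Omega> K N0 z0 = ereal (NK_energy N0 w0)"
  unfolding NK_energy_def
proof (rule inv_NK_form_eq[OF pos_N0 NK_form_integrable[OF N0 w0]])
  show "AE x in leb. z0 x \<bullet> (matrix_inv (NKf N0 x) *v z0 x) = grad w0 x \<bullet> (NKf N0 x *v grad w0 x)"
    using pos_N0 z0_eq by eventually_elim (simp add: pos_def_matrix_inv_mult inner_commute)
qed

lemma inner_z0: "inner2 z0 (grad w0) = NK_energy N0 w0"
  unfolding NK_energy_def l2_inner_def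
proof (rule integral_cong_AE)
  show "AE x in leb. z0 x \<bullet> grad w0 x = grad w0 x \<bullet> (NKf N0 x *v grad w0 x)"
    using z0_eq by eventually_elim (simp add: inner_commute)
qed (use L2_inner_integrable[OF z0 grad_w0] NK_form_integrable[OF N0 w0] in \<open>auto intro: borel_measurable_integrable\<close>)

lemma J_u0_eq_J_star: "ereal (J \<Omega> H h p P (v0, w0)) = J_star \<Omega> H h K (Q0, N0) z0"
proof -
  have "inner2 (\<lambda>x. z0 x + Q0 x) (grad w0) = NK_energy N0 w0 + inner2 Q0 (grad w0)"
    using l2_inner_add_left[OF z0 Q0 grad_w0] inner_z0 by simp
  then show ?thesis
    unfolding J_star_eq[OF Q0 z0 form_z0_eq] J_decomposition[OF A123 u0] conj_energy_z0_Q0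
      strain_gap_eq_0[OF u0 N0 sym_N0 strain_eq_Hinv]
    by (simp add: algebra_simps)
qed

text \<open>Expanding around \<open>z0\<close>, half the inverse form yields the linear term \<zeta>
  paired with the gradient of \<open>w0\<close>, and the conjugate yields at most the same term.
  They cancel, and \<open>J_hat\<close> at \<zeta> is a lower bound for the increment; an infinite
  form makes the claim trivial.\<close>

lemma J_star_z0_le:
  assumes z: "z \<in> L2 \<Omega>"
  shows "J_star \<Omega> H h K (Q0, N0) z0 \<le> J_star \<Omega> H h K (Q0, N0) z"
proof (cases "inv_NK_form \<Omega> K N0 z = \<infinity>")
  case True
  then show ?thesis by (simp add: J_star_def G_star_def F_star_eq[OF z Q0])
next
  case False
  let ?g = "grad w0"
  define \<zeta> where "\<zeta> x = z x - z0 x" for x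
  have \<zeta>: "\<zeta> \<in> L2 \<Omega>" unfolding \<zeta>_def[abs_def] using z z0 by (rule L2_diff)
  obtain f where f: "integrable leb f"
    "AE x in leb. z x \<bullet> (matrix_inv (NKf N0 x) *v z x) = f x"
    using inv_NK_form_finite[OF pos_N0 N0 z False] by blast
  note form_z = inv_NK_form_eq[OF pos_N0 f]
  note int = f(1) NK_form_integrable[OF N0 w0] L2_inner_integrable[OF \<zeta> grad_w0]
  \<comment> \<open>The inverse form at \<zeta>: since the inverse of \<open>A\<close> maps
    \<open>z0\<close> to the gradient, the cross terms reduce to pairings of \<zeta> with that
    gradient.\<close>
  define b where "b = (LINT x|leb. f x) - NK_energy N0 w0 - 2 * inner2 \<zeta> ?g"
  have form_\<zeta>: "inv_NK_form \<Omega> K N0 \<zeta> = ereal b"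
  proof -
    have "inv_NK_form \<Omega> K N0 \<zeta> =
        ereal (LINT x|leb. f x - ?g x \<bullet> (NKf N0 x *v ?g x) - 2 * (\<zeta> x \<bullet> ?g x))"
    proof (rule inv_NK_form_eq[OF pos_N0])
      show "integrable leb (\<lambda>x. f x - ?g x \<bullet> (NKf N0 x *v ?g x) - 2 * (\<zeta> x \<bullet> ?g x))"
        using int by (intro Bochner_Integration.integrable_diff integrable_mult_right)
      show "AE x in leb. \<zeta> x \<bullet> (matrix_inv (NKf N0 x) *v \<zeta> x) =
          f x - ?g x \<bullet> (NKf N0 x *v ?g x) - 2 * (\<zeta> x \<bullet> ?g x)"
        using pos_N0 f(2) z0_eq
      proof eventually_elim
        case (elim x)
        let ?B = "matrix_inv (NKf N0 x)"
        have B0: "?B *v z0 x = ?g x" using elim(3) pos_def_matrix_inv_mult(1)[OF elim(1)] by simp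
        have "z x = \<zeta> x + z0 x" by (simp add: \<zeta>_def)
        then have "f x = (\<zeta> x + z0 x) \<bullet> (?B *v \<zeta> x + ?g x)"
          using elim(2) B0 by (simp add: matrix_vector_right_distrib)
        moreover have "z0 x \<bullet> (?B *v \<zeta> x) = ?g x \<bullet> \<zeta> x"
          using pos_def_matrix_inv_commute[OF elim(1), of "z0 x" "\<zeta> x"] B0 by simp
        moreover have "z0 x \<bullet> ?g x = ?g x \<bullet> (NKf N0 x *v ?g x)"
          using elim(3) by (simp add: inner_commute)
        ultimately show ?case
          by (simp add: inner_add_left inner_add_right inner_commute)
      qed
    qed
    also have "(LINT x|leb. f x - ?g x \<bullet> (NKf N0 x *v ?g x) - 2 * (\<zeta> x \<bullet> ?g x)) = b"
      using int by (simp add: b_def NK_energy_def l2_inner_def)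
    finally show ?thesis .
  qed
  have ge: "conj_energy \<zeta> \<le> 1/2 * b"
  \<comment> \<open>Strict positivity in \<open>A4\<close> excludes fields vanishing almost
    everywhere; for those the conjugate is at most 0 and the form is nonnegative.\<close>
  proof (cases "AE x in leb. \<zeta> x = 0")
    case True
    have "conj_energy \<zeta> \<le> 0"
    proof (rule conj_energy_least)
      fix w assume w: "w \<in> V"
      have "inner2 \<zeta> (grad w) = inner2 (\<lambda>x. 0) (grad w)"
        using True by (intro l2_inner_cong_AE \<zeta> L2_zero grad_L2 w) auto
      then show "inner2 \<zeta> (grad w) - 1/2 * energy w w \<le> 0"
        using energy_nonneg[of w] by (simp add: l2_inner_def)
    qed
    moreover have "0 \<le> ereal b"
      unfolding form_\<zeta>[symmetric] inv_NK_form_def by simp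
    ultimately show ?thesis by simp
  next
    case False
    have "(Q0, N0) \<in> A4 \<Omega> H h K" using A0 by (simp add: A_star_def)
    then have "J_hat \<Omega> H h K N0 \<zeta> > 0" using False \<zeta> by (simp add: A4_def)
    then show ?thesis
      by (simp add: J_hat_def form_\<zeta> F_star_eq[OF \<zeta> L2_zero])
  qed
  have y: "(\<lambda>x. z x + Q0 x) = (\<lambda>x. (z0 x + Q0 x) + \<zeta> x)" by (simp add: \<zeta>_def add.commute)
  have "conj_energy (\<lambda>x. z x + Q0 x) \<le> conj_energy (\<lambda>x. z0 x + Q0 x) + inner2 \<zeta> ?g + conj_energy \<zeta>"
    unfolding y by (rule conj_energy_add_le[OF L2_add[OF z0 Q0] w0 \<zeta> conj_energy_z0_Q0])
  with ge show ?thesis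
    unfolding J_star_eq[OF Q0 z0 form_z0_eq] J_star_eq[OF Q0 z form_z] b_def
    by simp
qed

lemma J_tilde_eq_J_star: "J_tilde \<Omega> H h K (Q0, N0) = J_star \<Omega> H h K (Q0, N0) z0"
  unfolding J_tilde_def
  by (rule antisym) (auto intro: INF_lower z0 INF_greatest J_star_z0_le)

end

end

theorem theorem4p1:
  fixes \<Omega> :: "(real^2) set" and H :: tensor4 and h K :: real
    and p :: "real^2 \<Rightarrow> real^2" and P :: "real^2 \<Rightarrow> real"
  assumes "open \<Omega>" "bounded \<Omega>" "connected \<Omega>" "lipschitz_boundary \<Omega>"
    and "symmetric_tensor H" "pos_def_tensor H"
    and "h > 0" "K > 0"
    and "p \<in> L2 \<Omega>" "P \<in> L2 \<Omega>"
  shows "(INF u\<in>U \<Omega>. ereal (J \<Omega> H h p P u)) \<ge>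
           (SUP v\<in>A_star \<Omega> H h K p P. INF z\<in>L2 \<Omega>. - F_star \<Omega> H h K z (fst v) + G_star \<Omega> H K z (snd v))
    \<and> (\<forall>v0\<in>A_star \<Omega> H h K p P. \<forall>z0\<in>L2 \<Omega>. \<forall>u0\<in>U \<Omega>.
         first_variation_vanishes \<Omega> H h K p P v0 z0 u0 \<longrightarrow>
           (\<forall>u\<in>U \<Omega>. J \<Omega> H h p P u0 \<le> J \<Omega> H h p P u)
         \<and> (\<forall>v\<in>A_star \<Omega> H h K p P. J_tilde \<Omega> H h K v \<le> J_tilde \<Omega> H h K v0)
         \<and> ereal (J \<Omega> H h p P u0) = J_tilde \<Omega> H h K v0
         \<and> J_tilde \<Omega> H h K v0 = J_star \<Omega> H h K v0 z0)"
proof -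
  interpret plate \<Omega> H h K p P
    using assms by unfold_locales
  have weak: "J_tilde \<Omega> H h K v \<le> ereal (J \<Omega> H h p P u)" if "v \<in> A_star \<Omega> H h K p P" "u \<in> U \<Omega>" for v u
    using that weak_duality[of "fst v" "snd v" "fst u" "snd u"] by (simp add: A_star_def)
  have "(SUP v\<in>A_star \<Omega> H h K p P. J_tilde \<Omega> H h K v) \<le> (INF u\<in>U \<Omega>. ereal (J \<Omega> H h p P u))"
    by (intro SUP_least INF_greatest weak)
  moreover have "(\<forall>u\<in>U \<Omega>. J \<Omega> H h p P u0 \<le> J \<Omega> H h p P u)
         \<and> (\<forall>v\<in>A_star \<Omega> H h K p P. J_tilde \<Omega> H h K v \<le> J_tilde \<Omega> H h K v0)
         \<and> ereal (J \<Omega> H h p P u0) = J_tilde \<Omega> H h K v0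
         \<and> J_tilde \<Omega> H h K v0 = J_star \<Omega> H h K v0 z0"
    if v0: "v0 \<in> A_star \<Omega> H h K p P" and z0: "z0 \<in> L2 \<Omega>" and u0: "u0 \<in> U \<Omega>"
      and fv: "first_variation_vanishes \<Omega> H h K p P v0 z0 u0" for v0 z0 u0
  proof -
    obtain Q0 N0 v w where eq: "v0 = (Q0, N0)" "u0 = (v, w)" by (metis surj_pair)
    have star: "J_tilde \<Omega> H h K v0 = J_star \<Omega> H h K v0 z0"
      using J_tilde_eq_J_star that unfolding eq by blast
    have J: "ereal (J \<Omega> H h p P u0) = J_tilde \<Omega> H h K v0"
      unfolding star unfolding eq using J_u0_eq_J_star that unfolding eq by blast
    \<comment> \<open>The primal value at \<open>u0\<close> equals the dual value at
      \<open>v0\<close>, so weak duality with one of the two held fixed yields the minimum and the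
      maximum.\<close>
    have "J \<Omega> H h p P u0 \<le> J \<Omega> H h p P u" if "u \<in> U \<Omega>" for u
      using weak[OF v0 that] unfolding J[symmetric] by simp
    moreover have "J_tilde \<Omega> H h K v \<le> J_tilde \<Omega> H h K v0" if "v \<in> A_star \<Omega> H h K p P" for v
      using weak[OF that u0] unfolding J .
    ultimately show ?thesis using star J by blast
  qed
  ultimately show ?thesis
    unfolding J_tilde_def J_star_def by blast
qed

end
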